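(* Let $A=\{H_1,\dots,H_m\}$ be a hyperplane configuration in $\mathbb{C}^n$ with $H_i=V(\alpha_i)$ pairwise distinct, $\alpha=\prod_{i=1}^m\alpha_i$, and let $\beta=(\beta_1,\dots,\beta_m)\in\mathbb{C}^m$. Let $\pi:\tilde{\mathbb{C}}^n\to\mathbb{C}^n$ be a resolution of the singularities of $V(\alpha)$ with irreducible exceptional components $E_1,\dots,E_s$, and let the integers $r^i_j$ be defined by $\mathrm{Div}\,\pi^*(\alpha_i)=\tilde H_i+r^i_1E_1+\dots+r^i_sE_s$, where $\tilde H_i$ is the proper transform of $H_i$. If $$\beta_1,\dots,\beta_m,\ \sum_{i=1}^m r^i_1\beta_i,\ \dots,\ \sum_{i=1}^m r^i_s\beta_i\ \in\ \mathbb{C}\setminus\mathbb{Z},$$ then the $A_n$-module $M_\alpha^\beta$ is irreducible.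
   Context: $A_n$ is the $n$-th Weyl algebra over $\mathbb{C}$, and $\mathbb{C}[x]=\mathbb{C}[x_1,\dots,x_n]$. A hyperplane configuration in $\mathbb{C}^n$ is a finite set of affine hyperplanes $H_i=V(\alpha_i)$, where each $\alpha_i$ is a polynomial of degree one. $M_\alpha^\beta$ is the free rank one module over the localization $\mathbb{C}[x]_\alpha$ on a generator denoted $\alpha^\beta$, made into an $A_n$-module by extending $\partial_j(\alpha^\beta)=\sum_{i=1}^m\beta_i\frac{\partial_j(\alpha_i)}{\alpha_i}\alpha^\beta$, $j=1,\dots,n$, by the Leibniz rule. Resolution of the singularities of $V(\alpha)$: $\tilde{\mathbb{C}}^n$ is a smooth variety, $\pi:\tilde{\mathbb{C}}^n\to\mathbb{C}^n$ is a proper birational morphism, with exceptional divisor $E=\bigcup_{i=1}^sE_i$ ($E_i$ irreducible) and center $Z=\pi(E)\subset V(\alpha)$, so that $\pi$ restricts to an isomorphism $\tilde{\mathbb{C}}^n\setminus E\cong\mathbb{C}^n\setminus Z$. Moreover: (a) $\tilde{\mathbb{C}}^n$ has a finite cover by affine open subsets, each isomorphic to an open affine subvariety of $\mathbb{C}^n$; (b) $\pi^{-1}V(\alpha)$ is a normal crossing divisor with components among the $\tilde H_i$ and $E_j$: at each point $p$, local equations of those $\tilde H_i$ and $E_j$ passing through $p$ form part of a regular system of parameters. *)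

theory Defs
  imports "HOL-Analysis.Analysis" "HOL-Library.Poly_Mapping" "HOL-Library.Extended_Nat"
    "HOL-Computational_Algebra.Fraction_Field"
begin

lifting_forget poly_mapping.lifting

section \<open>Polynomials and rational functions\<close>

text \<open>
  Polynomials with complex coefficients in variables indexed by a type \<open>'i\<close>: finitely supported
  families of coefficients, indexed by exponent vectors. A linear order on \<open>'i\<close> is what
  \<^theory>\<open>HOL-Library.Poly_Mapping\<close> needs to make this an integral domain, so that its field of
  fractions is available.
\<close>

type_synonym 'i mpoly = "('i \<Rightarrow>\<^sub>0 nat) \<Rightarrow>\<^sub>0 complex"
type_synonym 'i ratfun = "'i mpoly fract"

definition poly_const :: "complex \<Rightarrow> 'i mpoly" where
  "poly_const c = Poly_Mapping.single 0 c"

definition poly_var :: "'i \<Rightarrow> 'i mpoly" where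
  "poly_var i = Poly_Mapping.single (Poly_Mapping.single i 1) 1"

definition eval_poly :: "'i mpoly \<Rightarrow> ('i \<Rightarrow> complex) \<Rightarrow> complex" where
  "eval_poly p x = (\<Sum>m\<in>Poly_Mapping.keys p. Poly_Mapping.lookup p m * (\<Prod>i\<in>Poly_Mapping.keys m. x i ^ Poly_Mapping.lookup m i))"

definition total_degree :: "'i mpoly \<Rightarrow> nat" where
  "total_degree p = Max (insert 0 ((\<lambda>m. \<Sum>i\<in>Poly_Mapping.keys m. Poly_Mapping.lookup m i) ` Poly_Mapping.keys p))"

definition partial_deriv :: "'i \<Rightarrow> 'i mpoly \<Rightarrow> 'i mpoly" where
  "partial_deriv i p =
     (\<Sum>m\<in>Poly_Mapping.keys p. Poly_Mapping.single (m - Poly_Mapping.single i 1) (of_nat (Poly_Mapping.lookup m i) * Poly_Mapping.lookup p m))"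

lemma poly_mapping_sum_single:
  "(\<Sum>m\<in>Poly_Mapping.keys p. Poly_Mapping.single m (Poly_Mapping.lookup p m)) = (p :: 'a \<Rightarrow>\<^sub>0 'b::comm_monoid_add)"
proof (rule poly_mapping_eqI)
  fix k
  have "Poly_Mapping.lookup (\<Sum>m\<in>Poly_Mapping.keys p. Poly_Mapping.single m (Poly_Mapping.lookup p m)) k
      = (\<Sum>m\<in>Poly_Mapping.keys p. if m = k then Poly_Mapping.lookup p m else 0)"
    unfolding lookup_sum by (rule sum.cong) (auto simp: lookup_single when_def)
  also have "\<dots> = Poly_Mapping.lookup p k"
    by (simp add: not_in_keys_iff_lookup_eq_zero)
  finally show "Poly_Mapping.lookup (\<Sum>m\<in>Poly_Mapping.keys p. Poly_Mapping.single m (Poly_Mapping.lookup p m)) k = Poly_Mapping.lookup p k" .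
qed

lemma poly_mapping_induct_single [case_names single add]:
  fixes p :: "'a \<Rightarrow>\<^sub>0 'b::comm_monoid_add"
  assumes "\<And>m c. P (Poly_Mapping.single m c)" "\<And>p q. P p \<Longrightarrow> P q \<Longrightarrow> P (p + q)"
  shows "P p"
proof -
  have 0: "P 0" using assms(1)[of _ 0] by simp
  have "P (\<Sum>m\<in>A. Poly_Mapping.single m (Poly_Mapping.lookup p m))" if "finite A" for A
    using that by (induction A) (auto intro: assms 0)
  from this[of "Poly_Mapping.keys p"] show ?thesis by (simp add: poly_mapping_sum_single)
qed

lemma poly_sum_superset:
  fixes p :: "'i mpoly" and g :: "_ \<Rightarrow> complex \<Rightarrow> 'b::comm_monoid_add"
  assumes "finite A" "Poly_Mapping.keys p \<subseteq> A" "\<And>m. g m 0 = 0"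
  shows "(\<Sum>m\<in>Poly_Mapping.keys p. g m (Poly_Mapping.lookup p m)) = (\<Sum>m\<in>A. g m (Poly_Mapping.lookup p m))"
  by (rule sum.mono_neutral_left) (use assms in \<open>auto simp: in_keys_iff\<close>)

lemma poly_sum_add:
  fixes p q :: "'i mpoly" and g :: "_ \<Rightarrow> complex \<Rightarrow> 'b::comm_monoid_add"
  assumes "\<And>m. g m 0 = 0" "\<And>m a b. g m (a + b) = g m a + g m b"
  shows "(\<Sum>m\<in>Poly_Mapping.keys (p + q). g m (Poly_Mapping.lookup (p + q) m))
       = (\<Sum>m\<in>Poly_Mapping.keys p. g m (Poly_Mapping.lookup p m)) + (\<Sum>m\<in>Poly_Mapping.keys q. g m (Poly_Mapping.lookup q m))"
proof -
  let ?A = "Poly_Mapping.keys p \<union> Poly_Mapping.keys q"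
  have A: "finite ?A" by simp
  show ?thesis
    unfolding poly_sum_superset[of ?A "p + q" g, OF A Poly_Mapping.keys_add assms(1)]
      poly_sum_superset[of ?A p g, OF A Un_upper1 assms(1)]
      poly_sum_superset[of ?A q g, OF A Un_upper2 assms(1)]
    by (simp add: lookup_add assms(2) sum.distrib)
qed

lemma eval_poly_add: "eval_poly (p + q) x = eval_poly p x + eval_poly q x"
  unfolding eval_poly_def
  by (rule poly_sum_add[where g = "\<lambda>m c. c * (\<Prod>i\<in>Poly_Mapping.keys m. x i ^ Poly_Mapping.lookup m i)"])
     (simp_all add: algebra_simps)

lemma eval_poly_single:
  "eval_poly (Poly_Mapping.single m c) x = c * (\<Prod>i\<in>Poly_Mapping.keys m. x i ^ Poly_Mapping.lookup m i)"
  by (simp add: eval_poly_def)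

lemma monom_eval_add:
  fixes x :: "'i \<Rightarrow> complex"
  shows "(\<Prod>i\<in>Poly_Mapping.keys (m + n). x i ^ Poly_Mapping.lookup (m + n) i)
       = (\<Prod>i\<in>Poly_Mapping.keys m. x i ^ Poly_Mapping.lookup m i) * (\<Prod>i\<in>Poly_Mapping.keys n. x i ^ Poly_Mapping.lookup n i)"
proof -
  let ?A = "Poly_Mapping.keys m \<union> Poly_Mapping.keys n"
  have *: "(\<Prod>i\<in>Poly_Mapping.keys k. x i ^ Poly_Mapping.lookup k i) = (\<Prod>i\<in>?A. x i ^ Poly_Mapping.lookup k i)" if "Poly_Mapping.keys k \<subseteq> ?A" for k
    by (rule prod.mono_neutral_left) (use that in \<open>auto simp: in_keys_iff\<close>)
  have "(\<Prod>i\<in>Poly_Mapping.keys (m + n). x i ^ Poly_Mapping.lookup (m + n) i) = (\<Prod>i\<in>?A. x i ^ Poly_Mapping.lookup (m + n) i)"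
    by (rule *) (rule Poly_Mapping.keys_add)
  then show ?thesis
    using *[of m] *[of n] by (simp add: lookup_add power_add prod.distrib)
qed

lemma eval_poly_mult: "eval_poly (p * q) x = eval_poly p x * eval_poly q x"
proof (induction p rule: poly_mapping_induct_single)
  case (single m c)
  show ?case
  proof (induction q rule: poly_mapping_induct_single)
    case (single n d)
    then show ?case by (simp add: mult_single eval_poly_single monom_eval_add)
  qed (simp add: eval_poly_add algebra_simps)
qed (simp add: eval_poly_add algebra_simps)

lemma partial_deriv_add: "partial_deriv i (p + q) = partial_deriv i p + partial_deriv i q"
  unfolding partial_deriv_def
  by (rule poly_sum_add[where g = "\<lambda>m c. Poly_Mapping.single (m - Poly_Mapping.single i 1)
        (of_nat (Poly_Mapping.lookup m i) * c)"])
     (simp_all add: algebra_simps single_add)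

lemma partial_deriv_single:
  "partial_deriv i (Poly_Mapping.single m c) =
     Poly_Mapping.single (m - Poly_Mapping.single i 1) (of_nat (Poly_Mapping.lookup m i) * c)"
  by (simp add: partial_deriv_def)

lemma partial_deriv_zero [simp]: "partial_deriv i 0 = 0"
  by (simp add: partial_deriv_def)

lemma exponent_minus_add:
  fixes m n :: "'i \<Rightarrow>\<^sub>0 nat"
  assumes "Poly_Mapping.lookup m i > 0"
  shows "m + n - Poly_Mapping.single i 1 = (m - Poly_Mapping.single i 1) + n"
proof (rule poly_mapping_eqI)
  fix k
  show "Poly_Mapping.lookup (m + n - Poly_Mapping.single i 1) k = Poly_Mapping.lookup (m - Poly_Mapping.single i 1 + n) k"
    using assms by (cases "k = i") (auto simp: lookup_add lookup_minus lookup_single when_def)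
qed

lemma partial_deriv_mult:
  "partial_deriv i (p * q) = partial_deriv i p * q + p * partial_deriv i q"
proof (induction p rule: poly_mapping_induct_single)
  case (single m c)
  show ?case
  proof (induction q rule: poly_mapping_induct_single)
    case (single n d)
    let ?e = "Poly_Mapping.single i 1"
    have 1: "Poly_Mapping.single (m - ?e + n) (of_nat (Poly_Mapping.lookup m i) * (c * d))
        = Poly_Mapping.single (m + n - ?e) (of_nat (Poly_Mapping.lookup m i) * (c * d))"
      by (cases "Poly_Mapping.lookup m i = 0") (simp_all add: exponent_minus_add[of m i n, simplified])
    have 2: "Poly_Mapping.single (m + (n - ?e)) (of_nat (Poly_Mapping.lookup n i) * (c * d))
        = Poly_Mapping.single (m + n - ?e) (of_nat (Poly_Mapping.lookup n i) * (c * d))"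
      using exponent_minus_add[of n i m]
      by (cases "Poly_Mapping.lookup n i = 0") (simp_all add: add.commute)
    have "partial_deriv i (Poly_Mapping.single m c * Poly_Mapping.single n d)
        = Poly_Mapping.single (m + n - ?e) (of_nat (Poly_Mapping.lookup m i) * (c * d))
        + Poly_Mapping.single (m + n - ?e) (of_nat (Poly_Mapping.lookup n i) * (c * d))"
      by (simp add: mult_single partial_deriv_single lookup_add ring_distribs single_add)
    also have "\<dots> = Poly_Mapping.single (m - ?e + n) (of_nat (Poly_Mapping.lookup m i) * (c * d))
        + Poly_Mapping.single (m + (n - ?e)) (of_nat (Poly_Mapping.lookup n i) * (c * d))"
      by (simp only: 1 2)
    also have "\<dots> = partial_deriv i (Poly_Mapping.single m c) * Poly_Mapping.single n d
        + Poly_Mapping.single m c * partial_deriv i (Poly_Mapping.single n d)"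
      by (simp add: mult_single partial_deriv_single mult.assoc mult.left_commute[of c])
    finally show ?case .
  qed (simp add: partial_deriv_add algebra_simps)
qed (simp add: partial_deriv_add algebra_simps)

lemma partial_deriv_commute:
  "partial_deriv i (partial_deriv j p) = partial_deriv j (partial_deriv i p)"
proof (induction p rule: poly_mapping_induct_single)
  case (single m c)
  show ?case
  proof (cases "i = j")
    case False
    have "m - Poly_Mapping.single i 1 - Poly_Mapping.single j 1
        = m - Poly_Mapping.single j 1 - Poly_Mapping.single i (1::nat)"
      by (rule poly_mapping_eqI) (simp add: lookup_minus)
    with False show ?thesis
      by (simp add: partial_deriv_single lookup_minus lookup_single mult_ac)
  qed simp
qed (simp add: partial_deriv_add)

lemma partial_deriv_const [simp]: "partial_deriv i (poly_const c) = 0"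
  by (simp add: poly_const_def partial_deriv_single)

lemma partial_deriv_one [simp]: "partial_deriv i 1 = 0"
  using partial_deriv_const[of i 1] by (simp add: poly_const_def)

lemma partial_deriv_var: "partial_deriv i (poly_var j) = of_bool (i = j)"
  by (auto simp: poly_var_def partial_deriv_single lookup_single when_def)

lemma partial_deriv_minus [simp]: "partial_deriv i (- p) = - partial_deriv i p"
  using partial_deriv_add[of i p "- p"] by (simp add: add_eq_0_iff)

lemma partial_deriv_diff: "partial_deriv i (p - q) = partial_deriv i p - partial_deriv i q"
  using partial_deriv_add[of i p "- q"] by simp

abbreviation to_ratfun :: "'i::linorder mpoly \<Rightarrow> 'i ratfun" where
  "to_ratfun p \<equiv> Fract p 1"

lemma quotient_rule_well_defined:
  fixes p q u v p' q' u' v' :: "'a::idom"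
  assumes e: "p * v = u * q" and d: "p' * v + p * v' = u' * q + u * q'"
  shows "(p' * q - p * q') * (v * v) = (u' * v - u * v') * (q * q)"
proof -
  have "(p' * q - p * q') * (v * v) = q * v * (p' * v + p * v') - q * v' * (p * v) - v * q' * (p * v)"
    by (simp add: algebra_simps)
  also have "\<dots> = q * v * (u' * q + u * q') - q * v' * (u * q) - v * q' * (u * q)"
    by (simp only: e d)
  also have "\<dots> = (u' * v - u * v') * (q * q)"
    by (simp add: algebra_simps)
  finally show ?thesis .
qed

lift_definition ratfun_deriv :: "'i::linorder \<Rightarrow> 'i ratfun \<Rightarrow> 'i ratfun" is
  "\<lambda>i (p, q). (partial_deriv i p * q - p * partial_deriv i q, q * q)"
proof -
  fix i and s t :: "'i mpoly \<times> 'i mpoly"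
  assume *: "fractrel s t"
  obtain p q where s: "s = (p, q)" by fastforce
  obtain u v where t: "t = (u, v)" by fastforce
  from * have nz: "q \<noteq> 0" "v \<noteq> 0" and e: "p * v = u * q"
    unfolding s t fractrel_iff fst_conv snd_conv by blast+
  have "partial_deriv i p * v + p * partial_deriv i v = partial_deriv i u * q + u * partial_deriv i q"
    using arg_cong[OF e, of "partial_deriv i"] unfolding partial_deriv_mult .
  from quotient_rule_well_defined[OF e this] nz
  show "fractrel (case s of (p, q) \<Rightarrow> (partial_deriv i p * q - p * partial_deriv i q, q * q))
      (case t of (p, q) \<Rightarrow> (partial_deriv i p * q - p * partial_deriv i q, q * q))"
    unfolding s t prod.case fractrel_iff fst_conv snd_conv mult_eq_0_iff by blast
qed

lemma ratfun_deriv_Fract: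
  "q \<noteq> 0 \<Longrightarrow> ratfun_deriv i (Fract p q) = Fract (partial_deriv i p * q - p * partial_deriv i q) (q * q)"
  by transfer simp

lemma fract_quotient_rules:
  fixes a b c d a' b' c' d' ai aj bi bj aij bij :: "'a::idom"
  assumes "b \<noteq> 0" "d \<noteq> 0"
  shows "Fract ((a' * d + a * d' + (c' * b + c * b')) * (b * d) - (a * d + c * b) * (b' * d + b * d'))
      (b * d * (b * d)) = Fract (a' * b - a * b') (b * b) + Fract (c' * d - c * d') (d * d)"
    and "Fract ((a' * c + a * c') * (b * d) - a * c * (b' * d + b * d')) (b * d * (b * d)) =
      Fract (a' * b - a * b') (b * b) * Fract c d + Fract a b * Fract (c' * d - c * d') (d * d)"
    and "Fract ((aij * b + aj * bi - (ai * bj + a * bij)) * (b * b) - (aj * b - a * bj) * (bi * b + b * bi))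
        (b * b * (b * b)) =
      Fract ((aij * b + ai * bj - (aj * bi + a * bij)) * (b * b) - (ai * b - a * bi) * (bj * b + b * bj))
        (b * b * (b * b))"
  using assms by (simp_all add: eq_fract algebra_simps)

lemma ratfun_deriv_add: "ratfun_deriv i (f + g) = ratfun_deriv i f + ratfun_deriv i g"
proof -
  obtain a b c d where f: "f = Fract a b" and g: "g = Fract c d" and nz: "b \<noteq> 0" "d \<noteq> 0"
    by (cases f, cases g) blast
  then have bd: "b * d \<noteq> 0" by simp
  show ?thesis
    unfolding f g add_fract[OF nz] ratfun_deriv_Fract[OF bd] ratfun_deriv_Fract[OF nz(1)]
      ratfun_deriv_Fract[OF nz(2)] partial_deriv_add partial_deriv_mult
    by (rule fract_quotient_rules(1)[OF nz])
qed

lemma ratfun_deriv_mult: "ratfun_deriv i (f * g) = ratfun_deriv i f * g + f * ratfun_deriv i g"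
proof -
  obtain a b c d where f: "f = Fract a b" and g: "g = Fract c d" and nz: "b \<noteq> 0" "d \<noteq> 0"
    by (cases f, cases g) blast
  then have bd: "b * d \<noteq> 0" by simp
  have "ratfun_deriv i (Fract a b * Fract c d) = ratfun_deriv i (Fract (a * c) (b * d))"
    by (simp only: mult_fract)
  also have "\<dots> = ratfun_deriv i (Fract a b) * Fract c d + Fract a b * ratfun_deriv i (Fract c d)"
    unfolding ratfun_deriv_Fract[OF bd] ratfun_deriv_Fract[OF nz(1)]
      ratfun_deriv_Fract[OF nz(2)] partial_deriv_mult
    by (rule fract_quotient_rules(2)[OF nz])
  finally show ?thesis by (simp only: f g)
qed

lemma ratfun_deriv_to_ratfun: "ratfun_deriv i (to_ratfun p) = to_ratfun (partial_deriv i p)"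
  by (simp add: ratfun_deriv_Fract)

lemma ratfun_deriv_commute: "ratfun_deriv i (ratfun_deriv j f) = ratfun_deriv j (ratfun_deriv i f)"
proof -
  obtain a b where f: "f = Fract a b" and nz: "b \<noteq> 0" by (cases f)
  then have bb: "b * b \<noteq> 0" by simp
  show ?thesis
    unfolding f ratfun_deriv_Fract[OF nz] ratfun_deriv_Fract[OF bb] partial_deriv_diff
      partial_deriv_mult partial_deriv_commute[of j i]
    by (rule fract_quotient_rules(3)[OF nz nz])
qed


lifting_forget fract.lifting

section \<open>The Weyl algebra and its modules\<close>

text \<open>
  The Weyl algebra, presented by generators and relations: the unital associative complex algebra
  generated by coordinates \<open>x\<^sub>i\<close> and derivations \<open>\<partial>\<^sub>i\<close>, subject to the canonical
  commutation relations.
\<close>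

datatype 'n weyl_expr =
    WConst complex
  | WCoord 'n
  | WDeriv 'n
  | WPlus "'n weyl_expr" "'n weyl_expr"
  | WTimes "'n weyl_expr" "'n weyl_expr"

inductive weyl_eq :: "'n weyl_expr \<Rightarrow> 'n weyl_expr \<Rightarrow> bool" where
  refl: "weyl_eq a a"
| sym: "weyl_eq a b \<Longrightarrow> weyl_eq b a"
| trans: "weyl_eq a b \<Longrightarrow> weyl_eq b c \<Longrightarrow> weyl_eq a c"
| plus_cong: "weyl_eq a a' \<Longrightarrow> weyl_eq b b' \<Longrightarrow> weyl_eq (WPlus a b) (WPlus a' b')"
| times_cong: "weyl_eq a a' \<Longrightarrow> weyl_eq b b' \<Longrightarrow> weyl_eq (WTimes a b) (WTimes a' b')"
| plus_assoc: "weyl_eq (WPlus (WPlus a b) c) (WPlus a (WPlus b c))"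
| plus_commute: "weyl_eq (WPlus a b) (WPlus b a)"
| plus_zero: "weyl_eq (WPlus (WConst 0) a) a"
| times_assoc: "weyl_eq (WTimes (WTimes a b) c) (WTimes a (WTimes b c))"
| one_times: "weyl_eq (WTimes (WConst 1) a) a"
| zero_times: "weyl_eq (WTimes (WConst 0) a) (WConst 0)"
| distrib_left: "weyl_eq (WTimes a (WPlus b c)) (WPlus (WTimes a b) (WTimes a c))"
| distrib_right: "weyl_eq (WTimes (WPlus a b) c) (WPlus (WTimes a c) (WTimes b c))"
| const_plus: "weyl_eq (WPlus (WConst c) (WConst d)) (WConst (c + d))"
| const_times: "weyl_eq (WTimes (WConst c) (WConst d)) (WConst (c * d))"
| const_central: "weyl_eq (WTimes a (WConst c)) (WTimes (WConst c) a)"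
| coord_coord: "weyl_eq (WTimes (WCoord i) (WCoord j)) (WTimes (WCoord j) (WCoord i))"
| deriv_deriv: "weyl_eq (WTimes (WDeriv i) (WDeriv j)) (WTimes (WDeriv j) (WDeriv i))"
| deriv_coord: "weyl_eq (WTimes (WDeriv i) (WCoord j))
    (WPlus (WTimes (WCoord j) (WDeriv i)) (WConst (of_bool (i = j))))"

quotient_type 'n weyl = "'n weyl_expr" / weyl_eq
  by (rule equivpI) (auto simp: reflp_def symp_def transp_def intro: weyl_eq.intros)

primrec expr_action :: "('n \<Rightarrow> 'n::linorder ratfun \<Rightarrow> 'n ratfun) \<Rightarrow> 'n weyl_expr \<Rightarrow> 'n ratfun \<Rightarrow> 'n ratfun"
where
  "expr_action D (WConst c) f = to_ratfun (poly_const c) * f"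
| "expr_action D (WCoord i) f = to_ratfun (poly_var i) * f"
| "expr_action D (WDeriv i) f = D i f"
| "expr_action D (WPlus a b) f = expr_action D a f + expr_action D b f"
| "expr_action D (WTimes a b) f = expr_action D a (expr_action D b f)"

text \<open>
  The action of the derivations on multiples of the symbol \<open>\<alpha>\<^sup>\<beta>\<close>: writing \<open>f\<close> for
  \<open>f \<cdot> \<alpha>\<^sup>\<beta>\<close>, the rule for \<open>\<partial>\<^sub>j \<alpha>\<^sup>\<beta>\<close> and the Leibniz rule give
  \<open>\<partial>\<^sub>j (f \<cdot> \<alpha>\<^sup>\<beta>) = (\<partial>\<^sub>j f + f \<cdot> (\<Sum>i. \<beta>\<^sub>i \<partial>\<^sub>j \<alpha>\<^sub>i / \<alpha>\<^sub>i)) \<cdot> \<alpha>\<^sup>\<beta>\<close>.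
\<close>

definition log_form :: "nat \<Rightarrow> (nat \<Rightarrow> 'n::linorder mpoly) \<Rightarrow> (nat \<Rightarrow> complex) \<Rightarrow> 'n \<Rightarrow> 'n ratfun" where
  "log_form m \<alpha> \<beta> j = (\<Sum>i = 1..m. to_ratfun (poly_const (\<beta> i)) *
      (to_ratfun (partial_deriv j (\<alpha> i)) / to_ratfun (\<alpha> i)))"

definition twisted_deriv ::
    "nat \<Rightarrow> (nat \<Rightarrow> 'n::linorder mpoly) \<Rightarrow> (nat \<Rightarrow> complex) \<Rightarrow> 'n \<Rightarrow> 'n ratfun \<Rightarrow> 'n ratfun" where
  "twisted_deriv m \<alpha> \<beta> j f = ratfun_deriv j f + f * log_form m \<alpha> \<beta> j"

lemma to_ratfun_hom:
  "to_ratfun p + to_ratfun q = to_ratfun (p + q)" "to_ratfun p * to_ratfun q = to_ratfun (p * q)"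
  by simp_all

lemma ratfun_deriv_const [simp]: "ratfun_deriv i (to_ratfun (poly_const c)) = 0"
  by (simp add: ratfun_deriv_to_ratfun fract_collapse)

lemma ratfun_deriv_zero [simp]: "ratfun_deriv i 0 = 0"
  using ratfun_deriv_to_ratfun[of i 0] by (simp add: fract_collapse)

lemma ratfun_deriv_sum: "ratfun_deriv i (sum f A) = (\<Sum>k\<in>A. ratfun_deriv i (f k))"
  by (induction A rule: infinite_finite_induct) (simp_all add: ratfun_deriv_add)

lemma dlog_closed:
  "ratfun_deriv k (to_ratfun (partial_deriv j a) / to_ratfun a) =
   ratfun_deriv j (to_ratfun (partial_deriv k a) / to_ratfun a)"
proof (cases "a = 0")
  case True
  then show ?thesis by (simp add: fract_collapse)
next
  case False
  then show ?thesis
    by (simp add: ratfun_deriv_Fract eq_fract partial_deriv_commute[of j k] algebra_simps)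
qed

lemma log_form_closed:
  "ratfun_deriv k (log_form m \<alpha> \<beta> j) = ratfun_deriv j (log_form m \<alpha> \<beta> k)"
  unfolding log_form_def ratfun_deriv_sum ratfun_deriv_mult
  by (rule sum.cong) (simp_all only: dlog_closed[of k j] ratfun_deriv_const mult_zero_left)

lemma twisted_deriv_add:
  "twisted_deriv m \<alpha> \<beta> j (f + g) = twisted_deriv m \<alpha> \<beta> j f + twisted_deriv m \<alpha> \<beta> j g"
  by (simp add: twisted_deriv_def ratfun_deriv_add algebra_simps)

lemma twisted_deriv_mult:
  "twisted_deriv m \<alpha> \<beta> j (f * g) = ratfun_deriv j f * g + f * twisted_deriv m \<alpha> \<beta> j g"
  by (simp add: twisted_deriv_def ratfun_deriv_mult algebra_simps)

lemma twisted_deriv_commute: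
  "twisted_deriv m \<alpha> \<beta> i (twisted_deriv m \<alpha> \<beta> j f) = twisted_deriv m \<alpha> \<beta> j (twisted_deriv m \<alpha> \<beta> i f)"
  using log_form_closed[of i m \<alpha> \<beta> j]
  by (simp add: twisted_deriv_def ratfun_deriv_add ratfun_deriv_mult ratfun_deriv_commute[of i j]
      algebra_simps)

lemma poly_const_hom:
  "poly_const (c + d) = poly_const c + poly_const d"
  "poly_const (c * d) = poly_const c * poly_const d"
  "poly_const 0 = 0" "poly_const 1 = 1"
  by (simp_all add: poly_const_def single_add mult_single)

lemma expr_action_add:
  "expr_action (twisted_deriv m \<alpha> \<beta>) a (f + g)
   = expr_action (twisted_deriv m \<alpha> \<beta>) a f + expr_action (twisted_deriv m \<alpha> \<beta>) a g"
  by (induction a arbitrary: f g) (simp_all add: twisted_deriv_add ring_distribs)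

lemma expr_action_const:
  "expr_action (twisted_deriv m \<alpha> \<beta>) a (to_ratfun (poly_const c) * f)
   = to_ratfun (poly_const c) * expr_action (twisted_deriv m \<alpha> \<beta>) a f"
proof (induction a arbitrary: f)
  case (WDeriv i)
  then show ?case by (simp only: expr_action.simps twisted_deriv_mult ratfun_deriv_const) simp
next
  case (WPlus a b)
  then show ?case by (simp only: expr_action.simps ring_distribs)
next
  case (WTimes a b)
  then show ?case by (simp only: expr_action.simps)
qed (simp_all only: expr_action.simps mult.left_commute)

lemma expr_action_cong:
  "weyl_eq a b \<Longrightarrow> expr_action (twisted_deriv m \<alpha> \<beta>) a f = expr_action (twisted_deriv m \<alpha> \<beta>) b f"
proof (induction arbitrary: f rule: weyl_eq.induct)
  case (deriv_coord i j)
  have "ratfun_deriv i (to_ratfun (poly_var j)) = to_ratfun (poly_const (of_bool (i = j)))"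
    by (simp add: ratfun_deriv_to_ratfun partial_deriv_var poly_const_hom of_bool_def)
  then show ?case by (simp only: expr_action.simps twisted_deriv_mult add.commute)
next
  case (deriv_deriv i j)
  then show ?case by (simp only: expr_action.simps twisted_deriv_commute)
next
  case (const_central a c)
  then show ?case by (simp only: expr_action.simps expr_action_const)
next
  case (distrib_left a b c)
  then show ?case by (simp only: expr_action.simps expr_action_add)
next
  case (const_plus c d)
  then show ?case
    by (simp only: expr_action.simps poly_const_hom to_ratfun_hom(1)[symmetric] ring_distribs)
next
  case (const_times c d)
  then show ?case
    by (simp only: expr_action.simps poly_const_hom to_ratfun_hom(2)[symmetric] mult.assoc)
qed (simp_all add: poly_const_hom fract_collapse algebra_simps)

instantiation weyl :: (type) ring
begin

lift_definition zero_weyl :: "'a weyl" is "WConst 0" .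
lift_definition plus_weyl :: "'a weyl \<Rightarrow> 'a weyl \<Rightarrow> 'a weyl" is WPlus by (rule weyl_eq.plus_cong)
lift_definition times_weyl :: "'a weyl \<Rightarrow> 'a weyl \<Rightarrow> 'a weyl" is WTimes by (rule weyl_eq.times_cong)
lift_definition uminus_weyl :: "'a weyl \<Rightarrow> 'a weyl" is "WTimes (WConst (- 1))"
  by (intro weyl_eq.times_cong weyl_eq.refl)
definition minus_weyl :: "'a weyl \<Rightarrow> 'a weyl \<Rightarrow> 'a weyl" where "minus_weyl a b = a + (- b)"

instance
proof
  fix a b c :: "'a weyl"
  show "a + b + c = a + (b + c)" by transfer (rule weyl_eq.plus_assoc)
  show "a + b = b + a" by transfer (rule weyl_eq.plus_commute)
  show "0 + a = a" by transfer (rule weyl_eq.plus_zero)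
  show "- a + a = 0"
  proof transfer
    fix a :: "'a weyl_expr"
    have "weyl_eq (WPlus (WTimes (WConst (- 1)) a) a)
        (WPlus (WTimes (WConst (- 1)) a) (WTimes (WConst 1) a))"
      by (intro weyl_eq.plus_cong weyl_eq.refl weyl_eq.sym[OF weyl_eq.one_times])
    moreover have "weyl_eq (WPlus (WTimes (WConst (- 1)) a) (WTimes (WConst 1) a))
        (WTimes (WPlus (WConst (- 1)) (WConst 1)) a)"
      by (rule weyl_eq.sym[OF weyl_eq.distrib_right])
    moreover have "weyl_eq (WTimes (WPlus (WConst (- 1)) (WConst 1)) a) (WTimes (WConst 0) a)"
      using weyl_eq.const_plus[of "- 1" 1] by (intro weyl_eq.times_cong weyl_eq.refl) simp
    ultimately show "weyl_eq (WPlus (WTimes (WConst (- 1)) a) a) (WConst 0)"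
      by (meson weyl_eq.trans weyl_eq.zero_times)
  qed
  show "a - b = a + - b" by (rule minus_weyl_def)
  show "a * b * c = a * (b * c)" by transfer (rule weyl_eq.times_assoc)
  show "(a + b) * c = a * c + b * c" by transfer (rule weyl_eq.distrib_right)
  show "a * (b + c) = a * b + a * c" by transfer (rule weyl_eq.distrib_left)
qed

end

text \<open>\<open>weyl_action m \<alpha> \<beta> P f\<close> is \<open>P \<cdot> (f \<cdot> \<alpha>\<^sup>\<beta>)\<close>.\<close>

lift_definition weyl_action ::
    "nat \<Rightarrow> (nat \<Rightarrow> 'n::linorder mpoly) \<Rightarrow> (nat \<Rightarrow> complex) \<Rightarrow> 'n weyl \<Rightarrow> 'n ratfun \<Rightarrow> 'n ratfun"
  is "\<lambda>m \<alpha> \<beta>. expr_action (twisted_deriv m \<alpha> \<beta>)"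
  using expr_action_cong by blast

instantiation weyl :: (linorder) ring_1
begin

lift_definition one_weyl :: "'a weyl" is "WConst 1" .

instance
proof
  fix a :: "'a weyl"
  show "1 * a = a" by transfer (rule weyl_eq.one_times)
  show "a * 1 = a"
    by transfer (blast intro: weyl_eq.trans weyl_eq.const_central weyl_eq.one_times)
  have "weyl_action 0 (\<lambda>_. 0) (\<lambda>_. 0) (0 :: 'a weyl) 1 \<noteq> weyl_action 0 (\<lambda>_. 0) (\<lambda>_. 0) 1 1"
    by transfer (simp add: poly_const_hom fract_collapse)
  then show "(0 :: 'a weyl) \<noteq> 1" by auto
qed

end

definition left_module :: "('r::ring_1 \<Rightarrow> 'm::ab_group_add \<Rightarrow> 'm) \<Rightarrow> 'm set \<Rightarrow> bool" where
  "left_module act M \<longleftrightarrow>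
     0 \<in> M \<and> (\<forall>x\<in>M. \<forall>y\<in>M. x + y \<in> M) \<and> (\<forall>x\<in>M. - x \<in> M) \<and>
     (\<forall>a. \<forall>x\<in>M. act a x \<in> M) \<and>
     (\<forall>a. \<forall>x\<in>M. \<forall>y\<in>M. act a (x + y) = act a x + act a y) \<and>
     (\<forall>a b. \<forall>x\<in>M. act (a + b) x = act a x + act b x) \<and>
     (\<forall>a b. \<forall>x\<in>M. act (a * b) x = act a (act b x)) \<and>
     (\<forall>x\<in>M. act 1 x = x)"

definition irreducible_module :: "('r::ring_1 \<Rightarrow> 'm::ab_group_add \<Rightarrow> 'm) \<Rightarrow> 'm set \<Rightarrow> bool" where
  "irreducible_module act M \<longleftrightarrow>
     left_module act M \<and> M \<noteq> {0} \<and>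
     (\<forall>N. N \<subseteq> M \<and> left_module act N \<longrightarrow> N = {0} \<or> N = M)"

text \<open>
  The localization of the polynomial ring at the powers of \<open>a\<close>, inside the field of rational
  functions. For \<open>a = \<Prod>i. \<alpha>\<^sub>i\<close> it is the underlying set of the free rank one module generated by
  \<open>\<alpha>\<^sup>\<beta>\<close>, an element \<open>f \<cdot> \<alpha>\<^sup>\<beta>\<close> being represented by its coefficient \<open>f\<close>.
\<close>

definition localization :: "'n::linorder mpoly \<Rightarrow> 'n ratfun set" where
  "localization a = {Fract p (a ^ k) | p k. True}"

lemma localization_iff: "f \<in> localization a \<longleftrightarrow> (\<exists>p k. f = Fract p (a ^ k))"
  by (auto simp: localization_def)

context
  fixes a :: "'n::linorder mpoly"
  assumes a: "a \<noteq> 0"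
begin

lemma localization_poly: "to_ratfun p \<in> localization a"
  unfolding localization_iff by (intro exI[of _ p] exI[of _ 0]) simp

lemma localization_add:
  assumes "f \<in> localization a" "g \<in> localization a" shows "f + g \<in> localization a"
proof -
  obtain p k q l where "f = Fract p (a ^ k)" "g = Fract q (a ^ l)"
    using assms unfolding localization_iff by blast
  with a have "f + g = Fract (p * a ^ l + q * a ^ k) (a ^ (k + l))" by (simp add: power_add)
  then show ?thesis unfolding localization_iff by blast
qed

lemma localization_mult:
  assumes "f \<in> localization a" "g \<in> localization a" shows "f * g \<in> localization a"
proof -
  obtain p k q l where "f = Fract p (a ^ k)" "g = Fract q (a ^ l)"
    using assms unfolding localization_iff by blast
  then have "f * g = Fract (p * q) (a ^ (k + l))" by (simp add: power_add)
  then show ?thesis unfolding localization_iff by blast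
qed

lemma localization_sum: "(\<And>k. k \<in> A \<Longrightarrow> f k \<in> localization a) \<Longrightarrow> sum f A \<in> localization a"
  by (induction A rule: infinite_finite_induct)
     (auto intro!: localization_add localization_poly[of 0, simplified fract_collapse]
       simp: fract_collapse)

lemma localization_deriv:
  assumes "f \<in> localization a" shows "ratfun_deriv j f \<in> localization a"
proof -
  obtain p k where "f = Fract p (a ^ k)" using assms unfolding localization_iff by blast
  with a have "ratfun_deriv j f =
      Fract (partial_deriv j p * a ^ k - p * partial_deriv j (a ^ k)) (a ^ (k + k))"
    by (simp add: ratfun_deriv_Fract power_add)
  then show ?thesis unfolding localization_iff by blast
qed

end

lemma weyl_action_simps:
  "weyl_action m \<alpha> \<beta> P (f + g) = weyl_action m \<alpha> \<beta> P f + weyl_action m \<alpha> \<beta> P g"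
  "weyl_action m \<alpha> \<beta> (P + Q) f = weyl_action m \<alpha> \<beta> P f + weyl_action m \<alpha> \<beta> Q f"
  "weyl_action m \<alpha> \<beta> (P * Q) f = weyl_action m \<alpha> \<beta> P (weyl_action m \<alpha> \<beta> Q f)"
  "weyl_action m \<alpha> \<beta> 1 f = f"
proof -
  show "weyl_action m \<alpha> \<beta> P (f + g) = weyl_action m \<alpha> \<beta> P f + weyl_action m \<alpha> \<beta> P g"
    by (induction P rule: weyl.abs_induct) (simp only: weyl_action.abs_eq expr_action_add)
  show "weyl_action m \<alpha> \<beta> (P + Q) f = weyl_action m \<alpha> \<beta> P f + weyl_action m \<alpha> \<beta> Q f"
    by (induction P rule: weyl.abs_induct; induction Q rule: weyl.abs_induct)
       (simp only: weyl_action.abs_eq plus_weyl.abs_eq expr_action.simps)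
  show "weyl_action m \<alpha> \<beta> (P * Q) f = weyl_action m \<alpha> \<beta> P (weyl_action m \<alpha> \<beta> Q f)"
    by (induction P rule: weyl.abs_induct; induction Q rule: weyl.abs_induct)
       (simp only: weyl_action.abs_eq times_weyl.abs_eq expr_action.simps)
  show "weyl_action m \<alpha> \<beta> 1 f = f"
    by (simp only: weyl_action.abs_eq one_weyl_def expr_action.simps poly_const_hom fract_collapse
        mult_1_left)
qed

theorem left_module_twisted:
  fixes \<alpha> :: "nat \<Rightarrow> 'n::linorder mpoly"
  assumes nz: "\<And>i. i \<in> {1..m} \<Longrightarrow> \<alpha> i \<noteq> 0"
  shows "left_module (weyl_action m \<alpha> \<beta>) (localization (\<Prod>i = 1..m. \<alpha> i))"
proof -
  define a where "a = (\<Prod>i = 1..m. \<alpha> i)"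
  have a: "a \<noteq> 0" using nz by (simp add: a_def)
  have inv: "to_ratfun p / to_ratfun (\<alpha> i) \<in> localization a" if "i \<in> {1..m}" for i p
  proof -
    have "a = \<alpha> i * (\<Prod>l\<in>{1..m} - {i}. \<alpha> l)"
      unfolding a_def using that by (subst prod.remove[of _ i]) auto
    then obtain b where b: "a = \<alpha> i * b" by blast
    have "to_ratfun p / to_ratfun (\<alpha> i) = Fract p (\<alpha> i)" by simp
    also have "\<dots> = Fract (p * b) (a ^ 1)"
      by (simp only: power_one_right eq_fract(1)[OF nz[OF that] a]) (simp only: b mult_ac)
    finally have "to_ratfun p / to_ratfun (\<alpha> i) = Fract (p * b) (a ^ 1)" .
    then show ?thesis unfolding localization_iff by blast
  qed
  have form: "log_form m \<alpha> \<beta> j \<in> localization a" for j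
    unfolding log_form_def by (intro localization_sum localization_mult localization_poly inv a) auto
  have expr: "expr_action (twisted_deriv m \<alpha> \<beta>) e f \<in> localization a" if "f \<in> localization a" for e f
    using that
  proof (induction e arbitrary: f)
    case (WConst c)
    then show ?case unfolding expr_action.simps by (intro localization_mult localization_poly a)
  next
    case (WCoord i)
    then show ?case unfolding expr_action.simps by (intro localization_mult localization_poly a)
  next
    case (WDeriv i)
    then show ?case unfolding expr_action.simps twisted_deriv_def
      by (intro localization_add localization_mult localization_deriv form a)
  next
    case (WPlus e e')
    then show ?case unfolding expr_action.simps by (intro localization_add a)
  next
    case (WTimes e e')
    then show ?case unfolding expr_action.simps by blast
  qed
  have neg: "- f \<in> localization a" if "f \<in> localization a" for f
  proof -
    have "to_ratfun (- 1) * f = - f"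
      unfolding minus_fract[symmetric] fract_collapse by simp
    then show ?thesis using localization_mult[OF a localization_poly[OF a, of "- 1"] that] by metis
  qed
  have closed: "weyl_action m \<alpha> \<beta> P f \<in> localization a" if "f \<in> localization a" for P f
    using expr[OF that] by (induction P rule: weyl.abs_induct) (simp only: weyl_action.abs_eq)
  have zero: "0 \<in> localization a"
    using localization_poly[OF a, of 0] unfolding fract_collapse .
  show ?thesis
    unfolding left_module_def a_def[symmetric]
    by (intro conjI ballI allI zero closed neg localization_add[OF a] weyl_action_simps)
qed


section \<open>Complex algebraic varieties as spaces with functions\<close>

text \<open>
  A space carrying a Zariski topology and a sheaf of complex-valued functions. Functions are total
  in HOL, so \<open>f \<in> regular X U\<close> says that the restriction of \<open>f\<close> to \<open>U\<close> is a section over \<open>U\<close>;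
  the values of \<open>f\<close> outside \<open>U\<close> are irrelevant.
\<close>

record 'a ringed_space =
  zariski :: "'a topology"
  regular :: "'a set \<Rightarrow> ('a \<Rightarrow> complex) set"

abbreviation points :: "'a ringed_space \<Rightarrow> 'a set" where
  "points X \<equiv> topspace (zariski X)"

definition space_with_functions :: "'a ringed_space \<Rightarrow> bool" where
  "space_with_functions X \<longleftrightarrow>
     (\<forall>U f. f \<in> regular X U \<longrightarrow> openin (zariski X) U) \<and>
     (\<forall>U f g. f \<in> regular X U \<and> (\<forall>x\<in>U. f x = g x) \<longrightarrow> g \<in> regular X U) \<and>
     (\<forall>U c. openin (zariski X) U \<longrightarrow> (\<lambda>_. c) \<in> regular X U) \<and>
     (\<forall>U f g. f \<in> regular X U \<and> g \<in> regular X U \<longrightarrow>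
        (\<lambda>x. f x + g x) \<in> regular X U \<and> (\<lambda>x. f x * g x) \<in> regular X U) \<and>
     (\<forall>U V f. f \<in> regular X U \<and> openin (zariski X) V \<and> V \<subseteq> U \<longrightarrow> f \<in> regular X V) \<and>
     (\<forall>U f. openin (zariski X) U \<and> (\<forall>p\<in>U. \<exists>V. p \<in> V \<and> V \<subseteq> U \<and> f \<in> regular X V) \<longrightarrow>
        f \<in> regular X U) \<and>
     (\<forall>U f. f \<in> regular X U \<longrightarrow>
        openin (zariski X) {x \<in> U. f x \<noteq> 0} \<and>
        (\<lambda>x. inverse (f x)) \<in> regular X {x \<in> U. f x \<noteq> 0})"

text \<open>
  On an open subset this is the restriction of the sheaf; on a closed subset it is the sheaf of
  functions that extend locally to the ambient space.
\<close>

definition induced_space :: "'a ringed_space \<Rightarrow> 'a set \<Rightarrow> 'a ringed_space" where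
  "induced_space X S = \<lparr>zariski = subtopology (zariski X) S,
     regular = (\<lambda>V. {f. openin (subtopology (zariski X) S) V \<and>
       (\<forall>p\<in>V. \<exists>U. \<exists>g\<in>regular X U. p \<in> U \<and> (\<forall>x\<in>U \<inter> V. f x = g x))})\<rparr>"

definition morphism :: "'a ringed_space \<Rightarrow> 'b ringed_space \<Rightarrow> ('a \<Rightarrow> 'b) \<Rightarrow> bool" where
  "morphism X Y \<phi> \<longleftrightarrow>
     continuous_map (zariski X) (zariski Y) \<phi> \<and>
     (\<forall>V. \<forall>f\<in>regular Y V. (\<lambda>x. f (\<phi> x)) \<in> regular X {x \<in> points X. \<phi> x \<in> V})"

definition isomorphism :: "'a ringed_space \<Rightarrow> 'b ringed_space \<Rightarrow> ('a \<Rightarrow> 'b) \<Rightarrow> bool" where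
  "isomorphism X Y \<phi> \<longleftrightarrow>
     morphism X Y \<phi> \<and>
     (\<exists>\<psi>. morphism Y X \<psi> \<and> (\<forall>x\<in>points X. \<psi> (\<phi> x) = x) \<and> (\<forall>y\<in>points Y. \<phi> (\<psi> y) = y))"

text \<open>
  Affine space with coordinates indexed by a subset \<open>I\<close> of a type; coordinates outside \<open>I\<close> are \<open>0\<close>.
  Letting \<open>I\<close> vary over \<open>{..<N}\<close> gives all affine spaces on one type of points.
\<close>

definition affine_points :: "'i set \<Rightarrow> ('i \<Rightarrow> complex) set" where
  "affine_points I = {x. \<forall>i. i \<notin> I \<longrightarrow> x i = 0}"

definition zariski_affine :: "'i set \<Rightarrow> ('i \<Rightarrow> complex) topology" where
  "zariski_affine I = topology (\<lambda>U. \<exists>P. U = {x \<in> affine_points I. \<exists>p\<in>P. eval_poly p x \<noteq> 0})"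

lemma openin_zariski_affine:
  "openin (zariski_affine I) U \<longleftrightarrow>
   (\<exists>P. U = {x \<in> affine_points I. \<exists>p\<in>P. eval_poly p x \<noteq> 0})"
proof -
  let ?open = "\<lambda>U. \<exists>P. U = {x \<in> affine_points I. \<exists>p\<in>P. eval_poly p x \<noteq> 0}"
  have "istopology ?open"
    unfolding istopology_def
  proof (intro conjI allI impI)
    fix S T assume "?open S" "?open T"
    then obtain P Q where
      S: "S = {x \<in> affine_points I. \<exists>p\<in>P. eval_poly p x \<noteq> 0}" and
      T: "T = {x \<in> affine_points I. \<exists>p\<in>Q. eval_poly p x \<noteq> 0}" by blast
    have "S \<inter> T = {x \<in> affine_points I. \<exists>p\<in>{p * q | p q. p \<in> P \<and> q \<in> Q}. eval_poly p x \<noteq> 0}"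
    proof (intro set_eqI iffI)
      fix x assume "x \<in> S \<inter> T"
      then obtain p q where "x \<in> affine_points I" "p \<in> P" "q \<in> Q" "eval_poly (p * q) x \<noteq> 0"
        unfolding S T by (auto simp: eval_poly_mult)
      then show "x \<in> {x \<in> affine_points I. \<exists>p\<in>{p * q | p q. p \<in> P \<and> q \<in> Q}. eval_poly p x \<noteq> 0}"
        by blast
    qed (auto simp: S T eval_poly_mult)
    then show "?open (S \<inter> T)" by blast
  next
    fix K assume "\<forall>S\<in>K. ?open S"
    from bchoice[OF this] obtain P
      where P: "\<forall>S\<in>K. S = {x \<in> affine_points I. \<exists>p\<in>P S. eval_poly p x \<noteq> 0}" ..
    have "\<Union>K = (\<Union>S\<in>K. S)" by simp
    also have "\<dots> = (\<Union>S\<in>K. {x \<in> affine_points I. \<exists>p\<in>P S. eval_poly p x \<noteq> 0})"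
      by (rule SUP_cong[OF HOL.refl]) (rule P[rule_format])
    also have "\<dots> = {x \<in> affine_points I. \<exists>p\<in>\<Union>(P ` K). eval_poly p x \<noteq> 0}"
      by blast
    finally have "\<Union>K = {x \<in> affine_points I. \<exists>p\<in>\<Union>(P ` K). eval_poly p x \<noteq> 0}" .
    then show "?open (\<Union>K)" by blast
  qed
  then show ?thesis unfolding zariski_affine_def by (simp only: topology_inverse')
qed

definition affine_space :: "'i set \<Rightarrow> ('i \<Rightarrow> complex) ringed_space" where
  "affine_space I = \<lparr>zariski = zariski_affine I,
     regular = (\<lambda>U. {f. openin (zariski_affine I) U \<and>
       (\<forall>p\<in>U. \<exists>V g h. openin (zariski_affine I) V \<and> p \<in> V \<and> V \<subseteq> U \<and>
          (\<forall>x\<in>V. eval_poly h x \<noteq> 0 \<and> f x = eval_poly g x / eval_poly h x))})\<rparr>"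

definition affine_variety :: "'a ringed_space \<Rightarrow> bool" where
  "affine_variety X \<longleftrightarrow> (\<exists>(N::nat) C \<phi>. closedin (zariski (affine_space {..<N})) C \<and>
     isomorphism X (induced_space (affine_space {..<N}) C) \<phi>)"

definition prevariety :: "'a ringed_space \<Rightarrow> bool" where
  "prevariety X \<longleftrightarrow> space_with_functions X \<and>
     (\<exists>\<U>. finite \<U> \<and> \<Union>\<U> = points X \<and>
        (\<forall>U\<in>\<U>. openin (zariski X) U \<and> affine_variety (induced_space X U)))"

text \<open>
  The Zariski topology of the product variety. It is finer than the product topology: its basic
  open sets are the nonvanishing loci of \<open>\<Sum>k. f\<^sub>k \<otimes> g\<^sub>k\<close> with \<open>f\<^sub>k\<close>, \<open>g\<^sub>k\<close> regular on opens of the factors.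
\<close>

definition product_zariski :: "'a ringed_space \<Rightarrow> 'b ringed_space \<Rightarrow> ('a \<times> 'b) topology" where
  "product_zariski X Y = topology_generated_by
     {{(x, y). x \<in> U \<and> y \<in> V \<and> (\<Sum>k<K. f k x * g k y) \<noteq> 0} | U V K f g.
       openin (zariski X) U \<and> openin (zariski Y) V \<and>
       (\<forall>k<(K::nat). f k \<in> regular X U \<and> g k \<in> regular Y V)}"

definition irreducible_set :: "'a topology \<Rightarrow> 'a set \<Rightarrow> bool" where
  "irreducible_set T S \<longleftrightarrow> S \<subseteq> topspace T \<and> S \<noteq> {} \<and>
     (\<forall>A B. closedin T A \<and> closedin T B \<and> S \<subseteq> A \<union> B \<longrightarrow> S \<subseteq> A \<or> S \<subseteq> B)"

definition irreducible_components :: "'a topology \<Rightarrow> 'a set \<Rightarrow> 'a set set" where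
  "irreducible_components T S =
     {C. C \<subseteq> S \<and> irreducible_set T C \<and> (\<forall>D. C \<subseteq> D \<and> D \<subseteq> S \<and> irreducible_set T D \<longrightarrow> D = C)}"

definition variety :: "'a ringed_space \<Rightarrow> bool" where
  "variety X \<longleftrightarrow> prevariety X \<and> irreducible_set (zariski X) (points X) \<and>
     closedin (product_zariski X X) {(x, x) | x. x \<in> points X}"

text \<open>
  Separated and universally closed; finite type is automatic here. The test spaces \<open>Y\<close> of a base
  change live on one fixed type of the cardinality of the continuum, which up to isomorphism covers
  all prevarieties, since these have at most continuum many points.
\<close>

definition proper_morphism :: "'a ringed_space \<Rightarrow> 'b ringed_space \<Rightarrow> ('a \<Rightarrow> 'b) \<Rightarrow> bool" where
  "proper_morphism X S \<phi> \<longleftrightarrow> morphism X S \<phi> \<and>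
     closedin (subtopology (product_zariski X X) {(x, y). \<phi> x = \<phi> y}) {(x, x) | x. x \<in> points X} \<and>
     (\<forall>(Y :: (nat \<Rightarrow> complex) ringed_space) \<psi>. prevariety Y \<and> morphism Y S \<psi> \<longrightarrow>
        (\<forall>C. closedin (subtopology (product_zariski X Y) {(x, y). \<phi> x = \<psi> y}) C \<longrightarrow>
           closedin (zariski Y) (snd ` C)))"

definition birational_morphism :: "'a ringed_space \<Rightarrow> 'b ringed_space \<Rightarrow> ('a \<Rightarrow> 'b) \<Rightarrow> bool" where
  "birational_morphism X Y \<phi> \<longleftrightarrow> morphism X Y \<phi> \<and>
     (\<exists>U V. openin (zariski X) U \<and> U \<noteq> {} \<and> openin (zariski Y) V \<and> V \<noteq> {} \<and>
        isomorphism (induced_space X U) (induced_space Y V) \<phi>)"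


section \<open>Local rings, regularity and divisors\<close>

text \<open>
  For an irreducible closed \<open>Y\<close>, \<open>codim X Y\<close> is the codimension of \<open>Y\<close>, that is, the Krull dimension
  of the local ring \<open>O\<^sub>X\<^sub>,\<^sub>Y\<close>; for \<open>Y = {p}\<close> this is the dimension of \<open>X\<close> at \<open>p\<close>.
\<close>

definition codim :: "'a ringed_space \<Rightarrow> 'a set \<Rightarrow> enat" where
  "codim X Y = Sup {enat k | k. \<exists>C :: nat \<Rightarrow> 'a set.
     (\<forall>i\<le>k. closedin (zariski X) (C i) \<and> irreducible_set (zariski X) (C i)) \<and>
     (\<forall>i<k. C i \<subset> C (Suc i)) \<and> Y \<subseteq> C 0}"

definition prime_divisor :: "'a ringed_space \<Rightarrow> 'a set \<Rightarrow> bool" where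
  "prime_divisor X D \<longleftrightarrow>
     closedin (zariski X) D \<and> irreducible_set (zariski X) D \<and> codim X D = 1"

text \<open>
  Representatives of elements of the local ring \<open>O\<^sub>X\<^sub>,\<^sub>Y\<close> of an irreducible closed subset \<open>Y\<close> (a point,
  or a prime divisor): functions regular on some open set meeting \<open>Y\<close>.
\<close>

definition germs :: "'a ringed_space \<Rightarrow> 'a set \<Rightarrow> ('a \<Rightarrow> complex) set" where
  "germs X Y = {f. \<exists>U. U \<inter> Y \<noteq> {} \<and> f \<in> regular X U}"

definition germ_eq :: "'a ringed_space \<Rightarrow> 'a set \<Rightarrow> ('a \<Rightarrow> complex) \<Rightarrow> ('a \<Rightarrow> complex) \<Rightarrow> bool" where
  "germ_eq X Y f g \<longleftrightarrow> (\<exists>U. openin (zariski X) U \<and> U \<inter> Y \<noteq> {} \<and> (\<forall>x\<in>U. f x = g x))"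

text \<open>The ideal of \<open>D\<close> in \<open>O\<^sub>X\<^sub>,\<^sub>Y\<close>; for \<open>D = Y\<close> it is the maximal ideal.\<close>

definition vanishing_ideal :: "'a ringed_space \<Rightarrow> 'a set \<Rightarrow> 'a set \<Rightarrow> ('a \<Rightarrow> complex) set" where
  "vanishing_ideal X Y D =
     {f \<in> germs X Y. \<exists>U. openin (zariski X) U \<and> U \<inter> Y \<noteq> {} \<and> (\<forall>x\<in>U \<inter> D. f x = 0)}"

definition generates_ideal ::
    "'a ringed_space \<Rightarrow> 'a set \<Rightarrow> ('a \<Rightarrow> complex) list \<Rightarrow> ('a \<Rightarrow> complex) set \<Rightarrow> bool" where
  "generates_ideal X Y ts I \<longleftrightarrow> set ts \<subseteq> I \<and>
     (\<forall>f\<in>I. \<exists>c. (\<forall>k<length ts. c k \<in> germs X Y) \<and>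
        germ_eq X Y f (\<lambda>x. \<Sum>k<length ts. c k x * (ts ! k) x))"

definition regular_parameters :: "'a ringed_space \<Rightarrow> 'a \<Rightarrow> ('a \<Rightarrow> complex) list \<Rightarrow> bool" where
  "regular_parameters X p ts \<longleftrightarrow>
     generates_ideal X {p} ts (vanishing_ideal X {p} {p}) \<and> codim X {p} = enat (length ts)"

definition smooth :: "'a ringed_space \<Rightarrow> bool" where
  "smooth X \<longleftrightarrow> (\<forall>p\<in>points X. \<exists>ts. regular_parameters X p ts)"

definition local_equation :: "'a ringed_space \<Rightarrow> 'a \<Rightarrow> 'a set \<Rightarrow> ('a \<Rightarrow> complex) \<Rightarrow> bool" where
  "local_equation X p D f \<longleftrightarrow> generates_ideal X {p} [f] (vanishing_ideal X {p} D)"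

text \<open>Local equations of the members of \<open>\<D>\<close> through \<open>p\<close> form part of a regular system of parameters.\<close>

definition normal_crossing_at :: "'a ringed_space \<Rightarrow> 'a \<Rightarrow> 'a set set \<Rightarrow> bool" where
  "normal_crossing_at X p \<D> \<longleftrightarrow> (\<exists>ts \<iota>. regular_parameters X p ts \<and>
     inj_on \<iota> {D \<in> \<D>. p \<in> D} \<and>
     (\<forall>D\<in>\<D>. p \<in> D \<longrightarrow> \<iota> D < length ts \<and> local_equation X p D (ts ! \<iota> D)))"

text \<open>
  The valuation of the discrete valuation ring \<open>O\<^sub>X\<^sub>,\<^sub>D\<close>: \<open>f = u \<cdot> t\<^sup>k\<close> with \<open>t\<close> a uniformizer and \<open>u\<close> a
  unit. It is meant for \<open>X\<close> smooth, \<open>D\<close> a prime divisor and \<open>f\<close> a nonzero regular function.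
\<close>

definition vanishing_order :: "'a ringed_space \<Rightarrow> 'a set \<Rightarrow> ('a \<Rightarrow> complex) \<Rightarrow> nat" where
  "vanishing_order X D f = (THE k. \<exists>t u.
     generates_ideal X D [t] (vanishing_ideal X D D) \<and>
     u \<in> germs X D - vanishing_ideal X D D \<and> germ_eq X D f (\<lambda>x. u x * t x ^ k))"

text \<open>The divisor of a regular function: its family of multiplicities along prime divisors.\<close>

definition divisor_of :: "'a ringed_space \<Rightarrow> ('a \<Rightarrow> complex) \<Rightarrow> 'a set \<Rightarrow> int" where
  "divisor_of X f D = (if prime_divisor X D then int (vanishing_order X D f) else 0)"


section \<open>Resolutions\<close>

definition zero_locus :: "'i mpoly \<Rightarrow> ('i \<Rightarrow> complex) set" where
  "zero_locus p = {x. eval_poly p x = 0}"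

text \<open>The locus where \<open>\<phi>\<close> is not a local isomorphism.\<close>

definition exceptional_locus :: "'a ringed_space \<Rightarrow> 'b ringed_space \<Rightarrow> ('a \<Rightarrow> 'b) \<Rightarrow> 'a set" where
  "exceptional_locus X Y \<phi> = {p \<in> points X.
     \<not> (\<exists>U. openin (zariski X) U \<and> p \<in> U \<and> openin (zariski Y) (\<phi> ` U) \<and>
          isomorphism (induced_space X U) (induced_space Y (\<phi> ` U)) \<phi>)}"

definition proper_transform ::
    "'a ringed_space \<Rightarrow> 'b ringed_space \<Rightarrow> ('a \<Rightarrow> 'b) \<Rightarrow> 'b set \<Rightarrow> 'a set" where
  "proper_transform X Y \<phi> H =
     zariski X closure_of {x \<in> points X. \<phi> x \<in> H - \<phi> ` exceptional_locus X Y \<phi>}"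

text \<open>
  \<open>\<pi> : X \<rightarrow> \<complex>\<^sup>n\<close> is a resolution of the singularities of \<open>V (\<alpha>\<^sub>1 \<cdots> \<alpha>\<^sub>m)\<close>, with irreducible components
  \<open>E\<^sub>1, \<dots>, E\<^sub>s\<close> of the exceptional divisor.
\<close>

definition resolution_of_singularities ::
    "nat \<Rightarrow> (nat \<Rightarrow> 'n::{finite,linorder} mpoly) \<Rightarrow> 'a ringed_space \<Rightarrow> ('a \<Rightarrow> 'n \<Rightarrow> complex) \<Rightarrow>
     nat \<Rightarrow> (nat \<Rightarrow> 'a set) \<Rightarrow> bool" where
  "resolution_of_singularities m \<alpha> X \<pi> s E \<longleftrightarrow>
    (let A = affine_space (UNIV :: 'n set);
         V = zero_locus (\<Prod>i = 1..m. \<alpha> i);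
         Exc = exceptional_locus X A \<pi>;
         Z = \<pi> ` Exc;
         comps = {proper_transform X A \<pi> (zero_locus (\<alpha> i)) | i. i \<in> {1..m}} \<union> E ` {1..s}
     in variety X \<and> smooth X \<and> proper_morphism X A \<pi> \<and> birational_morphism X A \<pi> \<and>
        inj_on E {1..s} \<and> E ` {1..s} = irreducible_components (zariski X) Exc \<and>
        (\<forall>j\<in>{1..s}. prime_divisor X (E j)) \<and>
        Z \<subseteq> V \<and>
        isomorphism (induced_space X (points X - Exc)) (induced_space A (points A - Z)) \<pi> \<and>
        (\<exists>\<U>. finite \<U> \<and> \<Union>\<U> = points X \<and>
           (\<forall>U\<in>\<U>. openin (zariski X) U \<and> affine_variety (induced_space X U) \<and>
              (\<exists>W \<phi>. openin (zariski A) W \<and> affine_variety (induced_space A W) \<and>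
                 isomorphism (induced_space X U) (induced_space A W) \<phi>))) \<and>
        irreducible_components (zariski X) {x \<in> points X. \<pi> x \<in> V} \<subseteq> comps \<and>
        (\<forall>p\<in>points X. normal_crossing_at X p comps))"

end

theory Submission
  imports Defs "HOL-Computational_Algebra.Fundamental_Theorem_Algebra"
begin

text \<open>
  An element \<open>f\<close> of a submodule generates, after inverting \<open>\<alpha>\<close>, an ideal stable under derivations,
  so a nonzero submodule \<open>N\<close> becomes everything after inverting \<open>\<alpha>\<close>. If \<open>N\<close> is proper, choose a
  minimal set \<open>B\<close> of hyperplanes such that \<open>N\<close> stays proper after inverting all \<open>\<alpha>\<^sub>j\<close> with \<open>j \<notin> B\<close>; the
  quotient \<open>Q\<close> is then supported on the intersection of the hyperplanes in \<open>B\<close>. Suppose \<open>B\<close> contains a block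
  \<open>S\<close> whose linear forms are independent of the others and with \<open>\<sigma> = \<Sum>i\<in>S. \<beta>\<^sub>i\<close> not an integer, and let
  \<open>\<theta>\<close> be the Euler field of \<open>S\<close>. Filtering by powers of the ideal of \<open>S\<close> shows that \<open>\<theta>\<close> has eigenvalues in
  \<open>\<sigma> + \<int>\<close> on \<open>Q\<close>, while on an element killed by the forms in \<open>S\<close> it acts as a negative integer; so
  \<open>Q = 0\<close>.

  The blocks come from the resolution. A general line \<open>\<gamma>\<close> through a point \<open>x\<^sub>0\<close> lifts to \<open>X\<close> and, \<open>\<pi>\<close> being
  proper, has a limit \<open>p\<close> over \<open>x\<^sub>0\<close>. Each \<open>\<pi>\<^sup>*\<alpha>\<^sub>i\<close> with \<open>\<alpha>\<^sub>i(x\<^sub>0) = 0\<close> has order one along the lift, so at \<open>p\<close>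
  it is a unit \<open>u\<^sub>i\<close> times a single local equation \<open>t\<^sub>k\<close> of the normal crossing divisor. The \<open>i\<close> belonging to
  a fixed component \<open>D\<close> form the block \<open>S\<close>: the multiplicities of \<open>\<pi>\<^sup>*\<alpha>\<^sub>i\<close> along \<open>D\<close> are \<open>1\<close> on \<open>S\<close> and \<open>0\<close>
  elsewhere, hence \<open>\<sigma>\<close> is one of the numbers assumed to be nonintegral, and since the \<open>t\<^sub>k\<close> are part of a
  system of parameters, a linear relation \<open>\<Sum>i. c\<^sub>i \<alpha>\<^sub>i = 0\<close> forces \<open>\<Sum>i\<in>S. c\<^sub>i u\<^sub>i(p) = 0\<close>, which says that
  \<open>\<Sum>i\<in>S. c\<^sub>i \<alpha>\<^sub>i\<close> vanishes in the general direction of \<open>\<gamma>\<close>.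
\<close>

section \<open>Polynomials\<close>

text \<open>The line and the block depend on each other: the limit \<open>p\<close>, and with it the
  divisor and \<open>S\<close>, is known only once the direction \<open>v\<close> is fixed, while
  \<open>v\<close> must not annihilate the intersection of two spans that depends on
  \<open>S\<close>. Since there are finitely many candidates for \<open>S\<close>, one nonzero
  vector is picked in every nonzero intersection beforehand, and \<open>v\<close> pairs nontrivially
  with all of them.

  All geometry at \<open>p\<close> is of first order. In a chart, germs are quotients of polynomials
  and differentials are derivatives along coordinate lines. A form with nonzero slope along the line
  cannot pull back into the square of the maximal ideal, so its differential at \<open>p\<close> is
  nonzero; this is what forces a single component and a unit cofactor.

  Dimension theory enters at two places: a system of parameters has at most n members, and a
  function with nonzero differential vanishes on a whole component of any divisor covering its zero
  set. Both rest on one counting argument: n + 1 polynomials in n variables are algebraically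
  dependent.\<close>

lemma eval_poly_zero [simp]: "eval_poly 0 x = 0"
  by (simp add: eval_poly_def)

lemma eval_poly_const [simp]: "eval_poly (poly_const c) x = c"
  by (simp add: poly_const_def eval_poly_single)

lemma eval_poly_one [simp]: "eval_poly 1 x = 1"
  using eval_poly_const[of 1 x] by (simp add: poly_const_hom)

lemma eval_poly_var [simp]: "eval_poly (poly_var i) x = x i"
  by (simp add: poly_var_def eval_poly_single)

lemma eval_poly_uminus [simp]: "eval_poly (- p) x = - eval_poly p x"
  using eval_poly_add[of p "- p" x] by (simp add: add_eq_0_iff)

lemma eval_poly_diff: "eval_poly (p - q) x = eval_poly p x - eval_poly q x"
  using eval_poly_add[of p "- q" x] by simp

lemma eval_poly_sum: "eval_poly (sum f A) x = (\<Sum>a\<in>A. eval_poly (f a) x)"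
  by (induction A rule: infinite_finite_induct) (simp_all add: eval_poly_add)

lemma eval_poly_prod: "eval_poly (prod f A) x = (\<Prod>a\<in>A. eval_poly (f a) x)"
  by (induction A rule: infinite_finite_induct) (simp_all add: eval_poly_mult)

lemma eval_poly_power: "eval_poly (p ^ k) x = eval_poly p x ^ k"
  by (induction k) (simp_all add: eval_poly_mult)

lemma tendsto_eval_poly:
  assumes "\<And>i. ((\<lambda>\<tau>. a \<tau> i) \<longlongrightarrow> b i) F"
  shows "((\<lambda>\<tau>. eval_poly p (a \<tau>)) \<longlongrightarrow> eval_poly p b) F"
  unfolding eval_poly_def by (intro tendsto_intros assms)

lemma poly_const_eq_0_iff [simp]: "poly_const c = 0 \<longleftrightarrow> c = 0"
  by (metis eval_poly_const eval_poly_zero poly_const_hom(3))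

lemma lookup_partial_deriv:
  "Poly_Mapping.lookup (partial_deriv i p) k
   = of_nat (Poly_Mapping.lookup k i + 1) * Poly_Mapping.lookup p (k + Poly_Mapping.single i 1)"
proof (induction p rule: poly_mapping_induct_single)
  case (single m c)
  show ?case
  proof (cases "Poly_Mapping.lookup m i = 0")
    case True
    have "m \<noteq> k + Poly_Mapping.single i 1"
      using True by (metis add_eq_0_iff_both_eq_0 lookup_add lookup_single_eq zero_neq_one)
    then show ?thesis using True by (simp add: partial_deriv_single lookup_single when_def)
  next
    case False
    have "m = m - Poly_Mapping.single i 1 + Poly_Mapping.single i 1"
      using False by (intro poly_mapping_eqI) (auto simp: lookup_add lookup_minus lookup_single when_def)
    then have "m - Poly_Mapping.single i 1 = k \<longleftrightarrow> m = k + Poly_Mapping.single i 1"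
      by (metis add_implies_diff)
    moreover have "Poly_Mapping.lookup m i = Suc (Poly_Mapping.lookup k i)"
      if "m = k + Poly_Mapping.single i 1"
      using that by (simp add: lookup_add)
    ultimately show ?thesis
      by (auto simp: partial_deriv_single lookup_single when_def)
  qed
qed (simp add: partial_deriv_add lookup_add algebra_simps)

definition mdeg :: "('i \<Rightarrow>\<^sub>0 nat) \<Rightarrow> nat" where
  "mdeg m = (\<Sum>i\<in>Poly_Mapping.keys m. Poly_Mapping.lookup m i)"

lemma mdeg_add: "mdeg (m + n) = mdeg m + mdeg n"
proof -
  let ?A = "Poly_Mapping.keys m \<union> Poly_Mapping.keys n"
  have *: "mdeg k = (\<Sum>i\<in>?A. Poly_Mapping.lookup k i)" if "Poly_Mapping.keys k \<subseteq> ?A" for k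
    unfolding mdeg_def by (rule sum.mono_neutral_left) (use that in \<open>auto simp: in_keys_iff\<close>)
  show ?thesis
    using *[of m] *[of n] *[OF Poly_Mapping.keys_add] by (simp add: lookup_add sum.distrib)
qed

lemma mdeg_single [simp]: "mdeg (Poly_Mapping.single i k) = k"
  by (simp add: mdeg_def)

lemma mdeg_eq_0_iff [simp]: "mdeg m = 0 \<longleftrightarrow> m = 0"
  by (auto simp: mdeg_def in_keys_iff intro!: poly_mapping_eqI)

lemma mdeg_le_total_degree: "m \<in> Poly_Mapping.keys p \<Longrightarrow> mdeg m \<le> total_degree p"
  unfolding total_degree_def mdeg_def by (intro Max_ge) auto

lemma total_degree_less:
  "(\<And>m. m \<in> Poly_Mapping.keys p \<Longrightarrow> mdeg m < d) \<Longrightarrow> 0 < d \<Longrightarrow> total_degree p < d"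
  unfolding total_degree_def mdeg_def by auto

lemma exponent_nonzero_decompose:
  fixes m :: "'i \<Rightarrow>\<^sub>0 nat"
  assumes "m \<noteq> 0"
  obtains i k where "m = k + Poly_Mapping.single i 1"
proof -
  obtain i where i: "Poly_Mapping.lookup m i \<noteq> 0"
    using assms by (metis lookup_zero poly_mapping_eqI)
  have "m = m - Poly_Mapping.single i 1 + Poly_Mapping.single i 1"
    using i by (intro poly_mapping_eqI) (auto simp: lookup_add lookup_minus lookup_single when_def)
  then show thesis by (rule that)
qed

lemma poly_eq_const_if_derivs_zero:
  assumes "\<And>i. partial_deriv i p = 0"
  shows "p = poly_const (Poly_Mapping.lookup p 0)"
proof (rule poly_mapping_eqI)
  fix m
  show "Poly_Mapping.lookup p m = Poly_Mapping.lookup (poly_const (Poly_Mapping.lookup p 0)) m"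
  proof (cases "m = 0")
    case False
    then obtain i k where m: "m = k + Poly_Mapping.single i 1" by (rule exponent_nonzero_decompose)
    have "Poly_Mapping.lookup p m = 0"
      using lookup_partial_deriv[of i p k] assms[of i] unfolding m
      by (metis lookup_zero mult_eq_0_iff of_nat_eq_0_iff Suc_eq_plus1 nat.distinct(1))
    with False show ?thesis by (simp add: poly_const_def lookup_single)
  qed (simp add: poly_const_def)
qed

lemma total_degree_partial_deriv_less:
  assumes "partial_deriv i p \<noteq> 0"
  shows "total_degree (partial_deriv i p) < total_degree p"
proof -
  have *: "mdeg m < total_degree p" if "m \<in> Poly_Mapping.keys (partial_deriv i p)" for m
  proof -
    have "m + Poly_Mapping.single i 1 \<in> Poly_Mapping.keys p"
      using that by (auto simp: in_keys_iff lookup_partial_deriv)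
    from mdeg_le_total_degree[OF this] show ?thesis by (simp add: mdeg_add)
  qed
  have "Poly_Mapping.keys (partial_deriv i p) \<noteq> {}" using assms by simp
  with * have "0 < total_degree p" by fastforce
  with * show ?thesis by (intro total_degree_less)
qed

text \<open>An element of least total degree has vanishing derivatives.\<close>

lemma deriv_closed_contains_const:
  assumes closed: "\<And>q i. q \<in> J \<Longrightarrow> partial_deriv i q \<in> J"
  shows "p \<in> J \<Longrightarrow> p \<noteq> 0 \<Longrightarrow> \<exists>c. c \<noteq> 0 \<and> poly_const c \<in> J"
proof (induction "total_degree p" arbitrary: p rule: less_induct)
  case less
  show ?case
  proof (cases "\<forall>i. partial_deriv i p = 0")
    case True
    then have "p = poly_const (Poly_Mapping.lookup p 0)" by (intro poly_eq_const_if_derivs_zero) auto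
    with less.prems show ?thesis by (metis poly_const_eq_0_iff)
  next
    case False
    then obtain i where "partial_deriv i p \<noteq> 0" by blast
    then show ?thesis
      using less.hyps[OF total_degree_partial_deriv_less closed[OF less.prems(1)]] by simp
  qed
qed

lemma eval_poly_has_partial_derivative:
  "((\<lambda>t. eval_poly p (x(i := t))) has_field_derivative eval_poly (partial_deriv i p) (x(i := t))) (at t)"
proof (induction p rule: poly_mapping_induct_single)
  case (single m c)
  let ?C = "\<Prod>k\<in>Poly_Mapping.keys m - {i}. x k ^ Poly_Mapping.lookup m k"
  have e: "(\<Prod>k\<in>Poly_Mapping.keys m'. (x(i := t)) k ^ Poly_Mapping.lookup m' k)
      = (\<Prod>k\<in>Poly_Mapping.keys m' - {i}. x k ^ Poly_Mapping.lookup m' k) * t ^ Poly_Mapping.lookup m' i"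
    for t and m' :: "'a \<Rightarrow>\<^sub>0 nat"
  proof (cases "i \<in> Poly_Mapping.keys m'")
    case True
    then show ?thesis by (subst prod.remove[of _ i]) (auto intro!: prod.cong)
  next
    case False
    then show ?thesis by (auto simp: in_keys_iff intro!: prod.cong)
  qed
  have k: "Poly_Mapping.keys (m - Poly_Mapping.single i 1) - {i} = Poly_Mapping.keys m - {i}"
    by (auto simp: in_keys_iff lookup_minus lookup_single when_def)
  have "(\<Prod>k\<in>Poly_Mapping.keys (m - Poly_Mapping.single i 1) - {i}.
      x k ^ Poly_Mapping.lookup (m - Poly_Mapping.single i 1) k) = ?C"
    unfolding k by (rule prod.cong) (auto simp: lookup_minus lookup_single)
  then have "eval_poly (partial_deriv i (Poly_Mapping.single m c)) (x(i := t))
      = c * (?C * (of_nat (Poly_Mapping.lookup m i) * t ^ (Poly_Mapping.lookup m i - 1)))"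
    unfolding partial_deriv_single eval_poly_single e by (simp add: lookup_minus lookup_single)
  then show ?case
    unfolding eval_poly_single e by (auto intro!: derivative_eq_intros simp del: fun_upd_apply)
next
  case (add p q)
  then show ?case by (simp add: eval_poly_add partial_deriv_add DERIV_add)
qed

text \<open>The polynomials that vanish as functions are closed under \<open>partial_deriv\<close>,
  by differentiating along coordinate lines; a nonzero one would lead to a nonzero constant among
  them.\<close>

lemma eval_poly_eq_zeroI:
  assumes "\<And>x. eval_poly p x = 0"
  shows "p = 0"
proof (rule ccontr)
  assume "p \<noteq> 0"
  let ?J = "{p. \<forall>x. eval_poly p x = 0}"
  have "partial_deriv i q \<in> ?J" if "q \<in> ?J" for i and q :: "'a mpoly"
  proof -
    have "eval_poly (partial_deriv i q) x = 0" for x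
    proof -
      have "((\<lambda>t. 0) has_field_derivative eval_poly (partial_deriv i q) (x(i := x i))) (at (x i))"
        using eval_poly_has_partial_derivative[of q x i "x i"] that by simp
      from DERIV_unique[OF this DERIV_const] show ?thesis by simp
    qed
    then show ?thesis by blast
  qed
  from deriv_closed_contains_const[OF this, of p] assms \<open>p \<noteq> 0\<close> show False by auto
qed

lemma eval_poly_ext: "(\<And>x. eval_poly p x = eval_poly q x) \<Longrightarrow> p = q"
  using eval_poly_eq_zeroI[of "p - q"] by (simp add: eval_poly_diff)

lemma nonzero_poly_obtains_point:
  assumes "p \<noteq> 0" obtains x where "eval_poly p x \<noteq> 0"
  using assms eval_poly_eq_zeroI by blast

section \<open>Polynomials of degree one\<close>

definition lin_coeff :: "'i mpoly \<Rightarrow> 'i \<Rightarrow> complex" where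
  "lin_coeff p j = Poly_Mapping.lookup p (Poly_Mapping.single j 1)"

context
  fixes p :: "'n::finite mpoly"
  assumes deg: "total_degree p = 1"
begin

lemma degree_one_partial_deriv: "partial_deriv j p = poly_const (lin_coeff p j)"
proof (rule poly_mapping_eqI)
  fix k
  show "Poly_Mapping.lookup (partial_deriv j p) k = Poly_Mapping.lookup (poly_const (lin_coeff p j)) k"
  proof (cases "k = 0")
    case False
    have "k + Poly_Mapping.single j 1 \<notin> Poly_Mapping.keys p"
    proof
      assume "k + Poly_Mapping.single j 1 \<in> Poly_Mapping.keys p"
      from mdeg_le_total_degree[OF this] deg False show False
        by (simp add: mdeg_add) 
    qed
    with False show ?thesis
      by (simp add: lookup_partial_deriv poly_const_def lookup_single not_in_keys_iff_lookup_eq_zero)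
  qed (simp add: lookup_partial_deriv lin_coeff_def poly_const_def)
qed

text \<open>Subtracting the linear part leaves a polynomial all of whose derivatives vanish, hence a
  constant.\<close>

lemma degree_one_expand:
  "p = poly_const (Poly_Mapping.lookup p 0) + (\<Sum>j\<in>UNIV. poly_const (lin_coeff p j) * poly_var j)"
proof -
  let ?q = "p - (\<Sum>j\<in>UNIV. poly_const (lin_coeff p j) * poly_var j)"
  have ds: "partial_deriv i (sum f A) = (\<Sum>j\<in>A. partial_deriv i (f j))"
    for i and f :: "'n \<Rightarrow> 'n mpoly" and A
    by (induction A rule: infinite_finite_induct) (simp_all add: partial_deriv_add)
  have "partial_deriv i ?q = 0" for i
    by (simp add: partial_deriv_diff degree_one_partial_deriv ds partial_deriv_mult partial_deriv_var
        of_bool_def if_distrib[of "(*) _"] cong: if_cong)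
  then have "?q = poly_const (Poly_Mapping.lookup ?q 0)" by (rule poly_eq_const_if_derivs_zero)
  moreover have "Poly_Mapping.lookup (poly_const c * poly_var j) 0 = 0" for c and j :: 'n
    by (simp add: poly_const_def poly_var_def mult_single lookup_single when_def)
       (metis lookup_single_eq lookup_zero zero_neq_one One_nat_def)
  then have "Poly_Mapping.lookup ?q 0 = Poly_Mapping.lookup p 0"
    by (simp add: lookup_minus lookup_sum)
  ultimately show ?thesis by (simp add: algebra_simps)
qed

lemma degree_one_eval:
  "eval_poly p x = Poly_Mapping.lookup p 0 + (\<Sum>j\<in>UNIV. lin_coeff p j * x j)"
  by (subst degree_one_expand) (simp add: eval_poly_add eval_poly_sum eval_poly_mult)

lemma degree_one_lin_nonzero: "\<exists>j. lin_coeff p j \<noteq> 0"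
proof (rule ccontr)
  assume "\<nexists>j. lin_coeff p j \<noteq> 0"
  then have "p = poly_const (Poly_Mapping.lookup p 0)"
    by (subst degree_one_expand) (simp add: poly_const_hom)
  then have "total_degree p < 1"
    by (intro total_degree_less) (auto simp: poly_const_def in_keys_iff lookup_single when_def split: if_splits,
        metis lookup_single lookup_single_not_eq mdeg_eq_0_iff)
  with deg show False by simp
qed

end

section \<open>Restriction to lines, substitution and small roots\<close>

definition line_poly :: "('i \<Rightarrow> complex) \<Rightarrow> ('i \<Rightarrow> complex) \<Rightarrow> 'i mpoly \<Rightarrow> complex poly" where
  "line_poly x v p = (\<Sum>m\<in>Poly_Mapping.keys p. smult (Poly_Mapping.lookup p m)
     (\<Prod>i\<in>Poly_Mapping.keys m. [:x i, v i:] ^ Poly_Mapping.lookup m i))"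

lemma poly_line_poly [simp]: "poly (line_poly x v p) t = eval_poly p (\<lambda>i. x i + t * v i)"
  by (simp add: line_poly_def eval_poly_def poly_sum poly_prod)

lemma degree_line_poly: "degree (line_poly x v p) \<le> total_degree p"
  unfolding line_poly_def
proof (rule degree_sum_le)
  fix m assume m: "m \<in> Poly_Mapping.keys p"
  have "degree (\<Prod>i\<in>Poly_Mapping.keys m. [:x i, v i:] ^ Poly_Mapping.lookup m i)
      \<le> (\<Sum>i\<in>Poly_Mapping.keys m. degree ([:x i, v i:] ^ Poly_Mapping.lookup m i))"
    by (rule degree_prod_sum_le[unfolded o_def]) simp
  also have "\<dots> \<le> mdeg m" unfolding mdeg_def
  proof (rule sum_mono)
    fix i
    have "degree ([:x i, v i:] ^ Poly_Mapping.lookup m i) \<le> degree [:x i, v i:] * Poly_Mapping.lookup m i"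
      by (rule degree_power_le)
    also have "\<dots> \<le> 1 * Poly_Mapping.lookup m i" by (intro mult_right_mono) auto
    finally show "degree ([:x i, v i:] ^ Poly_Mapping.lookup m i) \<le> Poly_Mapping.lookup m i" by simp
  qed
  also have "\<dots> \<le> total_degree p" using m by (rule mdeg_le_total_degree)
  finally show "degree (smult (Poly_Mapping.lookup p m)
      (\<Prod>i\<in>Poly_Mapping.keys m. [:x i, v i:] ^ Poly_Mapping.lookup m i)) \<le> total_degree p"
    by (meson degree_smult_le order_trans)
qed simp

lemma exists_subst_poly:
  fixes s :: "'i \<Rightarrow> 'j mpoly"
  shows "\<exists>q. \<forall>x. eval_poly q x = eval_poly p (\<lambda>k. eval_poly (s k) x)"
proof -
  let ?q = "\<Sum>m\<in>Poly_Mapping.keys p. poly_const (Poly_Mapping.lookup p m) *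
     (\<Prod>i\<in>Poly_Mapping.keys m. s i ^ Poly_Mapping.lookup m i)"
  have "eval_poly ?q x = eval_poly p (\<lambda>k. eval_poly (s k) x)" for x
    by (simp add: eval_poly_sum eval_poly_mult eval_poly_prod eval_poly_power)
       (simp add: eval_poly_def)
  then show ?thesis by blast
qed

text \<open>The sum of the inverses of the roots is \<open>- P'(0) / P(0)\<close>, so some root is small.\<close>

lemma coeff_bound_if_roots_large:
  fixes P :: "complex poly"
  assumes "\<And>z. poly P z = 0 \<Longrightarrow> r \<le> cmod z" "P \<noteq> 0" "0 < r"
  shows "r * cmod (coeff P 1) \<le> degree P * cmod (coeff P 0)"
  using assms(1,2)
proof (induction "degree P" arbitrary: P)
  case 0
  then have "coeff P 1 = 0" by (metis coeff_eq_0 zero_less_one)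
  then show ?case by simp
next
  case (Suc d)
  then obtain z where z: "poly P z = 0"
    using fundamental_theorem_of_algebra[of P] by (metis constant_degree nat.distinct(1))
  then obtain Q where P: "P = [:- z, 1:] * Q" by (metis dvdE poly_eq_0_iff_dvd)
  from Suc.prems P have Q: "Q \<noteq> 0" by auto
  then have "degree P = degree [:- z, 1:] + degree Q" unfolding P by (intro degree_mult_eq) auto
  then have d: "d = degree Q" using Suc.hyps(2) by simp
  have IH: "r * cmod (coeff Q 1) \<le> d * cmod (coeff Q 0)"
    unfolding d using Suc.prems(1) Q by (intro Suc.hyps(1)[OF d]) (auto simp: P)
  have rz: "r \<le> cmod z" using Suc.prems(1) z by blast
  have c0: "coeff P 0 = - z * coeff Q 0" unfolding P by (simp add: coeff_pCons)
  have c1: "coeff P 1 = coeff Q 0 - z * coeff Q 1" unfolding P by (simp add: coeff_pCons)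
  have "r * cmod (coeff P 1) \<le> r * (cmod (coeff Q 0) + cmod z * cmod (coeff Q 1))"
    unfolding c1 using assms(3) norm_triangle_ineq4[of "coeff Q 0" "z * coeff Q 1"]
    by (simp add: norm_mult)
  also have "\<dots> = r * cmod (coeff Q 0) + cmod z * (r * cmod (coeff Q 1))" by (simp add: algebra_simps)
  also have "\<dots> \<le> cmod z * cmod (coeff Q 0) + cmod z * (d * cmod (coeff Q 0))"
    using rz IH by (intro add_mono mult_right_mono mult_left_mono) auto
  also have "\<dots> = degree P * cmod (coeff P 0)"
    unfolding c0 Suc.hyps(2)[symmetric] by (simp add: norm_mult algebra_simps)
  finally show ?case .
qed

text \<open>Only an upper bound \<open>d\<close> on the degree is asked for, so that one
  \<open>d\<close> serves a whole family of polynomials whose degrees may drop.\<close>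

lemma small_root_exists:
  fixes P :: "complex poly"
  assumes "coeff P 1 \<noteq> 0" "degree P \<le> d" "0 < \<epsilon>" "d * cmod (coeff P 0) < \<epsilon> * cmod (coeff P 1)"
  obtains z where "poly P z = 0" "cmod z < \<epsilon>"
proof (rule ccontr)
  assume "\<not> thesis"
  with that have "\<And>z. poly P z = 0 \<Longrightarrow> \<epsilon> \<le> cmod z" by (meson not_less)
  moreover have "P \<noteq> 0" using assms(1) by auto
  ultimately have "\<epsilon> * cmod (coeff P 1) \<le> degree P * cmod (coeff P 0)"
    using assms(3) by (rule coeff_bound_if_roots_large)
  also have "\<dots> \<le> d * cmod (coeff P 0)" using assms(2) by (intro mult_right_mono) auto
  finally show False using assms(4) by simp
qed

section \<open>Algebraic dependence and the shortening of relations\<close>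

lemma underdetermined_system:
  fixes f :: "'i \<Rightarrow> 'k \<Rightarrow> complex"
  assumes "finite K" "finite I" "card K < card I"
  shows "\<exists>c. (\<exists>i\<in>I. c i \<noteq> 0) \<and> (\<forall>k\<in>K. (\<Sum>i\<in>I. c i * f i k) = 0)"
  using assms
proof (induction K arbitrary: I f rule: finite_induct)
  case empty
  then have "I \<noteq> {}" by auto
  then show ?case by (intro exI[of _ "\<lambda>_. 1"]) auto
next
  case (insert k K)
  show ?case
  proof (cases "\<forall>i\<in>I. f i k = 0")
    case True
    then have "(\<Sum>i\<in>I. c i * f i k) = 0" for c by simp
    moreover have "card K < card I" using insert by simp
    ultimately show ?thesis using insert.IH[OF insert.prems(1), of f] by auto
  next
    case False
    then obtain j where j: "j \<in> I" "f j k \<noteq> 0" by blast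
    \<comment> \<open>Gaussian elimination with pivot \<open>j\<close>: equation \<open>k\<close>
      expresses the unknown \<open>j\<close> through the others, and \<open>g\<close> holds the
      remaining coefficients.\<close>
    define g where "g i l = f i l - f i k / f j k * f j l" for i l
    have "card K < card (I - {j})" using insert j by simp
    from insert.IH[OF _ this, of g] insert.prems(1) obtain c i where
      c: "i \<in> I - {j}" "c i \<noteq> 0" "\<And>l. l \<in> K \<Longrightarrow> (\<Sum>i\<in>I - {j}. c i * g i l) = 0" by auto
    define c' where "c' = c(j := - (\<Sum>i\<in>I - {j}. c i * (f i k / f j k)))"
    have "(\<Sum>i\<in>I. c' i * f i l) = (\<Sum>i\<in>I - {j}. c i * g i l)" for l
    proof -
      have "(\<Sum>i\<in>I. c' i * f i l) = c' j * f j l + (\<Sum>i\<in>I - {j}. c' i * f i l)"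
        by (rule sum.remove[OF insert.prems(1) j(1)])
      also have "(\<Sum>i\<in>I - {j}. c' i * f i l) = (\<Sum>i\<in>I - {j}. c i * f i l)"
        by (rule sum.cong) (auto simp: c'_def)
      finally show ?thesis
        by (simp add: c'_def g_def algebra_simps sum_subtractf sum_distrib_left sum_distrib_right)
    qed
    moreover have "g i k = 0" for i using j by (simp add: g_def)
    moreover have "c' i \<noteq> 0" using c by (auto simp: c'_def)
    ultimately show ?thesis using c by (intro exI[of _ c']) auto
  qed
qed

definition pvars :: "'i mpoly \<Rightarrow> 'i set" where
  "pvars p = (\<Union>m\<in>Poly_Mapping.keys p. Poly_Mapping.keys m)"

lemma eval_poly_cong: "(\<And>i. i \<in> pvars p \<Longrightarrow> x i = y i) \<Longrightarrow> eval_poly p x = eval_poly p y"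
  unfolding eval_poly_def pvars_def by (intro sum.cong prod.cong arg_cong2[where f = "(*)"]) (auto intro!: arg_cong[where f = "\<lambda>z. z ^ _"])

lemma lookup_poly_const_mult:
  "Poly_Mapping.lookup (poly_const c * p) m = c * Poly_Mapping.lookup p m"
proof (induction p rule: poly_mapping_induct_single)
  case (single m' d)
  then show ?case by (simp add: poly_const_def mult_single lookup_single when_def)
qed (simp add: lookup_add algebra_simps)

text \<open>Bounds each exponent separately: bounds add under multiplication, and the monomials in a
  box are counted by a plain power.\<close>

definition expo_bounded :: "'i mpoly \<Rightarrow> nat \<Rightarrow> bool" where
  "expo_bounded p d \<longleftrightarrow> (\<forall>m\<in>Poly_Mapping.keys p. \<forall>i. Poly_Mapping.lookup m i \<le> d)"

lemma expo_bounded_mult: "expo_bounded p d \<Longrightarrow> expo_bounded q e \<Longrightarrow> expo_bounded (p * q) (d + e)"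
  using keys_mult[of p q] unfolding expo_bounded_def
  by (fastforce simp: lookup_add intro: add_mono)

lemma expo_bounded_one: "expo_bounded 1 0"
  by (auto simp: expo_bounded_def)

lemma expo_bounded_power: "expo_bounded p d \<Longrightarrow> expo_bounded (p ^ k) (k * d)"
  by (induction k) (auto simp: expo_bounded_one expo_bounded_mult)

lemma expo_bounded_prod:
  "(\<And>k. k \<in> A \<Longrightarrow> expo_bounded (f k) (d k)) \<Longrightarrow> expo_bounded (prod f A) (sum d A)"
  by (induction A rule: infinite_finite_induct) (auto simp: expo_bounded_one expo_bounded_mult)

lemma expo_bounded_mono: "expo_bounded p d \<Longrightarrow> d \<le> e \<Longrightarrow> expo_bounded p e"
  unfolding expo_bounded_def by (meson le_trans)

lemma expo_bounded_total_degree: "expo_bounded p (total_degree p)"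
  unfolding expo_bounded_def
proof (intro ballI allI)
  fix m i assume m: "m \<in> Poly_Mapping.keys p"
  have "Poly_Mapping.lookup m i \<le> mdeg m"
    unfolding mdeg_def by (cases "i \<in> Poly_Mapping.keys m") (auto simp: in_keys_iff intro: member_le_sum)
  with mdeg_le_total_degree[OF m] show "Poly_Mapping.lookup m i \<le> total_degree p" by simp
qed

lemma card_bounded_exponents:
  fixes D :: nat
  defines "K \<equiv> {m :: 'n::finite \<Rightarrow>\<^sub>0 nat. \<forall>i. Poly_Mapping.lookup m i \<le> D}"
  shows "finite K" "card K \<le> (D + 1) ^ CARD('n)"
proof -
  let ?P = "PiE (UNIV :: 'n set) (\<lambda>_. {..D})"
  have inj: "inj_on Poly_Mapping.lookup K" by (auto simp: inj_on_def lookup_inject)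
  have im: "Poly_Mapping.lookup ` K \<subseteq> ?P" by (auto simp: K_def)
  have fin: "finite ?P" by (intro finite_PiE) auto
  show "finite K" using inj im fin by (meson finite_imageD finite_subset)
  have "card K \<le> card ?P" using inj im fin by (rule card_inj_on_le)
  then show "card K \<le> (D + 1) ^ CARD('n)" by (simp add: card_PiE)
qed

text \<open>Transcendence degree, by counting monomials of bounded degree.\<close>

lemma algebraic_dependence:
  fixes a :: "nat \<Rightarrow> 'n::finite mpoly"
  obtains Q :: "nat mpoly" where "Q \<noteq> 0" "pvars Q \<subseteq> {..CARD('n)}"
    "\<And>x. eval_poly Q (\<lambda>k. eval_poly (a k) x) = 0"
proof -
  let ?n = "CARD('n)"
  define d where "d = (\<Sum>k\<le>?n. total_degree (a k))"
  \<comment> \<open>Chosen so that \<open>((?n + 1) * d + 1) ^ ?n < L\<close>. There are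
    \<open>L ^ (?n + 1)\<close> exponent tuples, and at most \<open>(D + 1) ^ ?n\<close>
    coefficients to annihilate, a number bounded by
    \<open>((?n + 1) * d + 1) ^ ?n * L ^ ?n\<close>.\<close>
  define L where "L = ((?n + 1) * d + 1) ^ ?n + 1"
  define I where "I = PiE {..?n} (\<lambda>_. {..<L})"
  define f where "f e = (\<Prod>k\<le>?n. a k ^ e k)" for e
  define D where "D = (?n + 1) * (L * d)"
  define K where "K = {m :: 'n \<Rightarrow>\<^sub>0 nat. \<forall>i. Poly_Mapping.lookup m i \<le> D}"
  have L: "1 \<le> L" by (simp add: L_def)
  have K: "finite K" "card K \<le> (D + 1) ^ ?n" unfolding K_def by (rule card_bounded_exponents)+
  have I: "finite I" "card I = L ^ (?n + 1)" unfolding I_def by (auto simp: card_PiE intro!: finite_PiE)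
  have "D + 1 \<le> ((?n + 1) * d + 1) * L" using L by (simp add: D_def algebra_simps)
  then have "(D + 1) ^ ?n \<le> ((?n + 1) * d + 1) ^ ?n * L ^ ?n" by (metis power_mono power_mult_distrib zero_le)
  also have "\<dots> < L * L ^ ?n" using L by (intro mult_strict_right_mono) (auto simp: L_def)
  finally have "card K < card I" using K I by simp
  from underdetermined_system[OF K(1) I(1) this, of "\<lambda>e. Poly_Mapping.lookup (f e)"]
  obtain c e0 where c: "e0 \<in> I" "c e0 \<noteq> 0"
    "\<And>m. m \<in> K \<Longrightarrow> (\<Sum>e\<in>I. c e * Poly_Mapping.lookup (f e) m) = 0" by blast
  have fK: "Poly_Mapping.lookup (f e) m = 0" if "e \<in> I" "m \<notin> K" for e m
  proof -
    have "expo_bounded (f e) (\<Sum>k\<le>?n. e k * d)"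
      unfolding f_def
    proof (intro expo_bounded_prod expo_bounded_power)
      fix k assume "k \<in> {..?n}"
      then show "expo_bounded (a k) d"
        unfolding d_def by (intro expo_bounded_mono[OF expo_bounded_total_degree] member_le_sum) auto
    qed
    moreover have "(\<Sum>k\<le>?n. e k * d) \<le> (\<Sum>k\<le>?n. L * d)"
      using that(1) by (intro sum_mono mult_right_mono) (force simp: I_def PiE_def Pi_def)+
    then have "(\<Sum>k\<le>?n. e k * d) \<le> D" by (simp add: D_def)
    ultimately have "expo_bounded (f e) D" by (rule expo_bounded_mono)
    with that(2) show ?thesis unfolding K_def expo_bounded_def by (auto simp: in_keys_iff)
  qed
  have rel: "(\<Sum>e\<in>I. poly_const (c e) * f e) = 0"
  proof (rule poly_mapping_eqI)
    fix m
    show "Poly_Mapping.lookup (\<Sum>e\<in>I. poly_const (c e) * f e) m = Poly_Mapping.lookup 0 m"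
      by (cases "m \<in> K") (simp_all add: lookup_sum lookup_poly_const_mult c fK)
  qed
  define mo where "mo e = (\<Sum>k\<le>?n. Poly_Mapping.single k (e k))" for e :: "nat \<Rightarrow> nat"
  have mo: "Poly_Mapping.lookup (mo e) k = (if k \<le> ?n then e k else 0)" for e k
    by (simp add: mo_def lookup_sum lookup_single when_def)
  have inj: "mo e = mo e' \<Longrightarrow> e = e'" if "e \<in> I" "e' \<in> I" for e e'
  proof (rule ext)
    fix k assume "mo e = mo e'"
    then have "Poly_Mapping.lookup (mo e) k = Poly_Mapping.lookup (mo e') k" by simp
    then show "e k = e' k"
      using that by (cases "k \<le> ?n") (auto simp: mo I_def PiE_def extensional_def)
  qed
  define Q :: "nat mpoly" where "Q = (\<Sum>e\<in>I. Poly_Mapping.single (mo e) (c e))"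
  \<comment> \<open>Distinct tuples give distinct monomials, so nothing cancels at
    \<open>mo e0\<close> and \<open>Q\<close> is nonzero.\<close>
  have "Poly_Mapping.lookup Q (mo e0) = (\<Sum>e\<in>I. if e = e0 then c e else 0)"
    unfolding Q_def lookup_sum
    by (rule sum.cong) (use inj c(1) in \<open>auto simp: lookup_single when_def\<close>)
  then have "Poly_Mapping.lookup Q (mo e0) \<noteq> 0" using c I by simp
  then have "Q \<noteq> 0" by auto
  moreover have "pvars Q \<subseteq> {..?n}"
  proof
    fix k assume "k \<in> pvars Q"
    then obtain m where m: "m \<in> Poly_Mapping.keys Q" "k \<in> Poly_Mapping.keys m" by (auto simp: pvars_def)
    have "Poly_Mapping.keys Q \<subseteq> (\<Union>e\<in>I. Poly_Mapping.keys (Poly_Mapping.single (mo e) (c e)))"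
      unfolding Q_def by (rule keys_sum)
    then obtain e where "m = mo e" using m(1) by (fastforce split: if_splits)
    with m(2) show "k \<in> {..?n}" by (auto simp: in_keys_iff mo split: if_splits)
  qed
  moreover have "eval_poly Q (\<lambda>k. eval_poly (a k) x) = 0" for x
  proof -
    have "(\<Prod>k\<in>Poly_Mapping.keys (mo e). eval_poly (a k) x ^ Poly_Mapping.lookup (mo e) k)
        = eval_poly (f e) x" for e
      unfolding f_def eval_poly_prod eval_poly_power
      by (rule prod.mono_neutral_cong_left) (auto simp: in_keys_iff mo split: if_splits)
    then have "eval_poly Q (\<lambda>k. eval_poly (a k) x) = eval_poly (\<Sum>e\<in>I. poly_const (c e) * f e) x"
      by (simp add: Q_def eval_poly_sum eval_poly_single eval_poly_mult)
    then show ?thesis by (simp add: rel)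
  qed
  ultimately show thesis by (rule that)
qed

text \<open>The last condition says that the monomials of \<open>Q2\<close> arise from monomials of
  \<open>Q\<close> by removing one factor; it yields the smaller degree and the inclusion of
  variables when factors are split off repeatedly.\<close>

lemma poly_split_var:
  fixes Q :: "'i mpoly"
  obtains Q1 Q2 where "Q = Q1 + poly_var k * Q2" "pvars Q1 \<subseteq> pvars Q - {k}"
    "\<And>m. m \<in> Poly_Mapping.keys Q2 \<Longrightarrow> m + Poly_Mapping.single k 1 \<in> Poly_Mapping.keys Q"
proof -
  let ?A = "{m \<in> Poly_Mapping.keys Q. Poly_Mapping.lookup m k = 0}"
  let ?B = "{m \<in> Poly_Mapping.keys Q. Poly_Mapping.lookup m k \<noteq> 0}"
  define Q1 where "Q1 = (\<Sum>m\<in>?A. Poly_Mapping.single m (Poly_Mapping.lookup Q m))"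
  define Q2 where "Q2 = (\<Sum>m\<in>?B. Poly_Mapping.single (m - Poly_Mapping.single k 1) (Poly_Mapping.lookup Q m))"
  have m: "m - Poly_Mapping.single k 1 + Poly_Mapping.single k 1 = m" if "Poly_Mapping.lookup m k \<noteq> 0"
    for m :: "'i \<Rightarrow>\<^sub>0 nat"
    using that by (intro poly_mapping_eqI) (auto simp: lookup_add lookup_minus lookup_single when_def)
  have "poly_var k * Q2 = (\<Sum>m\<in>?B. Poly_Mapping.single m (Poly_Mapping.lookup Q m))"
    unfolding Q2_def sum_distrib_left poly_var_def
    by (rule sum.cong) (auto simp: mult_single m[simplified] add.commute[of "Poly_Mapping.single k _"])
  then have "Q1 + poly_var k * Q2 = (\<Sum>m\<in>?A \<union> ?B. Poly_Mapping.single m (Poly_Mapping.lookup Q m))"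
    unfolding Q1_def by (subst sum.union_disjoint) auto
  also have "?A \<union> ?B = Poly_Mapping.keys Q" by blast
  finally have "Q = Q1 + poly_var k * Q2" by (simp add: poly_mapping_sum_single)
  moreover have "Poly_Mapping.keys Q1 \<subseteq> ?A"
    unfolding Q1_def by (rule order_trans[OF keys_sum]) auto
  then have "pvars Q1 \<subseteq> pvars Q - {k}" unfolding pvars_def by (auto simp: subset_iff)
  moreover have "m + Poly_Mapping.single k 1 \<in> Poly_Mapping.keys Q" if "m \<in> Poly_Mapping.keys Q2" for m
  proof -
    have "Poly_Mapping.keys Q2 \<subseteq> (\<Union>m\<in>?B. Poly_Mapping.keys
        (Poly_Mapping.single (m - Poly_Mapping.single k 1) (Poly_Mapping.lookup Q m)))"
      unfolding Q2_def by (rule keys_sum)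
    with that obtain m' where "m' \<in> ?B" "m = m' - Poly_Mapping.single k 1"
      by (fastforce split: if_splits)
    with m[of m'] show ?thesis by auto
  qed
  ultimately show thesis by (rule that)
qed

text \<open>The tool for shortening a relation: the power of variable \<open>k\<close> is cancelled
  on an irreducible set where the \<open>k\<close>-th function is not identically zero, and where
  that function vanishes only the nonzero \<open>Q1\<close> survives, a relation among the
  others.\<close>

lemma poly_factor_var:
  fixes Q :: "'i mpoly"
  assumes "Q \<noteq> 0"
  shows "\<exists>e Q1 Q2. Q = poly_var k ^ e * (Q1 + poly_var k * Q2) \<and> Q1 \<noteq> 0 \<and> pvars Q1 \<subseteq> pvars Q - {k}"
  using assms
proof (induction "total_degree Q" arbitrary: Q rule: less_induct)
  case less
  obtain Q1 Q2 where Q: "Q = Q1 + poly_var k * Q2" "pvars Q1 \<subseteq> pvars Q - {k}"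
    and keys: "\<And>m. m \<in> Poly_Mapping.keys Q2 \<Longrightarrow> m + Poly_Mapping.single k 1 \<in> Poly_Mapping.keys Q"
    using poly_split_var[of Q k] by metis
  show ?case
  proof (cases "Q1 = 0")
    case False
    then show ?thesis using Q by (intro exI[of _ 0] exI[of _ Q1] exI[of _ Q2]) simp
  next
    case True
    then have Q2: "Q2 \<noteq> 0" using Q less.prems by auto
    have *: "mdeg m < total_degree Q" if "m \<in> Poly_Mapping.keys Q2" for m
      using mdeg_le_total_degree[OF keys[OF that]] by (simp add: mdeg_add)
    moreover have "Poly_Mapping.keys Q2 \<noteq> {}" using Q2 by simp
    ultimately have "total_degree Q2 < total_degree Q" by (intro total_degree_less) fastforce+
    from less.hyps[OF this Q2] obtain e R1 R2 where
      R: "Q2 = poly_var k ^ e * (R1 + poly_var k * R2)" "R1 \<noteq> 0" "pvars R1 \<subseteq> pvars Q2 - {k}" by blast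
    have "pvars Q2 \<subseteq> pvars Q"
    proof
      fix i assume "i \<in> pvars Q2"
      then obtain m where m: "m \<in> Poly_Mapping.keys Q2" "i \<in> Poly_Mapping.keys m" by (auto simp: pvars_def)
      have "i \<in> Poly_Mapping.keys (m + Poly_Mapping.single k 1)"
        using m(2) by (simp add: in_keys_iff lookup_add)
      with keys[OF m(1)] show "i \<in> pvars Q" by (auto simp: pvars_def)
    qed
    moreover have "Q = poly_var k ^ Suc e * (R1 + poly_var k * R2)"
      using Q(1) True R(1) by (simp add: mult.assoc)
    ultimately show ?thesis using R(2,3)
      by (intro exI[of _ "Suc e"] exI[of _ R1] exI[of _ R2]) auto
  qed
qed

section \<open>Linear algebra\<close>

text \<open>Bilinear, without complex conjugation: this is evaluation of a linear form at a
  vector.\<close>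

definition pair :: "complex ^ 'n::finite \<Rightarrow> complex ^ 'n \<Rightarrow> complex" where
  "pair a v = (\<Sum>j\<in>UNIV. a $ j * v $ j)"

lemma pair_add_left: "pair (a + b) v = pair a v + pair b v"
  by (simp add: pair_def algebra_simps sum.distrib)

lemma pair_scale_left: "pair (c *s a) v = c * pair a v"
  by (simp add: pair_def algebra_simps sum_distrib_left)

lemma pair_zero_left [simp]: "pair 0 v = 0"
  by (simp add: pair_def)

lemma pair_sum_left: "pair (sum f A) v = (\<Sum>i\<in>A. pair (f i) v)"
  by (induction A rule: infinite_finite_induct) (simp_all add: pair_add_left)

lemma pair_commute: "pair a v = pair v a"
  by (simp add: pair_def mult.commute)

lemma pair_vanishes_on_span:
  assumes "x \<in> vec.span A" "\<And>u. u \<in> A \<Longrightarrow> pair u v = 0" shows "pair x v = 0"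
  using assms(1)
  by (induction rule: vec.span_induct_alt) (auto simp: pair_add_left pair_scale_left assms(2))

text \<open>A linear map taking each \<open>x\<close> in \<open>P\<close> to the vector with all
  entries \<open>f x\<close> extends to the whole space; any coordinate of the extension is a linear
  form, hence a pairing with a vector.\<close>

lemma dual_vector_exists:
  fixes P :: "(complex ^ 'n::finite) set"
  assumes "vec.independent P"
  shows "\<exists>v. \<forall>x\<in>P. pair x v = f x"
proof -
  obtain g :: "complex ^ 'n \<Rightarrow> complex ^ 'n" where g: "Vector_Spaces.linear (*s) (*s) g" "\<forall>x\<in>P. g x = (\<chi> i. f x)"
    using vec.linear_independent_extend[OF assms, of "\<lambda>x. (\<chi> i. f x) :: complex ^ 'n"] by blast
  interpret g: Vector_Spaces.linear "(*s)" "(*s)" g by (rule g(1))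
  fix j0 :: 'n
  have "pair x (\<chi> j. g (axis j 1) $ j0) = f x" if "x \<in> P" for x
  proof -
    have "g x = g (\<Sum>j\<in>UNIV. (x $ j) *s axis j 1)" by (simp only: basis_expansion)
    also have "\<dots> = (\<Sum>j\<in>UNIV. (x $ j) *s g (axis j 1))" by (simp add: g.sum g.scale)
    finally have "g x $ j0 = (\<Sum>j\<in>UNIV. x $ j * g (axis j 1) $ j0)" by simp
    with g(2) that show ?thesis by (simp add: pair_def)
  qed
  then show ?thesis by blast
qed

text \<open>Adjoin \<open>w\<close> to a basis of the span of \<open>W\<close> and take the dual
  vector of \<open>w\<close>.\<close>

lemma separating_vector:
  fixes W :: "(complex ^ 'n::finite) set"
  assumes "w \<notin> vec.span W"
  obtains v where "pair w v = 1" "\<And>u. u \<in> W \<Longrightarrow> pair u v = 0"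
proof -
  obtain P where P: "P \<subseteq> W" "vec.independent P" "W \<subseteq> vec.span P"
    by (rule vec.maximal_independent_subset)
  have w: "w \<notin> vec.span P" using assms P(1) vec.span_mono by blast
  then have "vec.independent (insert w P)" by (rule vec.independent_insertI) (rule P(2))
  then obtain v where v: "\<And>x. x \<in> insert w P \<Longrightarrow> pair x v = of_bool (x = w)"
    using dual_vector_exists[where f = "\<lambda>x. of_bool (x = w)"] by blast
  have "w \<notin> P" using w vec.span_base by blast
  then have "pair u v = 0" if "u \<in> W" for u
    using that P(3) v by (intro pair_vanishes_on_span[of u P]) auto
  with v[of w] show thesis by (intro that) auto
qed

lemma span_image_obtains_coeffs:
  fixes a :: "'i \<Rightarrow> complex ^ 'n::finite"
  assumes "finite R" "x \<in> vec.span (a ` R)"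
  obtains c where "x = (\<Sum>b\<in>R. c b *s a b)"
proof -
  have "\<exists>c. x = (\<Sum>b\<in>R. c b *s a b)" using assms(2)
  proof (induction rule: vec.span_induct_alt)
    case base
    show ?case by (intro exI[of _ "\<lambda>_. 0"]) simp
  next
    case (step c u y)
    then obtain d b where d: "y = (\<Sum>b\<in>R. d b *s a b)" and b: "b \<in> R" "u = a b" by blast
    have "c *s u + y = (\<Sum>b'\<in>R. ((if b' = b then c else 0) + d b') *s a b')"
      using assms(1) b d by (simp add: vec.scale_left_distrib sum.distrib if_distrib[of "\<lambda>z. z *s _"] cong: if_cong)
    then show ?case by (intro exI)
  qed
  then show thesis using that by blast
qed

text \<open>Bases of two spans that meet only in zero form an independent set together, so the dual
  vectors of the first basis annihilate \<open>T\<close>. They are the directions in which the Euler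
  field of a block differentiates.\<close>

lemma split_span_dual_basis:
  fixes a :: "'i \<Rightarrow> complex ^ 'n::finite"
  assumes int: "vec.span (a ` S) \<inter> vec.span (a ` T) \<subseteq> {0}"
  obtains R v where "R \<subseteq> S" "a ` S \<subseteq> vec.span (a ` R)"
    "\<And>i i'. i \<in> R \<Longrightarrow> i' \<in> R \<Longrightarrow> pair (a i) (v i') = of_bool (i = i')"
    "\<And>b i'. b \<in> T \<Longrightarrow> i' \<in> R \<Longrightarrow> pair (a b) (v i') = 0"
proof -
  obtain P where P: "P \<subseteq> a ` S" "vec.independent P" "a ` S \<subseteq> vec.span P"
    by (rule vec.maximal_independent_subset)
  obtain Q where Q: "Q \<subseteq> a ` T" "vec.independent Q" "a ` T \<subseteq> vec.span Q"
    by (rule vec.maximal_independent_subset)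
  have int': "x = 0" if "x \<in> vec.span P" "x \<in> vec.span Q" for x
    using that int vec.span_mono[OF P(1)] vec.span_mono[OF Q(1)] by blast
  \<comment> \<open>Stated for \<open>P'\<close> and \<open>Q'\<close> because it is applied to the
    two bases in both orders.\<close>
  have aux: "False" if hyp: "x \<in> P'" "x \<in> vec.span ((P' - {x}) \<union> Q')" "vec.independent P'"
      "\<And>y. y \<in> vec.span P' \<Longrightarrow> y \<in> vec.span Q' \<Longrightarrow> y = 0" for x P' Q'
  proof -
    obtain y z where yz: "x = y + z" "y \<in> vec.span (P' - {x})" "z \<in> vec.span Q'"
      using hyp(2) unfolding vec.span_Un by blast
    have "y \<in> vec.span P'" using yz(2) vec.span_mono[of "P' - {x}" P'] by blast
    with hyp(1) have "x - y \<in> vec.span P'" by (auto intro: vec.span_diff vec.span_base)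
    then have "z = 0" using hyp(4)[of z] yz by simp
    with yz have "x \<in> vec.span (P' - {x})" by simp
    with hyp(1,3) show False unfolding vec.dependent_def by blast
  qed
  have disj: "P \<inter> Q = {}"
  proof (rule ccontr)
    assume "P \<inter> Q \<noteq> {}"
    then obtain x where "x \<in> P" "x \<in> Q" by blast
    with int'[of x] have "0 \<in> P" by (auto dest: vec.span_base)
    with P(2) show False using vec.dependent_zero by blast
  qed
  have "vec.independent (P \<union> Q)"
    unfolding vec.dependent_def
  proof
    assume "\<exists>x\<in>P \<union> Q. x \<in> vec.span (P \<union> Q - {x})"
    then obtain x where x: "x \<in> P \<union> Q" "x \<in> vec.span (P \<union> Q - {x})" by blast
    show False
    proof (cases "x \<in> P")
      case True
      with disj have "P \<union> Q - {x} = (P - {x}) \<union> Q" by blast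
      with x(2) have "x \<in> vec.span ((P - {x}) \<union> Q)" by simp
      from aux[OF True this P(2) int'] show False .
    next
      case False
      then have "P \<union> Q - {x} = (Q - {x}) \<union> P" by blast
      with x(2) have "x \<in> vec.span ((Q - {x}) \<union> P)" by simp
      from aux[OF _ this Q(2)] int' x(1) False show False by blast
    qed
  qed
  then have "\<exists>v. \<forall>x\<in>P \<union> Q. pair x v = of_bool (x = y)" for y
    using dual_vector_exists[where f = "\<lambda>x. of_bool (x = y)"] by blast
  then have "\<forall>y. \<exists>v. \<forall>x\<in>P \<union> Q. pair x v = of_bool (x = y)" by blast
  from choice[OF this] obtain d
    where d: "\<And>x y. x \<in> P \<union> Q \<Longrightarrow> pair x (d y) = of_bool (x = y)" by blast
  obtain R where R: "R \<subseteq> S" "inj_on a R" "P = a ` R"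
    using P(1) by (meson subset_image_inj)
  show thesis
  proof (rule that[of R "\<lambda>i. d (a i)"])
    show "R \<subseteq> S" by (rule R)
    show "a ` S \<subseteq> vec.span (a ` R)" using P(3) R(3) by simp
    show "pair (a i) (d (a i')) = of_bool (i = i')" if "i \<in> R" "i' \<in> R" for i i'
      using d[of "a i" "a i'"] R that by (auto simp: inj_on_eq_iff)
    show "pair (a b) (d (a i')) = 0" if "b \<in> T" "i' \<in> R" for b i'
    proof (rule pair_vanishes_on_span[of _ Q])
      show "a b \<in> vec.span Q" using Q(3) that by blast
      show "pair u (d (a i')) = 0" if "u \<in> Q" for u
        using d[of u "a i'"] that \<open>i' \<in> R\<close> R(3) disj by auto
    qed
  qed
qed

lemma avoid_zeros:
  fixes P :: "'j \<Rightarrow> complex poly"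
  assumes "finite J" "\<And>j. j \<in> J \<Longrightarrow> P j \<noteq> 0"
  obtains t where "\<And>j. j \<in> J \<Longrightarrow> poly (P j) t \<noteq> 0"
proof -
  have "finite (\<Union>j\<in>J. {t. poly (P j) t = 0})" using assms by (intro finite_UN_I poly_roots_finite)
  then obtain t where "t \<notin> (\<Union>j\<in>J. {t. poly (P j) t = 0})"
    using ex_new_if_finite infinite_UNIV_char_0 by blast
  with that show thesis by blast
qed

text \<open>A vector good for \<open>W\<close> is moved along a coordinate axis on which
  \<open>w\<close> is nonzero. Each form becomes a nonzero polynomial in the step length, and
  finitely many such polynomials have a common nonroot.\<close>

lemma common_nonzero_vector:
  fixes W :: "(complex ^ 'n::finite) set"
  assumes "finite W" "\<And>w. w \<in> W \<Longrightarrow> w \<noteq> 0"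
  shows "\<exists>v. \<forall>w\<in>W. pair w v \<noteq> 0"
  using assms
proof (induction rule: finite_induct)
  case (insert w W)
  then obtain v where v: "\<forall>u\<in>W. pair u v \<noteq> 0" by auto
  obtain j where j: "w $ j \<noteq> 0" using insert.prems[of w] by (auto simp: vec_eq_iff)
  have pj: "pair u (axis j 1) = u $ j" for u
    by (simp add: pair_def axis_def if_distrib cong: if_cong)
  define P where "P u = [: pair u v, u $ j :]" for u
  have "P u \<noteq> 0" if "u \<in> insert w W" for u using that v j by (auto simp: P_def)
  then obtain t where t: "\<And>u. u \<in> insert w W \<Longrightarrow> poly (P u) t \<noteq> 0"
    using avoid_zeros[of "insert w W" P] insert.hyps by auto
  have "pair u (v + t *s axis j 1) = poly (P u) t" for u
    by (simp add: P_def pair_commute[of u] pair_add_left pair_scale_left)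
       (simp add: pair_commute[of _ u] pj)
  with t show ?case by (intro exI[of _ "v + t *s axis j 1"]) auto
qed simp

section \<open>Polynomials, constants and derivatives inside the rational functions\<close>

definition rf :: "'n::linorder mpoly \<Rightarrow> 'n ratfun" where "rf p = to_ratfun p"

lemma rf_add: "rf (p + q) = rf p + rf q" and rf_mult: "rf (p * q) = rf p * rf q"
  by (simp_all add: rf_def)

lemma rf_0 [simp]: "rf 0 = 0" and rf_1 [simp]: "rf 1 = 1"
  by (simp_all add: rf_def fract_collapse)

lemma rf_power: "rf (p ^ k) = rf p ^ k"
  by (induction k) (simp_all add: rf_mult)

lemma rf_eq_0_iff [simp]: "rf p = 0 \<longleftrightarrow> p = 0"
  by (simp add: rf_def Zero_fract_def eq_fract)

lemma rf_sum: "rf (sum f A) = (\<Sum>i\<in>A. rf (f i))"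
  by (induction A rule: infinite_finite_induct) (simp_all add: rf_add)

lemma rf_prod: "rf (prod f A) = (\<Prod>i\<in>A. rf (f i))"
  by (induction A rule: infinite_finite_induct) (simp_all add: rf_mult)

lemma Fract_eq_rf: "Fract p q = rf p / rf q"
  by (simp add: rf_def)

lemma ratfun_deriv_rf: "ratfun_deriv j (rf p) = rf (partial_deriv j p)"
  unfolding rf_def by (rule ratfun_deriv_to_ratfun)

lemma localization_iff_rf: "f \<in> localization a \<longleftrightarrow> (\<exists>p k. f = rf p / rf a ^ k)"
  unfolding localization_iff Fract_eq_rf rf_power ..

definition cf :: "complex \<Rightarrow> 'n::linorder ratfun" where "cf c = rf (poly_const c)"

lemma cf_hom: "cf (c + d) = cf c + cf d" "cf (c * d) = cf c * cf d" "cf 0 = 0" "cf 1 = 1"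
  by (simp_all only: cf_def poly_const_hom rf_add rf_mult rf_0 rf_1)

lemma cf_uminus: "cf (- c) = - cf c"
  by (metis cf_hom(1,3) add.right_inverse minus_unique)

lemma cf_diff: "cf (c - d) = cf c - cf d"
  using cf_hom(1)[of c "- d"] by (simp add: cf_uminus)

lemma cf_sum: "cf (sum f A) = (\<Sum>i\<in>A. cf (f i))"
  by (induction A rule: infinite_finite_induct) (simp_all add: cf_hom)

lemma cf_of_nat: "cf (of_nat k) = of_nat k"
  by (induction k) (simp_all add: cf_hom)

lemma ratfun_deriv_cf [simp]: "ratfun_deriv j (cf c) = 0"
  by (simp add: cf_def ratfun_deriv_rf)

section \<open>Submodules of the twisted module\<close>

lemma partial_deriv_power:
  "partial_deriv j (p ^ Suc k) = of_nat (Suc k) * p ^ k * partial_deriv j p"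
  by (induction k) (simp_all add: partial_deriv_mult algebra_simps)

definition lin :: "'n::finite mpoly \<Rightarrow> complex ^ 'n" where "lin p = (\<chi> j. lin_coeff p j)"

lemma eval_poly_shift:
  assumes "total_degree p = 1"
  shows "eval_poly p (\<lambda>j. x j + y $ j) = eval_poly p x + pair (lin p) y"
  by (simp add: degree_one_eval[OF assms] pair_def lin_def algebra_simps sum.distrib)

lemma lin_nonzero: "total_degree p = 1 \<Longrightarrow> lin p \<noteq> 0"
  using degree_one_lin_nonzero[of p] by (auto simp: lin_def vec_eq_iff)

lemma total_degree_one_nonzero: "total_degree p = 1 \<Longrightarrow> p \<noteq> 0"
  by (auto simp: total_degree_def)

lemma ratfun_deriv_inverse:
  assumes "x \<noteq> 0"
  shows "ratfun_deriv j (1 / x) = - (1 / x) * (ratfun_deriv j x / x)"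
proof -
  have "ratfun_deriv j (1 :: 'a ratfun) = 0"
    using ratfun_deriv_cf[of j 1] by (simp only: cf_hom)
  moreover have "ratfun_deriv j (x * (1 / x)) = ratfun_deriv j x * (1 / x) + x * ratfun_deriv j (1 / x)"
    by (rule ratfun_deriv_mult)
  ultimately have "x * ratfun_deriv j (1 / x) = - (ratfun_deriv j x * (1 / x))"
    using assms by (simp add: eq_neg_iff_add_eq_0 add.commute)
  then show ?thesis using assms by (simp add: field_simps)
qed

lemma ratfun_deriv_prod:
  "(\<And>i. i \<in> A \<Longrightarrow> f i \<noteq> 0) \<Longrightarrow>
   ratfun_deriv j (prod f A) = prod f A * (\<Sum>i\<in>A. ratfun_deriv j (f i) / f i)"
proof (induction A rule: infinite_finite_induct)
  case (insert i A)
  then show ?case by (simp add: ratfun_deriv_mult field_simps)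
qed (use ratfun_deriv_cf[of j 1] in \<open>simp_all add: cf_hom\<close>)

lemma ratfun_deriv_power:
  assumes "x \<noteq> 0"
  shows "ratfun_deriv j (x ^ k) = of_nat k * x ^ k * (ratfun_deriv j x / x)"
  using ratfun_deriv_prod[of "{..<k}" "\<lambda>_. x" j] assms by (simp add: mult_ac)

text \<open>The elements sent into \<open>N\<close> by some product of operators \<open>\<theta> - c\<close> with \<open>c \<in> \<Lambda>\<close>.\<close>

inductive_set geneig :: "('n::linorder ratfun \<Rightarrow> 'n ratfun) \<Rightarrow> 'n ratfun set \<Rightarrow> complex set \<Rightarrow> 'n ratfun set"
  for \<theta> N \<Lambda> where
  base: "x \<in> N \<Longrightarrow> x \<in> geneig \<theta> N \<Lambda>"
| step: "\<theta> x - cf c * x \<in> geneig \<theta> N \<Lambda> \<Longrightarrow> c \<in> \<Lambda> \<Longrightarrow> x \<in> geneig \<theta> N \<Lambda>"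

context
  fixes \<theta> :: "'n::linorder ratfun \<Rightarrow> 'n ratfun" and N and \<Lambda> :: "complex set"
  assumes \<theta>_add: "\<And>x y. \<theta> (x + y) = \<theta> x + \<theta> y" and \<theta>_cf: "\<And>c x. \<theta> (cf c * x) = cf c * \<theta> x"
    and N_add: "\<And>x y. x \<in> N \<Longrightarrow> y \<in> N \<Longrightarrow> x + y \<in> N"
    and N_cf: "\<And>c x. x \<in> N \<Longrightarrow> cf c * x \<in> N"
    and N_\<theta>: "\<And>x. x \<in> N \<Longrightarrow> \<theta> x \<in> N"
begin

lemma \<theta>_diff: "\<theta> (x - y) = \<theta> x - \<theta> y"
  using \<theta>_add[of "x - y" y] by simp

lemma N_diff: "x \<in> N \<Longrightarrow> y \<in> N \<Longrightarrow> x - y \<in> N"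
  using N_add[of x "cf (- 1) * y"] N_cf[of y "- 1"] by (simp add: cf_uminus cf_hom)

lemma N_shift: "x \<in> N \<Longrightarrow> \<theta> x - cf c * x \<in> N"
  by (intro N_diff N_\<theta> N_cf)

lemma shift_commute:
  "\<theta> (\<theta> x - cf d * x) - cf c * (\<theta> x - cf d * x) = \<theta> (\<theta> x - cf c * x) - cf d * (\<theta> x - cf c * x)"
  by (simp add: \<theta>_diff \<theta>_cf right_diff_distrib)

lemma geneig_shift: "x \<in> geneig \<theta> N \<Lambda> \<Longrightarrow> \<theta> x - cf d * x \<in> geneig \<theta> N \<Lambda>"
proof (induction rule: geneig.induct)
  case (base x)
  then show ?case by (intro geneig.base N_shift)
next
  case (step x c)
  then show ?case using geneig.step[of \<theta> "\<theta> x - cf d * x" c] shift_commute[of x c d] by metis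
qed

lemma geneig_add_base: "y \<in> geneig \<theta> N \<Lambda> \<Longrightarrow> x \<in> N \<Longrightarrow> x + y \<in> geneig \<theta> N \<Lambda>"
proof (induction arbitrary: x rule: geneig.induct)
  case (base y)
  then show ?case by (intro geneig.base N_add)
next
  case (step y c)
  have "(\<theta> x - cf c * x) + (\<theta> y - cf c * y) \<in> geneig \<theta> N \<Lambda>" by (intro step.IH N_shift step.prems)
  then have "\<theta> (x + y) - cf c * (x + y) \<in> geneig \<theta> N \<Lambda>" by (simp add: \<theta>_add algebra_simps)
  then show ?case using step.hyps(2) by (rule geneig.step)
qed

lemma geneig_add: "x \<in> geneig \<theta> N \<Lambda> \<Longrightarrow> y \<in> geneig \<theta> N \<Lambda> \<Longrightarrow> x + y \<in> geneig \<theta> N \<Lambda>"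
proof (induction arbitrary: y rule: geneig.induct)
  case (base x)
  then show ?case by (intro geneig_add_base)
next
  case (step x c)
  have "(\<theta> x - cf c * x) + (\<theta> y - cf c * y) \<in> geneig \<theta> N \<Lambda>" by (intro step.IH geneig_shift step.prems)
  then have "\<theta> (x + y) - cf c * (x + y) \<in> geneig \<theta> N \<Lambda>" by (simp add: \<theta>_add algebra_simps)
  then show ?case using step.hyps(2) by (rule geneig.step)
qed

lemma geneig_sum:
  "0 \<in> N \<Longrightarrow> (\<And>i. i \<in> A \<Longrightarrow> f i \<in> geneig \<theta> N \<Lambda>) \<Longrightarrow> sum f A \<in> geneig \<theta> N \<Lambda>"
  by (induction A rule: infinite_finite_induct) (auto intro: geneig_add geneig.base)

text \<open>Modulo \<open>N\<close> the operator acts on \<open>x\<close> by \<open>- r\<close>,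
  which is not in \<open>\<Lambda>\<close>. By induction \<open>?y\<close> lies in \<open>N\<close>,
  and \<open>?z - ?y\<close> is \<open>r + c\<close> times \<open>x\<close>, with an invertible
  scalar.\<close>

lemma geneig_disjoint_eigenvalue:
  assumes "\<And>c. c \<in> \<Lambda> \<Longrightarrow> r + c \<noteq> 0"
  shows "x \<in> geneig \<theta> N \<Lambda> \<Longrightarrow> \<theta> x + cf r * x \<in> N \<Longrightarrow> x \<in> N"
proof (induction rule: geneig.induct)
  case (step x c)
  let ?y = "\<theta> x - cf c * x" and ?z = "\<theta> x + cf r * x"
  have "\<theta> ?y + cf r * ?y = \<theta> ?z - cf c * ?z" by (simp add: \<theta>_diff \<theta>_add \<theta>_cf distrib_left right_diff_distrib) (simp add: algebra_simps)
  then have "?y \<in> N" using step.IH N_shift[OF step.prems] by simp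
  then have "cf (inverse (r + c)) * (?z - ?y) \<in> N" by (rule N_cf[OF N_diff[OF step.prems]])
  moreover have "cf (inverse (r + c)) * (?z - ?y) = cf (inverse (r + c) * (r + c)) * x"
    by (simp only: cf_hom) (simp add: algebra_simps)
  ultimately show ?case using assms[OF step.hyps(2)] by (simp add: cf_hom)
qed

end

section \<open>Submodules and their localizations\<close>

locale twisted =
  fixes m :: nat and \<alpha> :: "nat \<Rightarrow> 'n::{finite,linorder} mpoly" and \<beta> :: "nat \<Rightarrow> complex"
  assumes degree_one: "\<And>i. i \<in> {1..m} \<Longrightarrow> total_degree (\<alpha> i) = 1"
begin

abbreviation "tw \<equiv> twisted_deriv m \<alpha> \<beta>"

definition "a = (\<Prod>i = 1..m. \<alpha> i)"

lemma \<alpha>_nz: "i \<in> {1..m} \<Longrightarrow> \<alpha> i \<noteq> 0"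
  by (rule total_degree_one_nonzero[OF degree_one])

lemma a_nz: "a \<noteq> 0"
  using \<alpha>_nz by (simp add: a_def)

lemma tw_mult: "tw j (q * x) = ratfun_deriv j q * x + q * tw j x"
  by (rule twisted_deriv_mult)

text \<open>Closure under generators of the Weyl algebra, phrased for all polynomials at once so
  that operator expressions disappear from the arguments below.\<close>

definition dsub :: "'n ratfun set \<Rightarrow> bool" where
  "dsub N \<longleftrightarrow> 0 \<in> N \<and> (\<forall>x\<in>N. \<forall>y\<in>N. x + y \<in> N) \<and> (\<forall>p. \<forall>x\<in>N. rf p * x \<in> N) \<and> (\<forall>j. \<forall>x\<in>N. tw j x \<in> N)"

lemma
  assumes "dsub N"
  shows dsub_0: "0 \<in> N"
    and dsub_add: "x \<in> N \<Longrightarrow> y \<in> N \<Longrightarrow> x + y \<in> N"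
    and dsub_rf: "x \<in> N \<Longrightarrow> rf p * x \<in> N"
    and dsub_tw: "x \<in> N \<Longrightarrow> tw j x \<in> N"
  using assms by (auto simp: dsub_def)

lemma dsub_cf: "dsub N \<Longrightarrow> x \<in> N \<Longrightarrow> cf c * x \<in> N"
  unfolding cf_def by (rule dsub_rf)

lemma dsub_rf_power: "dsub N \<Longrightarrow> x \<in> N \<Longrightarrow> rf p ^ k * x \<in> N"
  unfolding rf_power[symmetric] by (rule dsub_rf)

lemma dsub_diff: "dsub N \<Longrightarrow> x \<in> N \<Longrightarrow> y \<in> N \<Longrightarrow> x - y \<in> N"
  using dsub_add[of N x "cf (- 1) * y"] dsub_cf[of N y "- 1"] by (simp add: cf_uminus cf_hom)

lemma dsub_sum: "dsub N \<Longrightarrow> (\<And>i. i \<in> A \<Longrightarrow> f i \<in> N) \<Longrightarrow> sum f A \<in> N"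
  by (induction A rule: infinite_finite_induct) (auto intro: dsub_0 dsub_add)

text \<open>The localization of \<open>N\<close> at the powers of \<open>g\<close>, formed inside
  the field of rational functions.\<close>

definition loc :: "'n mpoly \<Rightarrow> 'n ratfun set \<Rightarrow> 'n ratfun set" where
  "loc g N = {f. \<exists>e. rf g ^ e * f \<in> N}"

lemma loc_superset: "N \<subseteq> loc g N"
  unfolding loc_def by (auto intro: exI[of _ 0])

lemma loc_dsub:
  assumes N: "dsub N"
  shows "dsub (loc g N)"
  unfolding dsub_def
proof (intro conjI ballI allI)
  show "0 \<in> loc g N" using loc_superset dsub_0[OF N] by blast
next
  fix x y assume "x \<in> loc g N" "y \<in> loc g N"
  then obtain d e where de: "rf g ^ d * x \<in> N" "rf g ^ e * y \<in> N" unfolding loc_def by blast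
  have "rf g ^ e * (rf g ^ d * x) + rf g ^ d * (rf g ^ e * y) \<in> N"
    by (intro dsub_add[OF N] dsub_rf_power[OF N] de)
  then have "rf g ^ (d + e) * (x + y) \<in> N" by (simp add: power_add algebra_simps)
  then show "x + y \<in> loc g N" unfolding loc_def by blast
next
  fix p x assume "x \<in> loc g N"
  then obtain e where "rf g ^ e * x \<in> N" unfolding loc_def by blast
  from dsub_rf[OF N this, of p] have "rf g ^ e * (rf p * x) \<in> N" by (simp add: mult_ac)
  then show "rf p * x \<in> loc g N" unfolding loc_def by blast
next
  fix j x assume "x \<in> loc g N"
  then obtain e where e: "rf g ^ e * x \<in> N" unfolding loc_def by blast
  \<comment> \<open>The exponent \<open>Suc e\<close> is one more than \<open>x\<close> requires, so
    that differentiating the power still leaves the factor \<open>g ^ e\<close> that brings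
    \<open>x\<close> into \<open>N\<close>.\<close>
  have 1: "tw j (rf (g ^ Suc e) * x) = rf (of_nat (Suc e) * partial_deriv j g) * (rf g ^ e * x)
      + rf g ^ Suc e * tw j x"
    unfolding tw_mult ratfun_deriv_rf partial_deriv_power by (simp only: rf_mult rf_power mult_ac)
  have "rf (g ^ Suc e) * x \<in> N" using dsub_rf[OF N e, of g] by (simp add: rf_power rf_mult mult_ac)
  then have "tw j (rf (g ^ Suc e) * x) - rf (of_nat (Suc e) * partial_deriv j g) * (rf g ^ e * x) \<in> N"
    by (rule dsub_diff[OF N dsub_tw[OF N] dsub_rf[OF N e]])
  then have "rf g ^ Suc e * tw j x \<in> N" unfolding 1 by simp
  then show "tw j x \<in> loc g N" unfolding loc_def by blast
qed

lemma loc_divide: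
  assumes N: "dsub N" and x: "x \<in> loc g N" and g: "g \<noteq> 0" "g = h * h'"
  shows "x / rf h \<in> loc g N"
proof -
  from x obtain e where e: "rf g ^ e * x \<in> N" unfolding loc_def by blast
  have "rf h \<noteq> 0" using g by auto
  then have "rf g ^ Suc e * (x / rf h) = rf h' * (rf g ^ e * x)"
    by (simp add: g(2) rf_mult field_simps)
  with dsub_rf[OF N e, of h'] have "rf g ^ Suc e * (x / rf h) \<in> N" by simp
  then show ?thesis unfolding loc_def by blast
qed

lemma log_form_rf:
  "log_form m \<alpha> \<beta> j = (\<Sum>i = 1..m. cf (\<beta> i) * (rf (partial_deriv j (\<alpha> i)) / rf (\<alpha> i)))"
  by (simp only: log_form_def cf_def rf_def)

text \<open>After inverting \<open>a\<close>, the summand with \<open>log_form\<close> can be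
  subtracted from a twisted derivative. The polynomials in the localized module are therefore closed
  under ordinary derivatives, so they include a nonzero constant and hence \<open>1\<close>.\<close>

lemma loc_generated_by_nonzero:
  assumes N: "dsub N" "N \<subseteq> localization a" and x: "x \<in> N" "x \<noteq> 0"
  shows "localization a \<subseteq> loc a N"
proof -
  let ?L = "loc a N"
  have L: "dsub ?L" by (rule loc_dsub[OF N(1)])
  have div: "y / rf (\<alpha> i) \<in> ?L" if "y \<in> ?L" "i \<in> {1..m}" for y i
  proof -
    have "a = \<alpha> i * (\<Prod>l\<in>{1..m} - {i}. \<alpha> l)"
      unfolding a_def using that(2) by (subst prod.remove[of _ i]) auto
    with that(1) show ?thesis by (rule loc_divide[OF N(1) _ a_nz])
  qed
  obtain p k where p: "x = rf p / rf a ^ k" using x(1) N(2) localization_iff_rf[of x a] by blast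
  have rp: "rf p = rf a ^ k * x" using a_nz by (simp add: p)
  have "rf p \<in> ?L" unfolding rp using loc_superset x(1) by (intro dsub_rf_power[OF L]) blast
  moreover have "p \<noteq> 0" using x(2) p by auto
  moreover have "partial_deriv j q \<in> {q. rf q \<in> ?L}" if "q \<in> {q. rf q \<in> ?L}" for q j
  proof -
    have q: "rf q \<in> ?L" using that by simp
    have "rf q * log_form m \<alpha> \<beta> j
        = (\<Sum>i = 1..m. cf (\<beta> i) * (rf (partial_deriv j (\<alpha> i)) * (rf q / rf (\<alpha> i))))"
      unfolding log_form_rf sum_distrib_left by (intro sum.cong) (auto simp: mult_ac)
    also have "\<dots> \<in> ?L" by (intro dsub_sum[OF L] dsub_cf[OF L] dsub_rf[OF L] div q)
    finally have "tw j (rf q) - rf q * log_form m \<alpha> \<beta> j \<in> ?L" by (intro dsub_diff[OF L] dsub_tw[OF L] q)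
    then show ?thesis by (simp add: twisted_deriv_def ratfun_deriv_rf)
  qed
  ultimately obtain c where c: "c \<noteq> 0" "rf (poly_const c) \<in> ?L"
    using deriv_closed_contains_const[of "{q. rf q \<in> ?L}" p] by blast
  have "cf (inverse c) * cf c \<in> ?L" unfolding cf_def[of c] by (rule dsub_cf[OF L c(2)])
  with c(1) have one: "1 \<in> ?L" by (simp flip: cf_hom)
  have "rf p / rf a ^ k \<in> ?L" for p k
  proof (induction k)
    case 0
    show ?case using dsub_rf[OF L one, of p] by simp
  next
    case (Suc k)
    from loc_divide[OF N(1) this a_nz, of a 1] show ?case by (simp add: mult.commute)
  qed
  then show ?thesis by (auto simp: localization_iff_rf)
qed

end

section \<open>Quotients supported on an intersection of hyperplanes\<close>

definition aug :: "'n::finite mpoly \<Rightarrow> complex ^ 'n option" where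
  "aug p = (\<chi> k. case k of None \<Rightarrow> Poly_Mapping.lookup p 0 | Some j \<Rightarrow> lin_coeff p j)"

lemma sum_option: "(\<Sum>k\<in>UNIV. f k) = f None + (\<Sum>j\<in>(UNIV :: 'n::finite set). f (Some j))"
  by (simp add: UNIV_option_conv sum.reindex)

text \<open>Homogenization: the entry \<open>None\<close> carries the constant term, so relations
  between affine forms become linear relations between vectors.\<close>

lemma pair_aug:
  assumes "total_degree p = 1" "v $ None = 1"
  shows "pair (aug p) v = eval_poly p (\<lambda>j. v $ Some j)"
  by (simp add: degree_one_eval[OF assms(1)] pair_def aug_def sum_option assms(2))

lemma sum_rf_eval:
  assumes "\<And>x. eval_poly p x = (\<Sum>i\<in>A. c i * eval_poly (q i) x)"
  shows "rf p = (\<Sum>i\<in>A. cf (c i) * rf (q i))"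
proof -
  have "p = (\<Sum>i\<in>A. poly_const (c i) * q i)"
    by (rule eval_poly_ext) (simp add: assms eval_poly_sum eval_poly_mult)
  then show ?thesis by (simp add: rf_sum rf_mult cf_def)
qed

text \<open>Here \<open>N\<close> is already localized away from \<open>B\<close>, which is what
  \<open>N_div\<close> expresses. The condition \<open>nil\<close> comes from minimality of
  \<open>B\<close> and says that the quotient is supported on every hyperplane of
  \<open>B\<close>.\<close>

locale local_sub = twisted m \<alpha> \<beta>
  for m :: nat and \<alpha> :: "nat \<Rightarrow> 'n::{finite,linorder} mpoly" and \<beta> +
  fixes N :: "'n ratfun set" and B :: "nat set"
  assumes N: "dsub N" and B: "B \<subseteq> {1..m}"
    and N_div: "\<And>j x. j \<in> {1..m} - B \<Longrightarrow> x \<in> N \<Longrightarrow> x / rf (\<alpha> j) \<in> N"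
    and nil: "\<And>i x. i \<in> B \<Longrightarrow> x \<in> localization a \<Longrightarrow> \<exists>e. rf (\<alpha> i) ^ e * x \<in> N"
    and proper: "\<not> localization a \<subseteq> N"
begin

lemma fin: "finite B"
  using B by (rule finite_subset) simp

lemma M_rf: "x \<in> localization a \<Longrightarrow> rf p * x \<in> localization a"
  unfolding rf_def by (intro localization_mult localization_poly a_nz)

text \<open>The forms are treated one at a time: \<open>y\<close> is multiplied by the last power of
  \<open>rf (\<alpha> i)\<close> that keeps it outside \<open>N\<close>. What was achieved for
  earlier forms persists, as \<open>N\<close> is closed under multiplication by polynomials.\<close>

lemma socle_exists: "\<exists>y. y \<in> localization a \<and> y \<notin> N \<and> (\<forall>i\<in>B. rf (\<alpha> i) * y \<in> N)"
proof -
  have "finite C \<Longrightarrow> C \<subseteq> B \<Longrightarrow> \<exists>y. y \<in> localization a \<and> y \<notin> N \<and> (\<forall>i\<in>C. rf (\<alpha> i) * y \<in> N)" for C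
  proof (induction C rule: finite_induct)
    case empty
    then show ?case using proper by auto
  next
    case (insert i C)
    then obtain y where y: "y \<in> localization a" "y \<notin> N" "\<forall>i\<in>C. rf (\<alpha> i) * y \<in> N" by auto
    define e where "e = (LEAST e. rf (\<alpha> i) ^ e * y \<in> N)"
    have e: "rf (\<alpha> i) ^ e * y \<in> N"
      unfolding e_def using nil[OF _ y(1), of i] insert.prems by (auto intro: LeastI_ex)
    with y(2) obtain k where k: "e = Suc k" by (cases e) auto
    have nk: "rf (\<alpha> i) ^ k * y \<notin> N" using not_less_Least[of k "\<lambda>e. rf (\<alpha> i) ^ e * y \<in> N"] k e_def by auto
    have "rf (\<alpha> l) * (rf (\<alpha> i) ^ k * y) \<in> N" if "l \<in> insert i C" for l
    proof (cases "l = i")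
      case False
      then have "rf (\<alpha> i) ^ k * (rf (\<alpha> l) * y) \<in> N" using y(3) that by (intro dsub_rf_power[OF N]) auto
      then show ?thesis by (simp add: mult_ac)
    qed (use e k in \<open>simp add: mult_ac\<close>)
    moreover have "rf (\<alpha> i) ^ k * y \<in> localization a" unfolding rf_power[symmetric] by (rule M_rf[OF y(1)])
    ultimately show ?case using nk by blast
  qed
  then show ?thesis using fin by blast
qed

lemma no_relation:
  assumes "rf p = (\<Sum>i\<in>B. cf (c i) * rf (\<alpha> i))" "y \<notin> N" "\<forall>i\<in>B. rf (\<alpha> i) * y \<in> N"
  shows "rf p * y \<in> N"
proof -
  have "rf p * y = (\<Sum>i\<in>B. cf (c i) * (rf (\<alpha> i) * y))"
    by (simp add: assms(1) sum_distrib_right mult.assoc)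
  also have "\<dots> \<in> N" using assms(3) by (intro dsub_sum[OF N] dsub_cf[OF N]) auto
  finally show ?thesis .
qed

text \<open>Without a common zero, \<open>1\<close> would be a linear combination of the forms in
  \<open>B\<close>, and a socle element would lie in \<open>N\<close>.\<close>

lemma common_zero_exists: "\<exists>x. \<forall>i\<in>B. eval_poly (\<alpha> i) x = 0"
proof -
  obtain y where y: "y \<notin> N" "\<forall>i\<in>B. rf (\<alpha> i) * y \<in> N" using socle_exists by blast
  let ?w = "axis None 1 :: complex ^ 'n option"
  have pw: "pair ?w v = v $ None" for v
    by (simp add: pair_def axis_def if_distrib[of "\<lambda>z. z * _"] cong: if_cong)
  have "?w \<notin> vec.span ((\<lambda>i. aug (\<alpha> i)) ` B)"
  proof
    assume "?w \<in> vec.span ((\<lambda>i. aug (\<alpha> i)) ` B)"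
    then obtain c where c: "?w = (\<Sum>i\<in>B. c i *s aug (\<alpha> i))"
      by (rule span_image_obtains_coeffs[OF fin])
    have "eval_poly 1 x = (\<Sum>i\<in>B. c i * eval_poly (\<alpha> i) x)" for x
    proof -
      let ?v = "\<chi> k. case k of None \<Rightarrow> 1 | Some j \<Rightarrow> x j"
      have "1 = pair ?w ?v" by (simp add: pw)
      also have "\<dots> = (\<Sum>i\<in>B. c i * pair (aug (\<alpha> i)) ?v)"
        by (subst c) (simp add: pair_sum_left pair_scale_left)
      also have "\<dots> = (\<Sum>i\<in>B. c i * eval_poly (\<alpha> i) x)"
        using B by (intro sum.cong HOL.refl) (auto simp: pair_aug[OF degree_one])
      finally show ?thesis by simp
    qed
    from no_relation[OF sum_rf_eval[OF this] y] y(1) show False by simp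
  qed
  then obtain v where v: "pair ?w v = 1" "\<And>u. u \<in> (\<lambda>i. aug (\<alpha> i)) ` B \<Longrightarrow> pair u v = 0"
    by (rule separating_vector) blast
  have "eval_poly (\<alpha> i) (\<lambda>j. v $ Some j) = 0" if "i \<in> B" for i
    using v that B pair_aug[OF degree_one, of i v] by (auto simp: pw)
  then show ?thesis by blast
qed

text \<open>A form outside \<open>B\<close> that vanished on the whole flat of \<open>B\<close>
  would be a combination of the forms in \<open>B\<close>; its product with a socle element would
  lie in \<open>N\<close>, and so would the element itself, by \<open>N_div\<close>. The finitely
  many other hyperplanes are then avoided in turn.\<close>

lemma generic_zero_exists: "\<exists>x. {i \<in> {1..m}. eval_poly (\<alpha> i) x = 0} = B"
proof -
  obtain y where y: "y \<notin> N" "\<forall>i\<in>B. rf (\<alpha> i) * y \<in> N" using socle_exists by blast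
  obtain x0 where x0: "\<And>i. i \<in> B \<Longrightarrow> eval_poly (\<alpha> i) x0 = 0" using common_zero_exists by blast
  have ev: "eval_poly (\<alpha> i) x = pair (lin (\<alpha> i)) (\<chi> j. x j - x0 j)" if "i \<in> {1..m}" "eval_poly (\<alpha> i) x0 = 0" for i x
    using eval_poly_shift[OF degree_one[OF that(1)], of x0 "\<chi> j. x j - x0 j"] that(2) by simp
  have single: "\<exists>x. (\<forall>i\<in>B. eval_poly (\<alpha> i) x = 0) \<and> eval_poly (\<alpha> j) x \<noteq> 0" if j: "j \<in> {1..m} - B" for j
  proof (cases "eval_poly (\<alpha> j) x0 = 0")
    case True
    have "lin (\<alpha> j) \<notin> vec.span ((\<lambda>i. lin (\<alpha> i)) ` B)"
    proof
      assume "lin (\<alpha> j) \<in> vec.span ((\<lambda>i. lin (\<alpha> i)) ` B)"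
      then obtain c where c: "lin (\<alpha> j) = (\<Sum>i\<in>B. c i *s lin (\<alpha> i))"
        by (rule span_image_obtains_coeffs[OF fin])
      have "eval_poly (\<alpha> j) x = (\<Sum>i\<in>B. c i * eval_poly (\<alpha> i) x)" for x
        using j B True x0 by (simp add: ev c pair_sum_left pair_scale_left subset_iff)
      from no_relation[OF sum_rf_eval[OF this] y] have "rf (\<alpha> j) * y / rf (\<alpha> j) \<in> N"
        by (rule N_div[OF j])
      with \<alpha>_nz[of j] j y(1) show False by simp
    qed
    then obtain v where v: "pair (lin (\<alpha> j)) v = 1" "\<And>u. u \<in> (\<lambda>i. lin (\<alpha> i)) ` B \<Longrightarrow> pair u v = 0"
      by (rule separating_vector) blast
    have "eval_poly (\<alpha> i) (\<lambda>k. x0 k + v $ k) = 0" if "i \<in> B" for i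
      using eval_poly_shift[OF degree_one, of i x0 v] that B x0 v(2) by auto
    moreover have "eval_poly (\<alpha> j) (\<lambda>k. x0 k + v $ k) \<noteq> 0"
      using eval_poly_shift[OF degree_one, of j x0 v] j True v(1) by auto
    ultimately show ?thesis by blast
  qed (use x0 in blast)
  have "finite J \<Longrightarrow> J \<subseteq> {1..m} - B \<Longrightarrow>
      \<exists>x. (\<forall>i\<in>B. eval_poly (\<alpha> i) x = 0) \<and> (\<forall>j\<in>J. eval_poly (\<alpha> j) x \<noteq> 0)" for J
  proof (induction J rule: finite_induct)
    case empty
    then show ?case using x0 by blast
  next
    case (insert j J)
    then obtain x where x: "\<forall>i\<in>B. eval_poly (\<alpha> i) x = 0" "\<forall>j\<in>J. eval_poly (\<alpha> j) x \<noteq> 0" by auto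
    obtain z where z: "\<forall>i\<in>B. eval_poly (\<alpha> i) z = 0" "eval_poly (\<alpha> j) z \<noteq> 0"
      using single[of j] insert.prems by blast
    \<comment> \<open>On the line from \<open>x\<close> to \<open>z\<close> the earlier forms are
      nonzero at \<open>0\<close> and the new one at \<open>1\<close>, so all restrict to nonzero
      polynomials.\<close>
    let ?P = "\<lambda>k. line_poly x (\<lambda>i. z i - x i) (\<alpha> k)"
    have p0: "poly (?P k) 0 = eval_poly (\<alpha> k) x" and p1: "poly (?P k) 1 = eval_poly (\<alpha> k) z" for k
      by simp_all
    have "?P k \<noteq> 0" if "k \<in> insert j J" for k
    proof
      assume "?P k = 0"
      with p0[of k] p1[of k] have "eval_poly (\<alpha> k) x = 0" "eval_poly (\<alpha> k) z = 0" by simp_all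
      with x z that show False by auto
    qed
    moreover have "finite (insert j J)" using insert.hyps by simp
    ultimately obtain t where t: "\<And>k. k \<in> insert j J \<Longrightarrow> poly (?P k) t \<noteq> 0"
      using avoid_zeros[of "insert j J" ?P] by blast
    have "eval_poly (\<alpha> i) (\<lambda>k. x k + t * (z k - x k)) = 0" if "i \<in> B" for i
    proof -
      have i: "i \<in> {1..m}" using that B by blast
      have "eval_poly (\<alpha> i) z = eval_poly (\<alpha> i) x + pair (lin (\<alpha> i)) (\<chi> k. z k - x k)"
        using eval_poly_shift[OF degree_one[OF i], of x "\<chi> k. z k - x k"] by simp
      with x z that have "pair (lin (\<alpha> i)) (\<chi> k. z k - x k) = 0" by simp
      then have "pair (lin (\<alpha> i)) (t *s (\<chi> k. z k - x k)) = 0"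
        by (simp add: pair_commute[of "lin (\<alpha> i)"] pair_scale_left)
      with x that show ?thesis
        using eval_poly_shift[OF degree_one[OF i], of x "t *s (\<chi> k. z k - x k)"] by simp
    qed
    with t show ?case by (intro exI[of _ "\<lambda>k. x k + t * (z k - x k)"]) auto
  qed
  from this[of "{1..m} - B"] obtain x where
    "\<forall>i\<in>B. eval_poly (\<alpha> i) x = 0" "\<forall>j\<in>{1..m} - B. eval_poly (\<alpha> j) x \<noteq> 0" by auto
  then have "{i \<in> {1..m}. eval_poly (\<alpha> i) x = 0} = B" using B by blast
  then show ?thesis by blast
qed

definition rd :: "(complex, 'n) vec \<Rightarrow> 'n ratfun \<Rightarrow> 'n ratfun" where
  "rd w q = (\<Sum>j\<in>UNIV. cf (w $ j) * ratfun_deriv j q)"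

definition tv :: "(complex, 'n) vec \<Rightarrow> 'n ratfun \<Rightarrow> 'n ratfun" where
  "tv w x = (\<Sum>j\<in>UNIV. cf (w $ j) * tw j x)"

lemma rd_mult: "rd w (p * q) = rd w p * q + p * rd w q"
  by (simp add: rd_def ratfun_deriv_mult algebra_simps sum.distrib sum_distrib_left)

lemma tv_mult: "tv w (q * x) = rd w q * x + q * tv w x"
  by (simp add: rd_def tv_def tw_mult algebra_simps sum.distrib sum_distrib_left)

lemma tv_add: "tv w (x + y) = tv w x + tv w y"
  by (simp add: tv_def twisted_deriv_add algebra_simps sum.distrib)

lemma rd_cf [simp]: "rd w (cf c) = 0"
  by (simp add: rd_def)

lemma rd_\<alpha>: "i \<in> {1..m} \<Longrightarrow> rd w (rf (\<alpha> i)) = cf (pair (lin (\<alpha> i)) w)"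
  by (simp add: rd_def ratfun_deriv_rf degree_one_partial_deriv[OF degree_one] pair_def lin_def
      cf_sum cf_hom mult.commute flip: cf_def)

lemma tv_N: "x \<in> N \<Longrightarrow> tv w x \<in> N"
  unfolding tv_def by (intro dsub_sum[OF N] dsub_cf[OF N] dsub_tw[OF N])

text \<open>Formally \<open>1 / rf a ^ l\<close> times the symbol is the symbol with every exponent
  lowered by \<open>l\<close>, whence the coefficients \<open>\<beta> i - of_nat l\<close>.\<close>

lemma tw_inverse_power:
  "tw j (1 / rf a ^ l) = (1 / rf a ^ l) *
     (\<Sum>i = 1..m. cf (\<beta> i - of_nat l) * (rf (partial_deriv j (\<alpha> i)) / rf (\<alpha> i)))"
proof -
  have nz: "rf a ^ l \<noteq> 0" "rf a \<noteq> 0" using a_nz by simp_all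
  have "ratfun_deriv j (rf a) / rf a = (\<Sum>i = 1..m. rf (partial_deriv j (\<alpha> i)) / rf (\<alpha> i))"
  proof -
    have "ratfun_deriv j (\<Prod>i = 1..m. rf (\<alpha> i))
        = (\<Prod>i = 1..m. rf (\<alpha> i)) * (\<Sum>i = 1..m. ratfun_deriv j (rf (\<alpha> i)) / rf (\<alpha> i))"
      by (rule ratfun_deriv_prod) (use \<alpha>_nz in auto)
    then show ?thesis using nz by (simp add: a_def rf_prod ratfun_deriv_rf)
  qed
  then have "ratfun_deriv j (rf a ^ l) / rf a ^ l
      = of_nat l * (\<Sum>i = 1..m. rf (partial_deriv j (\<alpha> i)) / rf (\<alpha> i))"
    using ratfun_deriv_power[OF nz(2), of j l] nz by simp
  then have "ratfun_deriv j (1 / rf a ^ l)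
      = - (1 / rf a ^ l) * (of_nat l * (\<Sum>i = 1..m. rf (partial_deriv j (\<alpha> i)) / rf (\<alpha> i)))"
    using ratfun_deriv_inverse[OF nz(1), of j] by simp
  then show ?thesis
    unfolding twisted_deriv_def log_form_rf
    by (simp add: cf_diff cf_of_nat algebra_simps diff_divide_distrib sum_subtractf sum_negf sum_distrib_left)
qed

lemma tv_inverse_power:
  "tv w (1 / rf a ^ l) = (1 / rf a ^ l) *
     (\<Sum>i = 1..m. cf (\<beta> i - of_nat l) * (cf (pair (lin (\<alpha> i)) w) / rf (\<alpha> i)))"
proof -
  have *: "(\<Sum>j\<in>UNIV. cf (w $ j) * rf (partial_deriv j (\<alpha> i))) = cf (pair (lin (\<alpha> i)) w)"
    if "i \<in> {1..m}" for i
    using rd_\<alpha>[OF that, of w] by (simp add: rd_def ratfun_deriv_rf)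
  have "tv w (1 / rf a ^ l) = (\<Sum>j\<in>UNIV. \<Sum>i = 1..m. (1 / rf a ^ l) * (cf (\<beta> i - of_nat l) *
      (cf (w $ j) * rf (partial_deriv j (\<alpha> i)) / rf (\<alpha> i))))"
    unfolding tv_def tw_inverse_power sum_distrib_left
    by (intro sum.cong HOL.refl) (simp only: divide_inverse mult_ac)
  also have "\<dots> = (\<Sum>i = 1..m. (1 / rf a ^ l) * (cf (\<beta> i - of_nat l) *
      ((\<Sum>j\<in>UNIV. cf (w $ j) * rf (partial_deriv j (\<alpha> i))) / rf (\<alpha> i))))"
    by (subst sum.swap) (simp add: sum_distrib_left sum_divide_distrib)
  also have "\<dots> = (\<Sum>i = 1..m. (1 / rf a ^ l) * (cf (\<beta> i - of_nat l) *
      (cf (pair (lin (\<alpha> i)) w) / rf (\<alpha> i))))"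
    by (intro sum.cong HOL.refl) (simp add: *)
  finally show ?thesis by (simp add: sum_distrib_left)
qed

lemma no_nonintegral_block:
  assumes S: "S \<subseteq> B" "(\<Sum>i\<in>S. \<beta> i) \<notin> \<int>"
    and ind: "vec.span ((\<lambda>i. lin (\<alpha> i)) ` S) \<inter> vec.span ((\<lambda>i. lin (\<alpha> i)) ` (B - S)) \<subseteq> {0}"
    and x0: "{i \<in> {1..m}. eval_poly (\<alpha> i) x0 = 0} = B"
  shows False
proof -
  obtain R v where R: "R \<subseteq> S" "(\<lambda>i. lin (\<alpha> i)) ` S \<subseteq> vec.span ((\<lambda>i. lin (\<alpha> i)) ` R)"
    "\<And>i i'. i \<in> R \<Longrightarrow> i' \<in> R \<Longrightarrow> pair (lin (\<alpha> i)) (v i') = of_bool (i = i')"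
    "\<And>b i'. b \<in> B - S \<Longrightarrow> i' \<in> R \<Longrightarrow> pair (lin (\<alpha> b)) (v i') = 0"
    using split_span_dual_basis[OF ind] by blast
  have Rm: "R \<subseteq> {1..m}" and Sm: "S \<subseteq> {1..m}" and RB: "R \<subseteq> B" using R(1) S(1) B by auto
  have finR: "finite R" and finS: "finite S" using Rm Sm finite_subset by blast+
  \<comment> \<open>The Euler field of the block, acting on functions as \<open>E\<close> and on the
    module as \<open>\<theta>\<close>. As a derivation it fixes every form in \<open>S\<close> and
    kills the other forms in \<open>B\<close>.\<close>
  define E where "E q = (\<Sum>i\<in>R. rf (\<alpha> i) * rd (v i) q)" for q
  define \<theta> where "\<theta> x = (\<Sum>i\<in>R. rf (\<alpha> i) * tv (v i) x)" for x
  have \<theta>_mult: "\<theta> (q * x) = E q * x + q * \<theta> x" for q x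
    by (simp add: \<theta>_def E_def tv_mult algebra_simps sum.distrib sum_distrib_left)
  have E_mult: "E (p * q) = E p * q + p * E q" for p q
    by (simp add: E_def rd_mult algebra_simps sum.distrib sum_distrib_left)
  have E_cf: "E (cf c) = 0" for c by (simp add: E_def)
  have E_1: "E 1 = 0" using E_cf[of 1] by (simp only: cf_hom)
  have E_\<alpha>: "E (rf (\<alpha> i)) = rf (\<alpha> i)" if "i \<in> R" for i
  proof -
    have "E (rf (\<alpha> i)) = (\<Sum>i'\<in>R. if i' = i then rf (\<alpha> i) else 0)"
      unfolding E_def using that Rm R(3)[OF that] by (intro sum.cong) (auto simp: rd_\<alpha> cf_hom)
    then show ?thesis using that finR by simp
  qed
  have E_pow: "E (rf (\<alpha> i) ^ k) = of_nat k * rf (\<alpha> i) ^ k" if "i \<in> R" for i k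
    by (induction k) (simp_all add: E_1 E_mult E_\<alpha>[OF that] algebra_simps)
  have E_mono: "E (\<Prod>i\<in>R. rf (\<alpha> i) ^ \<kappa> i) = of_nat (\<Sum>i\<in>R. \<kappa> i) * (\<Prod>i\<in>R. rf (\<alpha> i) ^ \<kappa> i)" for \<kappa>
  proof -
    have "finite A \<Longrightarrow> A \<subseteq> R \<Longrightarrow> E (\<Prod>i\<in>A. rf (\<alpha> i) ^ \<kappa> i) = of_nat (\<Sum>i\<in>A. \<kappa> i) * (\<Prod>i\<in>A. rf (\<alpha> i) ^ \<kappa> i)" for A
      by (induction A rule: finite_induct) (simp_all add: E_1 E_mult E_pow algebra_simps)
    with finR show ?thesis by blast
  qed
  have \<theta>_add: "\<theta> (x + y) = \<theta> x + \<theta> y" for x y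
    by (simp add: \<theta>_def tv_add algebra_simps sum.distrib)
  have \<theta>_cf: "\<theta> (cf c * x) = cf c * \<theta> x" for c x by (simp add: \<theta>_mult E_cf)
  have \<theta>_N: "\<theta> x \<in> N" if "x \<in> N" for x
    unfolding \<theta>_def by (intro dsub_sum[OF N] dsub_rf[OF N] tv_N that)
  define \<Lambda> where "\<Lambda> = {(\<Sum>i\<in>S. \<beta> i) + of_int z | z. True}"
  have eig_sum: "(\<Sum>i\<in>R. f i) \<in> geneig \<theta> N \<Lambda>" if "\<And>i. i \<in> R \<Longrightarrow> f i \<in> geneig \<theta> N \<Lambda>" for f
    by (rule geneig_sum) (auto intro: \<theta>_add \<theta>_cf dsub_add[OF N] dsub_cf[OF N] \<theta>_N dsub_0[OF N] that)
  have eig_disj: "x \<in> N" if "x \<in> geneig \<theta> N \<Lambda>" "\<theta> x + cf r * x \<in> N" "\<And>c. c \<in> \<Lambda> \<Longrightarrow> r + c \<noteq> 0" for x r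
    by (rule geneig_disjoint_eigenvalue[OF _ _ _ _ _ that(3,1,2)])
       (auto intro: \<theta>_add \<theta>_cf dsub_add[OF N] dsub_cf[OF N] \<theta>_N)
  have ev: "eval_poly (\<alpha> i) x = pair (lin (\<alpha> i)) (\<chi> j. x j - x0 j)" if "i \<in> B" for i x
    using eval_poly_shift[OF degree_one, of i x0 "\<chi> j. x j - x0 j"] that B x0 by auto
  \<comment> \<open>Euler's identity for all forms of the block. They all vanish at
    \<open>x0\<close>, so a relation between the linear parts holds for the affine forms
    themselves.\<close>
  have bracket: "(\<Sum>i\<in>R. rf (\<alpha> i) * cf (pair (lin (\<alpha> k)) (v i))) = rf (\<alpha> k)" if k: "k \<in> S" for k
  proof -
    have "lin (\<alpha> k) \<in> vec.span ((\<lambda>i. lin (\<alpha> i)) ` R)" using R(2) k by blast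
    then obtain c where c: "lin (\<alpha> k) = (\<Sum>i\<in>R. c i *s lin (\<alpha> i))"
      by (rule span_image_obtains_coeffs[OF finR])
    have "pair (lin (\<alpha> k)) (v i) = c i" if "i \<in> R" for i
    proof -
      have "pair (lin (\<alpha> k)) (v i) = (\<Sum>i'\<in>R. if i' = i then c i else 0)"
        unfolding c pair_sum_left pair_scale_left using R(3)[OF _ that] by (intro sum.cong) auto
      then show ?thesis using that finR by simp
    qed
    moreover have "eval_poly (\<alpha> k) x = (\<Sum>i\<in>R. c i * eval_poly (\<alpha> i) x)" for x
      using k S(1) RB by (simp add: ev subset_iff c pair_sum_left pair_scale_left)
    from sum_rf_eval[OF this] have "rf (\<alpha> k) = (\<Sum>i\<in>R. cf (c i) * rf (\<alpha> i))" .
    ultimately show ?thesis by (simp add: mult.commute)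
  qed
  \<comment> \<open>Differentiating powers of \<open>a\<close> produces denominators from the
    hyperplanes off \<open>B\<close>. These can be inverted on \<open>N\<close>, so coefficients are
    taken in \<open>?O\<close>.\<close>
  define g where "g = (\<Prod>j\<in>{1..m} - B. \<alpha> j)"
  have g: "g \<noteq> 0" using \<alpha>_nz by (simp add: g_def)
  let ?O = "localization g"
  have O_inv: "1 / rf (\<alpha> k) \<in> ?O" if k: "k \<in> {1..m} - B" for k
  proof -
    have "g = \<alpha> k * (\<Prod>l\<in>{1..m} - B - {k}. \<alpha> l)"
      unfolding g_def using k by (intro prod.remove) auto
    then obtain h where h: "g = \<alpha> k * h" by blast
    then have "1 / rf (\<alpha> k) = rf h / rf g ^ 1" using g by (simp add: rf_mult)
    then show ?thesis unfolding localization_iff_rf by blast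
  qed
  have O_rf: "rf p \<in> ?O" for p unfolding rf_def by (rule localization_poly[OF g])
  have O_cf: "cf c \<in> ?O" for c unfolding cf_def by (rule O_rf)
  have O_rd: "rd w q \<in> ?O" if "q \<in> ?O" for w q
    unfolding rd_def
    by (intro localization_sum localization_mult localization_deriv O_cf g that)
  have N_O: "q * x \<in> N" if q: "q \<in> ?O" and x: "x \<in> N" for q x
  proof -
    have 1: "y / rf (\<Prod>j\<in>J. \<alpha> j) \<in> N" if "finite J" "J \<subseteq> {1..m} - B" "y \<in> N" for J y
      using that
    proof (induction J rule: finite_induct)
      case (insert j J)
      then have "y / rf (\<Prod>j\<in>J. \<alpha> j) / rf (\<alpha> j) \<in> N" by (intro N_div) auto
      then show ?case using insert.hyps by (simp add: rf_mult mult.commute)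
    qed simp
    have 2: "y / rf g ^ e \<in> N" if "y \<in> N" for y e
    proof (induction e)
      case (Suc e)
      from 1[OF _ order.refl this] show ?case by (simp add: g_def mult.commute)
    qed (use that in simp)
    obtain p e where "q = rf p / rf g ^ e" using q unfolding localization_iff_rf by blast
    with 2[OF dsub_rf[OF N x, of p], of e] show ?thesis by simp
  qed
  define Q where "Q l i = (\<Sum>k\<in>{1..m} - B. cf (\<beta> k - of_nat l) * (cf (pair (lin (\<alpha> k)) (v i)) * (1 / rf (\<alpha> k))))"
    for l :: nat and i
  have Q: "Q l i \<in> ?O" for l i
    unfolding Q_def by (intro localization_sum localization_mult O_cf O_inv g)
  define c where "c l = (\<Sum>k\<in>S. \<beta> k) - of_int (int (card S * l))" for l :: nat
  \<comment> \<open>Modulo the forms of the block, \<open>1 / rf a ^ l\<close> is an eigenvector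
    with eigenvalue \<open>c l\<close>. The forms in \<open>B - S\<close> contribute nothing, and
    those off \<open>B\<close> are collected in \<open>Q\<close>.\<close>
  have \<theta>_u: "\<theta> (1 / rf a ^ l) = (1 / rf a ^ l) * (cf (c l) + (\<Sum>i\<in>R. rf (\<alpha> i) * Q l i))" for l
  proof -
    let ?u = "1 / rf a ^ l"
    let ?br = "\<lambda>k. (\<Sum>i\<in>R. rf (\<alpha> i) * cf (pair (lin (\<alpha> k)) (v i)))"
    let ?t = "\<lambda>k. cf (\<beta> k - of_nat l) * (?br k * (1 / rf (\<alpha> k)))"
    have "\<theta> ?u = (\<Sum>i\<in>R. \<Sum>k = 1..m. ?u * (cf (\<beta> k - of_nat l) *
        ((rf (\<alpha> i) * cf (pair (lin (\<alpha> k)) (v i))) * (1 / rf (\<alpha> k)))))"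
      unfolding \<theta>_def tv_inverse_power sum_distrib_left
      by (intro sum.cong HOL.refl) (simp only: divide_inverse mult_ac mult_1_left)
    also have "\<dots> = ?u * (\<Sum>k = 1..m. ?t k)"
      by (subst sum.swap) (simp only: sum_distrib_left sum_distrib_right)
    also have "(\<Sum>k = 1..m. ?t k) = (\<Sum>k\<in>B. ?t k) + (\<Sum>k\<in>{1..m} - B. ?t k)"
      using sum.subset_diff[OF B, of ?t] by (simp add: add.commute)
    also have "(\<Sum>k\<in>B. ?t k) = (\<Sum>k\<in>S. ?t k)"
      using fin S(1) R(4) by (intro sum.mono_neutral_right) (auto simp: cf_hom)
    also have "\<dots> = (\<Sum>k\<in>S. cf (\<beta> k - of_nat l))"
      using Sm \<alpha>_nz by (intro sum.cong HOL.refl) (auto simp: bracket)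
    also have "\<dots> = cf (c l)" by (simp add: c_def sum_subtractf flip: cf_sum)
    also have "(\<Sum>k\<in>{1..m} - B. ?t k) = (\<Sum>i\<in>R. rf (\<alpha> i) * Q l i)"
      unfolding Q_def sum_distrib_left sum_distrib_right
      by (subst sum.swap) (intro sum.cong HOL.refl, simp only: mult_ac)
    finally show ?thesis .
  qed
  have u_M: "1 / rf a ^ l \<in> localization a" for l
    unfolding localization_iff_rf by (intro exI[of _ 1] exI[of _ l]) simp
  \<comment> \<open>Applying \<open>\<theta>\<close> minus the scalar \<open>d\<close> turns the
    product into a sum of such products with one exponent raised. Once some exponent reaches
    \<open>e i\<close> the product lies in \<open>N\<close>; the truncated differences measure how
    far that is away.\<close>
  have G: "(\<Prod>i\<in>R. rf (\<alpha> i) ^ \<kappa> i) * (q * (1 / rf a ^ l)) \<in> geneig \<theta> N \<Lambda>" if "q \<in> ?O" for \<kappa> q l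
  proof -
    have "\<forall>i. \<exists>e. i \<in> R \<longrightarrow> rf (\<alpha> i) ^ e * (1 / rf a ^ l) \<in> N" using nil[OF _ u_M] RB by blast
    from choice[OF this] obtain e where e: "\<And>i. i \<in> R \<Longrightarrow> rf (\<alpha> i) ^ e i * (1 / rf a ^ l) \<in> N" by blast
    show ?thesis using that
    proof (induction "\<Sum>i\<in>R. e i - \<kappa> i" arbitrary: \<kappa> q rule: less_induct)
      case less
      let ?m = "\<Prod>i\<in>R. rf (\<alpha> i) ^ \<kappa> i" and ?u = "1 / rf a ^ l"
      show ?case
      proof (cases "\<exists>i\<in>R. e i \<le> \<kappa> i")
        case True
        then obtain i where i: "i \<in> R" "e i \<le> \<kappa> i" by blast
        have "?m = rf (\<alpha> i) ^ \<kappa> i * (\<Prod>i\<in>R - {i}. rf (\<alpha> i) ^ \<kappa> i)"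
          by (rule prod.remove[OF finR i(1)])
        also have "rf (\<alpha> i) ^ \<kappa> i = rf (\<alpha> i) ^ (\<kappa> i - e i) * rf (\<alpha> i) ^ e i"
          using i(2) by (simp flip: power_add)
        finally have "?m * (q * ?u) = rf (\<alpha> i ^ (\<kappa> i - e i) * (\<Prod>i\<in>R - {i}. \<alpha> i ^ \<kappa> i)) *
            (q * (rf (\<alpha> i) ^ e i * ?u))"
          by (simp only: rf_mult rf_power rf_prod mult_ac)
        also have "\<dots> \<in> N" by (intro dsub_rf[OF N] N_O less.prems e i)
        finally show ?thesis by (rule geneig.base)
      next
        case False
        define d where "d = c l + of_nat (\<Sum>i\<in>R. \<kappa> i)"
        have ring: "D * P * (q * u) + P * (e * u + q * (u * (C + s)))
            = (C + D) * (P * (q * u)) + P * (e * u) + P * (q * (u * s))" for P q u s e C D :: "'n ratfun"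
          by (simp add: algebra_simps)
        have \<theta>m: "\<theta> (?m * (q * ?u)) - cf d * (?m * (q * ?u))
            = (\<Sum>i\<in>R. ?m * rf (\<alpha> i) * ((rd (v i) q + q * Q l i) * ?u))"
        proof -
          have "\<theta> (?m * (q * ?u)) = cf d * (?m * (q * ?u)) + ?m * (E q * ?u) + ?m * (q * (?u * (\<Sum>i\<in>R. rf (\<alpha> i) * Q l i)))"
            unfolding \<theta>_mult E_mono \<theta>_u d_def cf_hom cf_of_nat by (rule ring)
          also have "?m * (E q * ?u) = (\<Sum>i\<in>R. ?m * rf (\<alpha> i) * (rd (v i) q * ?u))"
            unfolding E_def sum_distrib_left sum_distrib_right by (intro sum.cong HOL.refl) (simp only: mult_ac)
          also have "?m * (q * (?u * (\<Sum>i\<in>R. rf (\<alpha> i) * Q l i))) = (\<Sum>i\<in>R. ?m * rf (\<alpha> i) * (q * Q l i * ?u))"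
            unfolding sum_distrib_left by (intro sum.cong HOL.refl) (simp only: mult_ac)
          finally have *: "\<theta> (?m * (q * ?u)) = cf d * (?m * (q * ?u))
              + (\<Sum>i\<in>R. ?m * rf (\<alpha> i) * (rd (v i) q * ?u)) + (\<Sum>i\<in>R. ?m * rf (\<alpha> i) * (q * Q l i * ?u))" .
          show ?thesis unfolding * by (simp only: ring_distribs sum.distrib) simp
        qed
        have "?m * rf (\<alpha> i) * ((rd (v i) q + q * Q l i) * ?u) \<in> geneig \<theta> N \<Lambda>" if i: "i \<in> R" for i
        proof -
          let ?\<kappa> = "\<kappa>(i := Suc (\<kappa> i))"
          have "(\<Sum>i\<in>R. e i - ?\<kappa> i) < (\<Sum>i\<in>R. e i - \<kappa> i)"
            using i False by (intro sum_strict_mono_ex1 finR) (auto intro!: bexI[of _ i])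
          moreover have "rd (v i) q + q * Q l i \<in> ?O"
            by (intro localization_add localization_mult g O_rd Q less.prems)
          ultimately have "(\<Prod>i\<in>R. rf (\<alpha> i) ^ ?\<kappa> i) * ((rd (v i) q + q * Q l i) * ?u) \<in> geneig \<theta> N \<Lambda>"
            by (rule less.hyps)
          moreover have "(\<Prod>i\<in>R. rf (\<alpha> i) ^ ?\<kappa> i) = ?m * rf (\<alpha> i)"
          proof -
            have "(\<Prod>i\<in>R. rf (\<alpha> i) ^ ?\<kappa> i) = rf (\<alpha> i) ^ Suc (\<kappa> i) * (\<Prod>k\<in>R - {i}. rf (\<alpha> k) ^ ?\<kappa> k)"
              using prod.remove[OF finR i, of "\<lambda>k. rf (\<alpha> k) ^ ?\<kappa> k"] by simp
            also have "(\<Prod>k\<in>R - {i}. rf (\<alpha> k) ^ ?\<kappa> k) = (\<Prod>k\<in>R - {i}. rf (\<alpha> k) ^ \<kappa> k)"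
              by (intro prod.cong) auto
            also have "rf (\<alpha> i) ^ Suc (\<kappa> i) * \<dots> = (rf (\<alpha> i) ^ \<kappa> i * (\<Prod>k\<in>R - {i}. rf (\<alpha> k) ^ \<kappa> k)) * rf (\<alpha> i)"
              by (simp add: mult_ac)
            also have "rf (\<alpha> i) ^ \<kappa> i * (\<Prod>k\<in>R - {i}. rf (\<alpha> k) ^ \<kappa> k) = ?m"
              by (rule prod.remove[OF finR i, symmetric])
            finally show ?thesis .
          qed
          ultimately show ?thesis by simp
        qed
        then have "\<theta> (?m * (q * ?u)) - cf d * (?m * (q * ?u)) \<in> geneig \<theta> N \<Lambda>"
          unfolding \<theta>m by (rule eig_sum)
        moreover have "d \<in> \<Lambda>"
        proof -
          have "d = (\<Sum>i\<in>S. \<beta> i) + of_int (int (\<Sum>i\<in>R. \<kappa> i) - int (card S * l))"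
            by (simp add: d_def c_def)
          then show ?thesis unfolding \<Lambda>_def by blast
        qed
        ultimately show ?thesis by (rule geneig.step)
      qed
    qed
  qed
  obtain y where y: "y \<in> localization a" "y \<notin> N" "\<forall>i\<in>B. rf (\<alpha> i) * y \<in> N" using socle_exists by blast
  obtain p l where p: "y = rf p / rf a ^ l" using y(1) unfolding localization_iff_rf by blast
  have yG: "y \<in> geneig \<theta> N \<Lambda>" using G[OF O_rf, of "\<lambda>_. 0" p l] by (simp add: p)
  \<comment> \<open>Moving \<open>rf (\<alpha> i)\<close> inside the derivative in direction
    \<open>v i\<close> costs one copy of \<open>y\<close> for each \<open>i\<close> in
    \<open>R\<close>, and \<open>rf (\<alpha> i) * y\<close> is in \<open>N\<close>. So
    \<open>\<theta>\<close> acts on \<open>y\<close> by \<open>- card R\<close> modulo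
    \<open>N\<close>.\<close>
  have "\<theta> y + cf (of_nat (card R)) * y \<in> N"
  proof -
    have "\<theta> y + cf (of_nat (card R)) * y = (\<Sum>i\<in>R. tv (v i) (rf (\<alpha> i) * y))"
    proof -
      have "tv (v i) (rf (\<alpha> i) * y) = y + rf (\<alpha> i) * tv (v i) y" if "i \<in> R" for i
        using that Rm R(3)[OF that that] by (auto simp: tv_mult rd_\<alpha> cf_hom)
      then show ?thesis by (simp add: \<theta>_def sum.distrib cf_of_nat)
    qed
    also have "\<dots> \<in> N" using y(3) RB by (intro dsub_sum[OF N] tv_N) auto
    finally show ?thesis .
  qed
  moreover have "of_nat (card R) + d \<noteq> 0" if "d \<in> \<Lambda>" for d :: complex
  proof
    assume "of_nat (card R) + d = 0"
    with that obtain z where "(\<Sum>i\<in>S. \<beta> i) = - of_nat (card R) - of_int z"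
      unfolding \<Lambda>_def by (auto simp: algebra_simps add_eq_0_iff)
    then have "(\<Sum>i\<in>S. \<beta> i) = of_int (- int (card R) - z)" by simp
    with S(2) show False by (metis Ints_of_int)
  qed
  ultimately have "y \<in> N" using eig_disj[OF yG, of "of_nat (card R)"] by blast
  with y(2) show False ..
qed

end

section \<open>Irreducibility from nonintegral blocks\<close>

lemma single_exponent_decompose:
  "Poly_Mapping.single (k + Poly_Mapping.single i 1) c = poly_var i * Poly_Mapping.single k c"
  by (simp add: poly_var_def mult_single add.commute)

context twisted
begin

lemma dsub_of_left_module:
  assumes "left_module (weyl_action m \<alpha> \<beta>) N"
  shows "dsub N"
proof -
  have N0: "0 \<in> N" and N_add: "\<And>x y. x \<in> N \<Longrightarrow> y \<in> N \<Longrightarrow> x + y \<in> N"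
    and N_act: "\<And>P x. x \<in> N \<Longrightarrow> weyl_action m \<alpha> \<beta> P x \<in> N"
    using assms unfolding left_module_def by blast+
  have ex: "expr_action tw e x \<in> N" if "x \<in> N" for e x
    using N_act[OF that, of "abs_weyl e"] by (simp add: weyl_action.abs_eq)
  have N_const: "rf (poly_const c) * x \<in> N" if "x \<in> N" for c x
    using ex[OF that, of "WConst c"] by (simp add: rf_def)
  have N_var: "rf (poly_var i) * x \<in> N" if "x \<in> N" for i x
    using ex[OF that, of "WCoord i"] by (simp add: rf_def)
  have N_tw: "tw j x \<in> N" if "x \<in> N" for j x
    using ex[OF that, of "WDeriv j"] by simp
  have N_single: "rf (Poly_Mapping.single k c) * x \<in> N" if "x \<in> N" for k c x
    using that
  proof (induction "mdeg k" arbitrary: k x)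
    case 0
    then show ?case using N_const[of x c] by (simp add: poly_const_def)
  next
    case (Suc d)
    from Suc.hyps(2) have "k \<noteq> 0" by (metis mdeg_eq_0_iff nat.distinct(1))
    then obtain i k' where k: "k = k' + Poly_Mapping.single i 1" by (rule exponent_nonzero_decompose)
    with Suc.hyps(2) have "d = mdeg k'" by (simp add: mdeg_add)
    from N_var[OF Suc.hyps(1)[OF this Suc.prems], of i] show ?case
      unfolding k single_exponent_decompose rf_mult by (simp only: mult.assoc)
  qed
  have "rf p * x \<in> N" if "x \<in> N" for p x
    by (induction p rule: poly_mapping_induct_single)
       (simp_all only: rf_add ring_distribs N_add N_single[OF that])
  then show ?thesis unfolding dsub_def using N0 N_add N_tw by blast
qed

theorem irreducible_if_nonintegral_blocks:
  assumes blocks: "\<And>x0. {i \<in> {1..m}. eval_poly (\<alpha> i) x0 = 0} \<noteq> {} \<Longrightarrow>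
    \<exists>S \<subseteq> {i \<in> {1..m}. eval_poly (\<alpha> i) x0 = 0}. (\<Sum>i\<in>S. \<beta> i) \<notin> \<int> \<and>
      vec.span ((\<lambda>i. lin (\<alpha> i)) ` S) \<inter>
      vec.span ((\<lambda>i. lin (\<alpha> i)) ` ({i \<in> {1..m}. eval_poly (\<alpha> i) x0 = 0} - S)) \<subseteq> {0}"
  shows "irreducible_module (weyl_action m \<alpha> \<beta>) (localization (\<Prod>i = 1..m. \<alpha> i))"
  unfolding irreducible_module_def a_def[symmetric]
proof (intro conjI allI impI)
  show "left_module (weyl_action m \<alpha> \<beta>) (localization a)"
    unfolding a_def using \<alpha>_nz by (rule left_module_twisted)
  have "rf 1 \<in> localization a" unfolding rf_def by (rule localization_poly[OF a_nz])
  then have one: "1 \<in> localization a" by (simp only: rf_1)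
  show "localization a \<noteq> {0}"
  proof
    assume "localization a = {0}"
    with one have "(1 :: 'n ratfun) = 0" by blast
    then show False by simp
  qed
  fix N assume *: "N \<subseteq> localization a \<and> left_module (weyl_action m \<alpha> \<beta>) N"
  then have N: "dsub N" "N \<subseteq> localization a" using dsub_of_left_module by blast+
  define g where "g B = (\<Prod>j\<in>{1..m} - B. \<alpha> j)" for B
  have g_nz: "g B \<noteq> 0" for B using \<alpha>_nz by (simp add: g_def)
  show "N = {0} \<or> N = localization a"
  proof (rule ccontr)
    assume neg: "\<not> (N = {0} \<or> N = localization a)"
    obtain x where x: "x \<in> N" "x \<noteq> 0" using neg dsub_0[OF N(1)] by blast
    \<comment> \<open>Nothing is inverted for the full index set, which is therefore bad; the empty
      set is not. A bad set of least size is thus nonempty, and removing an index makes it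
      good.\<close>
    define bad where "bad B \<longleftrightarrow> B \<subseteq> {1..m} \<and> \<not> localization a \<subseteq> loc (g B) N" for B
    have "loc (g {1..m}) N = N" by (simp add: loc_def g_def)
    then have "bad {1..m}" using neg N(2) by (auto simp: bad_def)
    then obtain B where B: "bad B" and min: "\<And>C. card C < card B \<Longrightarrow> \<not> bad C"
      using exists_least_iff[of "\<lambda>n. \<exists>B. bad B \<and> card B = n"] by blast
    have Bm: "B \<subseteq> {1..m}" using B by (simp add: bad_def)
    have "g {} = a" by (simp add: g_def a_def)
    then have "\<not> bad {}" using loc_generated_by_nonzero[OF N x] by (simp add: bad_def)
    with B have "B \<noteq> {}" by auto
    interpret local_sub m \<alpha> \<beta> "loc (g B) N" B
    proof unfold_locales
      show "dsub (loc (g B) N)" by (rule loc_dsub[OF N(1)])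
      show "B \<subseteq> {1..m}" by (rule Bm)
      show "\<not> localization a \<subseteq> loc (g B) N" using B by (simp add: bad_def)
      show "x / rf (\<alpha> j) \<in> loc (g B) N" if "j \<in> {1..m} - B" "x \<in> loc (g B) N" for j x
      proof (rule loc_divide[OF N(1) that(2) g_nz])
        show "g B = \<alpha> j * (\<Prod>l\<in>{1..m} - B - {j}. \<alpha> l)"
          unfolding g_def using that(1) by (intro prod.remove) auto
      qed
      show "\<exists>e. rf (\<alpha> i) ^ e * x \<in> loc (g B) N" if i: "i \<in> B" and x: "x \<in> localization a" for i x
      proof -
        \<comment> \<open>By minimality \<open>x\<close> is reached once \<open>\<alpha> i\<close>
          is inverted as well, so a power of \<open>\<alpha> i\<close> takes it into the
          localization for \<open>B\<close>.\<close>
        have "card (B - {i}) < card B" using i Bm by (intro psubset_card_mono) (auto intro: finite_subset)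
        then have "\<not> bad (B - {i})" by (rule min)
        then have "x \<in> loc (g (B - {i})) N" using x Bm by (auto simp: bad_def)
        then obtain e where e: "rf (g (B - {i})) ^ e * x \<in> N" unfolding loc_def by blast
        have "{1..m} - (B - {i}) = insert i ({1..m} - B)" using i Bm by blast
        then have "g (B - {i}) = \<alpha> i * g B" using i by (simp add: g_def)
        with e have "rf (g B) ^ e * (rf (\<alpha> i) ^ e * x) \<in> N" by (simp add: rf_mult power_mult_distrib mult_ac)
        then show ?thesis unfolding loc_def by blast
      qed
    qed
    obtain x0 where x0: "{i \<in> {1..m}. eval_poly (\<alpha> i) x0 = 0} = B" using generic_zero_exists by blast
    with blocks[of x0] \<open>B \<noteq> {}\<close> show False using no_nonintegral_block[OF _ _ _ x0] by auto
  qed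
qed

end

section \<open>Spaces with functions\<close>

lemma
  assumes "space_with_functions X"
  shows sf_open: "f \<in> regular X U \<Longrightarrow> openin (zariski X) U"
    and sf_cong: "f \<in> regular X U \<Longrightarrow> (\<And>x. x \<in> U \<Longrightarrow> f x = g x) \<Longrightarrow> g \<in> regular X U"
    and sf_const: "openin (zariski X) U \<Longrightarrow> (\<lambda>_. c) \<in> regular X U"
    and sf_add: "f \<in> regular X U \<Longrightarrow> g \<in> regular X U \<Longrightarrow> (\<lambda>x. f x + g x) \<in> regular X U"
    and sf_mult: "f \<in> regular X U \<Longrightarrow> g \<in> regular X U \<Longrightarrow> (\<lambda>x. f x * g x) \<in> regular X U"
    and sf_restrict: "f \<in> regular X U \<Longrightarrow> openin (zariski X) V \<Longrightarrow> V \<subseteq> U \<Longrightarrow> f \<in> regular X V"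
    and sf_glue: "openin (zariski X) U \<Longrightarrow> (\<And>p. p \<in> U \<Longrightarrow> \<exists>V. p \<in> V \<and> V \<subseteq> U \<and> f \<in> regular X V) \<Longrightarrow>
      f \<in> regular X U"
    and sf_nonzero_open: "f \<in> regular X U \<Longrightarrow> openin (zariski X) {x \<in> U. f x \<noteq> 0}"
    and sf_inverse: "f \<in> regular X U \<Longrightarrow> (\<lambda>x. inverse (f x)) \<in> regular X {x \<in> U. f x \<noteq> 0}"
proof -
  note s = assms[unfolded space_with_functions_def]
  note c1 = s[THEN conjunct2] and c0 = s[THEN conjunct1]
  note c2 = c1[THEN conjunct2] note c3 = c2[THEN conjunct2] note c4 = c3[THEN conjunct2]
  note c5 = c4[THEN conjunct2] note c6 = c5[THEN conjunct2]
  show "f \<in> regular X U \<Longrightarrow> openin (zariski X) U" using c0 by blast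
  show "f \<in> regular X U \<Longrightarrow> (\<And>x. x \<in> U \<Longrightarrow> f x = g x) \<Longrightarrow> g \<in> regular X U"
    using c1[THEN conjunct1] by blast
  show "openin (zariski X) U \<Longrightarrow> (\<lambda>_. c) \<in> regular X U" using c2[THEN conjunct1] by blast
  show "f \<in> regular X U \<Longrightarrow> g \<in> regular X U \<Longrightarrow> (\<lambda>x. f x + g x) \<in> regular X U"
    using c3[THEN conjunct1] by blast
  show "f \<in> regular X U \<Longrightarrow> g \<in> regular X U \<Longrightarrow> (\<lambda>x. f x * g x) \<in> regular X U"
    using c3[THEN conjunct1] by blast
  show "f \<in> regular X U \<Longrightarrow> openin (zariski X) V \<Longrightarrow> V \<subseteq> U \<Longrightarrow> f \<in> regular X V"
    using c4[THEN conjunct1] by blast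
  show "openin (zariski X) U \<Longrightarrow> (\<And>p. p \<in> U \<Longrightarrow> \<exists>V. p \<in> V \<and> V \<subseteq> U \<and> f \<in> regular X V) \<Longrightarrow>
      f \<in> regular X U" using c5[THEN conjunct1] by blast
  show "f \<in> regular X U \<Longrightarrow> openin (zariski X) {x \<in> U. f x \<noteq> 0}" using c6 by blast
  show "f \<in> regular X U \<Longrightarrow> (\<lambda>x. inverse (f x)) \<in> regular X {x \<in> U. f x \<noteq> 0}" using c6 by blast
qed

lemma sf_power:
  assumes "space_with_functions X" "f \<in> regular X U"
  shows "(\<lambda>x. f x ^ k) \<in> regular X U"
proof (induction k)
  case 0
  then show ?case using sf_const[OF assms(1) sf_open[OF assms]] by simp
next
  case (Suc k)
  then show ?case using sf_mult[OF assms] by simp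
qed

lemma sf_diff:
  assumes "space_with_functions X" "f \<in> regular X U" "g \<in> regular X U"
  shows "(\<lambda>x. f x - g x) \<in> regular X U"
proof -
  have "(\<lambda>x. f x + (- 1) * g x) \<in> regular X U"
    using assms by (intro sf_add sf_mult sf_const sf_open)
  then show ?thesis by simp
qed

lemma irreducible_set_meets:
  assumes "irreducible_set T S" "openin T U" "openin T V" "S \<inter> U \<noteq> {}" "S \<inter> V \<noteq> {}"
  shows "S \<inter> U \<inter> V \<noteq> {}"
proof
  assume e: "S \<inter> U \<inter> V = {}"
  have "S \<subseteq> topspace T" using assms(1) by (simp add: irreducible_set_def)
  with e have "S \<subseteq> (topspace T - U) \<union> (topspace T - V)" by blast
  moreover have "closedin T (topspace T - U)" "closedin T (topspace T - V)" using assms(2,3) by auto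
  ultimately have "S \<subseteq> topspace T - U \<or> S \<subseteq> topspace T - V"
    using assms(1) unfolding irreducible_set_def by blast
  with assms(4,5) show False by blast
qed

text \<open>Two nonvanishing loci that meet an irreducible set also meet each other inside it, so
  functions on it have no zero divisors.\<close>

lemma irreducible_mult_zero:
  assumes X: "space_with_functions X" and D: "irreducible_set (zariski X) D"
    and fg: "f \<in> regular X U" "g \<in> regular X U" "\<And>x. x \<in> D \<inter> U \<Longrightarrow> f x * g x = 0"
    and nz: "y \<in> D \<inter> U" "f y \<noteq> 0"
    and x: "x \<in> D \<inter> U"
  shows "g x = 0"
proof (rule ccontr)
  assume "g x \<noteq> 0"
  with x nz have "D \<inter> {x \<in> U. f x \<noteq> 0} \<inter> {x \<in> U. g x \<noteq> 0} \<noteq> {}"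
    by (intro irreducible_set_meets[OF D] sf_nonzero_open[OF X] fg(1,2)) auto
  with fg(3) show False by auto
qed

text \<open>Identity principle: if the nonvanishing locus of \<open>f\<close> met \<open>D\<close>,
  it would meet \<open>V\<close> inside \<open>D\<close>.\<close>

lemma irreducible_vanish_extend:
  assumes X: "space_with_functions X" and D: "irreducible_set (zariski X) D"
    and f: "f \<in> regular X U" and V: "openin (zariski X) V" "y \<in> D \<inter> V" "\<And>x. x \<in> D \<inter> U \<inter> V \<Longrightarrow> f x = 0"
    and x: "x \<in> D \<inter> U"
  shows "f x = 0"
proof (rule ccontr)
  assume "f x \<noteq> 0"
  with x V(2) have "D \<inter> {x \<in> U. f x \<noteq> 0} \<inter> V \<noteq> {}"
    by (intro irreducible_set_meets[OF D] sf_nonzero_open[OF X] f V(1)) auto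
  with V(3) show False by auto
qed

section \<open>Affine space as a space with functions\<close>

lemma openin_affineE:
  assumes "openin (zariski_affine I) U" "w \<in> U"
  obtains h where "eval_poly h w \<noteq> 0" "\<And>x. x \<in> affine_points I \<Longrightarrow> eval_poly h x \<noteq> 0 \<Longrightarrow> x \<in> U"
  using assms unfolding openin_zariski_affine by blast

lemma openin_affine_nonzero: "openin (zariski_affine I) {x \<in> affine_points I. eval_poly p x \<noteq> 0}"
  unfolding openin_zariski_affine by (intro exI[of _ "{p}"]) simp

lemma zariski_affine_space [simp]: "zariski (affine_space I) = zariski_affine I"
  by (simp add: affine_space_def)

lemma topspace_zariski_affine [simp]: "topspace (zariski_affine I) = affine_points I"
proof
  show "topspace (zariski_affine I) \<subseteq> affine_points I"
    using openin_topspace[of "zariski_affine I"] unfolding openin_zariski_affine by blast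
  show "affine_points I \<subseteq> topspace (zariski_affine I)"
    using openin_subset[OF openin_affine_nonzero[of I 1]] by simp
qed

lemma regular_affine_iff:
  "f \<in> regular (affine_space I) U \<longleftrightarrow> openin (zariski_affine I) U \<and>
     (\<forall>p\<in>U. \<exists>V g h. openin (zariski_affine I) V \<and> p \<in> V \<and> V \<subseteq> U \<and>
        (\<forall>x\<in>V. eval_poly h x \<noteq> 0 \<and> f x = eval_poly g x / eval_poly h x))"
  by (simp add: affine_space_def)

lemma regular_affineI:
  assumes "openin (zariski_affine I) U"
    and "\<And>p. p \<in> U \<Longrightarrow> \<exists>V g h. openin (zariski_affine I) V \<and> p \<in> V \<and> V \<subseteq> U \<and>
        (\<forall>x\<in>V. eval_poly h x \<noteq> 0 \<and> f x = eval_poly g x / eval_poly h x)"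
  shows "f \<in> regular (affine_space I) U"
  using assms unfolding regular_affine_iff by blast

lemma regular_affineE:
  assumes "f \<in> regular (affine_space I) U" "p \<in> U"
  obtains V g h where "openin (zariski_affine I) V" "p \<in> V" "V \<subseteq> U"
    "\<And>x. x \<in> V \<Longrightarrow> eval_poly h x \<noteq> 0" "\<And>x. x \<in> V \<Longrightarrow> f x = eval_poly g x / eval_poly h x"
proof -
  from assms(1)[unfolded regular_affine_iff, THEN conjunct2, THEN bspec, OF assms(2)]
  obtain V g h where "openin (zariski_affine I) V" "p \<in> V" "V \<subseteq> U"
    "\<forall>x\<in>V. eval_poly h x \<noteq> 0 \<and> f x = eval_poly g x / eval_poly h x" by blast
  then show thesis by (intro that[of V h g]) auto
qed

lemma regular_affine_poly:
  assumes "openin (zariski_affine I) U"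
  shows "eval_poly g \<in> regular (affine_space I) U"
  by (rule regular_affineI[OF assms], intro exI[of _ U] exI[of _ g] exI[of _ 1]) (use assms in auto)

lemma sf_affine_space: "space_with_functions (affine_space I)"
  unfolding space_with_functions_def zariski_affine_space
proof (intro conjI allI impI; (elim conjE)?)
  fix U and f :: "('a \<Rightarrow> complex) \<Rightarrow> complex" assume f: "f \<in> regular (affine_space I) U"
  show U: "openin (zariski_affine I) U" using f by (simp add: regular_affine_iff)
  show "g \<in> regular (affine_space I) U" if g: "\<forall>x\<in>U. f x = g x" for g
  proof (rule regular_affineI[OF U])
    fix p assume "p \<in> U"
    from f this obtain V a b where "openin (zariski_affine I) V" "p \<in> V" "V \<subseteq> U"
      "\<And>x. x \<in> V \<Longrightarrow> eval_poly b x \<noteq> 0" "\<And>x. x \<in> V \<Longrightarrow> f x = eval_poly a x / eval_poly b x"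
      by (rule regular_affineE) blast
    with g show "\<exists>V a b. openin (zariski_affine I) V \<and> p \<in> V \<and> V \<subseteq> U \<and>
        (\<forall>x\<in>V. eval_poly b x \<noteq> 0 \<and> g x = eval_poly a x / eval_poly b x)"
      by (intro exI[of _ V] exI[of _ a] exI[of _ b]) (auto simp: subset_iff)
  qed
  show "f \<in> regular (affine_space I) V" if V: "openin (zariski_affine I) V" "V \<subseteq> U" for V
  proof (rule regular_affineI[OF V(1)])
    fix p assume p: "p \<in> V"
    with V f obtain O' a b where "openin (zariski_affine I) O'" "p \<in> O'" "O' \<subseteq> U"
      "\<And>x. x \<in> O' \<Longrightarrow> eval_poly b x \<noteq> 0" "\<And>x. x \<in> O' \<Longrightarrow> f x = eval_poly a x / eval_poly b x"
      by (elim regular_affineE[of f I U p]) auto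
    with p V show "\<exists>V' a b. openin (zariski_affine I) V' \<and> p \<in> V' \<and> V' \<subseteq> V \<and>
        (\<forall>x\<in>V'. eval_poly b x \<noteq> 0 \<and> f x = eval_poly a x / eval_poly b x)"
      by (intro exI[of _ "O' \<inter> V"] exI[of _ a] exI[of _ b]) auto
  qed
  have inv: "\<exists>V a b. openin (zariski_affine I) V \<and> p \<in> V \<and> V \<subseteq> {x \<in> U. f x \<noteq> 0} \<and>
        (\<forall>x\<in>V. eval_poly b x \<noteq> 0 \<and> inverse (f x) = eval_poly a x / eval_poly b x)"
    if "p \<in> {x \<in> U. f x \<noteq> 0}" for p
  proof -
    from that have p: "p \<in> U" "f p \<noteq> 0" by auto
    from f p(1) obtain V a b where V: "openin (zariski_affine I) V" "p \<in> V" "V \<subseteq> U"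
      "\<And>x. x \<in> V \<Longrightarrow> eval_poly b x \<noteq> 0" "\<And>x. x \<in> V \<Longrightarrow> f x = eval_poly a x / eval_poly b x"
      by (rule regular_affineE) blast
    let ?V = "V \<inter> {x \<in> affine_points I. eval_poly a x \<noteq> 0}"
    have "openin (zariski_affine I) ?V" using V(1) openin_affine_nonzero by (rule openin_Int)
    moreover have "p \<in> ?V" using V p(2) openin_subset[OF V(1)] by auto
    moreover have "?V \<subseteq> {x \<in> U. f x \<noteq> 0}" using V by auto
    moreover have "\<forall>x\<in>?V. eval_poly a x \<noteq> 0 \<and> inverse (f x) = eval_poly b x / eval_poly a x" using V by auto
    ultimately show ?thesis by blast
  qed
  show op: "openin (zariski_affine I) {x \<in> U. f x \<noteq> 0}"
    by (subst openin_subopen) (use inv in blast)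
  show "(\<lambda>x. inverse (f x)) \<in> regular (affine_space I) {x \<in> U. f x \<noteq> 0}"
    by (rule regular_affineI[OF op inv])
next
  fix U and c :: complex assume "openin (zariski_affine I) U"
  then have "eval_poly (poly_const c) \<in> regular (affine_space I) U" by (rule regular_affine_poly)
  also have "eval_poly (poly_const c) = (\<lambda>_ :: 'a \<Rightarrow> complex. c)" by (rule ext) simp
  finally show "(\<lambda>_. c) \<in> regular (affine_space I) U" .
next
  fix U and f g :: "('a \<Rightarrow> complex) \<Rightarrow> complex"
  assume f: "f \<in> regular (affine_space I) U" and g: "g \<in> regular (affine_space I) U"
  have U: "openin (zariski_affine I) U" using f by (simp add: regular_affine_iff)
  have *: "\<exists>V a b c d. openin (zariski_affine I) V \<and> p \<in> V \<and> V \<subseteq> U \<and> (\<forall>x\<in>V. eval_poly b x \<noteq> 0 \<and>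
     eval_poly d x \<noteq> 0 \<and> f x = eval_poly a x / eval_poly b x \<and> g x = eval_poly c x / eval_poly d x)"
    if p: "p \<in> U" for p
  proof -
    from f p obtain V a b where V: "openin (zariski_affine I) V" "p \<in> V" "V \<subseteq> U"
      "\<And>x. x \<in> V \<Longrightarrow> eval_poly b x \<noteq> 0" "\<And>x. x \<in> V \<Longrightarrow> f x = eval_poly a x / eval_poly b x"
      by (rule regular_affineE) blast
    from g p obtain V' c d where V': "openin (zariski_affine I) V'" "p \<in> V'" "V' \<subseteq> U"
      "\<And>x. x \<in> V' \<Longrightarrow> eval_poly d x \<noteq> 0" "\<And>x. x \<in> V' \<Longrightarrow> g x = eval_poly c x / eval_poly d x"
      by (rule regular_affineE) blast
    show ?thesis
      by (intro exI[of _ "V \<inter> V'"] exI[of _ a] exI[of _ b] exI[of _ c] exI[of _ d]) (use V V' in auto)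
  qed
  show "(\<lambda>x. f x + g x) \<in> regular (affine_space I) U"
  proof (rule regular_affineI[OF U])
    fix p assume "p \<in> U"
    from *[OF this] obtain V a b c d where "openin (zariski_affine I) V" "p \<in> V" "V \<subseteq> U" "\<forall>x\<in>V. eval_poly b x \<noteq> 0 \<and>
     eval_poly d x \<noteq> 0 \<and> f x = eval_poly a x / eval_poly b x \<and> g x = eval_poly c x / eval_poly d x" by blast
    then show "\<exists>V a b. openin (zariski_affine I) V \<and> p \<in> V \<and> V \<subseteq> U \<and>
        (\<forall>x\<in>V. eval_poly b x \<noteq> 0 \<and> f x + g x = eval_poly a x / eval_poly b x)"
      by (intro exI[of _ V] exI[of _ "a * d + c * b"] exI[of _ "b * d"])
         (auto simp: eval_poly_add eval_poly_mult add_frac_eq)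
  qed
  show "(\<lambda>x. f x * g x) \<in> regular (affine_space I) U"
  proof (rule regular_affineI[OF U])
    fix p assume "p \<in> U"
    from *[OF this] obtain V a b c d where "openin (zariski_affine I) V" "p \<in> V" "V \<subseteq> U" "\<forall>x\<in>V. eval_poly b x \<noteq> 0 \<and>
     eval_poly d x \<noteq> 0 \<and> f x = eval_poly a x / eval_poly b x \<and> g x = eval_poly c x / eval_poly d x" by blast
    then show "\<exists>V a b. openin (zariski_affine I) V \<and> p \<in> V \<and> V \<subseteq> U \<and>
        (\<forall>x\<in>V. eval_poly b x \<noteq> 0 \<and> f x * g x = eval_poly a x / eval_poly b x)"
      by (intro exI[of _ V] exI[of _ "a * c"] exI[of _ "b * d"]) (auto simp: eval_poly_mult)
  qed
next
  fix U and f :: "('a \<Rightarrow> complex) \<Rightarrow> complex"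
  assume U: "openin (zariski_affine I) U"
    and loc: "\<forall>p\<in>U. \<exists>V. p \<in> V \<and> V \<subseteq> U \<and> f \<in> regular (affine_space I) V"
  show "f \<in> regular (affine_space I) U"
  proof (rule regular_affineI[OF U])
    fix p assume "p \<in> U"
    with loc obtain V where V: "p \<in> V" "V \<subseteq> U" "f \<in> regular (affine_space I) V" by blast
    from V(3,1) obtain V' a b where "openin (zariski_affine I) V'" "p \<in> V'" "V' \<subseteq> V"
      "\<And>x. x \<in> V' \<Longrightarrow> eval_poly b x \<noteq> 0" "\<And>x. x \<in> V' \<Longrightarrow> f x = eval_poly a x / eval_poly b x"
      by (rule regular_affineE) blast
    with V(2) show "\<exists>V a b. openin (zariski_affine I) V \<and> p \<in> V \<and> V \<subseteq> U \<and>
        (\<forall>x\<in>V. eval_poly b x \<noteq> 0 \<and> f x = eval_poly a x / eval_poly b x)"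
      by (intro exI[of _ V'] exI[of _ a] exI[of _ b]) auto
  qed
qed

section \<open>Isomorphisms between open subspaces\<close>

lemma zariski_induced [simp]: "zariski (induced_space X S) = subtopology (zariski X) S"
  by (simp add: induced_space_def)

lemma regular_induced_open:
  assumes X: "space_with_functions X" and S: "openin (zariski X) S"
  shows "f \<in> regular (induced_space X S) V \<longleftrightarrow> V \<subseteq> S \<and> f \<in> regular X V"
proof
  assume "f \<in> regular (induced_space X S) V"
  then have V: "openin (subtopology (zariski X) S) V"
    and loc: "\<And>p. p \<in> V \<Longrightarrow> \<exists>U. \<exists>g\<in>regular X U. p \<in> U \<and> (\<forall>x\<in>U \<inter> V. f x = g x)"
    by (auto simp: induced_space_def)
  have V': "openin (zariski X) V" "V \<subseteq> S" using V openin_open_subtopology[OF S] by auto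
  have "f \<in> regular X V"
  proof (rule sf_glue[OF X V'(1)])
    fix p assume p: "p \<in> V"
    from loc[OF this] obtain U g where g: "g \<in> regular X U" "p \<in> U" "\<forall>x\<in>U \<inter> V. f x = g x" by blast
    have "g \<in> regular X (U \<inter> V)" using g V'(1) sf_open[OF X g(1)] by (intro sf_restrict[OF X g(1)]) auto
    then have "f \<in> regular X (U \<inter> V)" by (rule sf_cong[OF X]) (use g in auto)
    with p g(2) show "\<exists>W. p \<in> W \<and> W \<subseteq> V \<and> f \<in> regular X W" by blast
  qed
  with V' show "V \<subseteq> S \<and> f \<in> regular X V" by blast
next
  assume *: "V \<subseteq> S \<and> f \<in> regular X V"
  then have "openin (subtopology (zariski X) S) V"
    using sf_open[OF X] openin_open_subtopology[OF S] by blast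
  with * show "f \<in> regular (induced_space X S) V" by (auto simp: induced_space_def)
qed

text \<open>An isomorphism of open pieces with its inverse made explicit and the transport of
  functions expressed in the ambient spaces, so that induced spaces need not be mentioned
  again.\<close>

definition open_iso ::
    "'a ringed_space \<Rightarrow> 'b ringed_space \<Rightarrow> 'a set \<Rightarrow> 'b set \<Rightarrow> ('a \<Rightarrow> 'b) \<Rightarrow> ('b \<Rightarrow> 'a) \<Rightarrow> bool" where
  "open_iso X Y U W \<phi> \<psi> \<longleftrightarrow> openin (zariski X) U \<and> openin (zariski Y) W \<and>
     (\<forall>x\<in>U. \<phi> x \<in> W \<and> \<psi> (\<phi> x) = x) \<and> (\<forall>y\<in>W. \<psi> y \<in> U \<and> \<phi> (\<psi> y) = y) \<and>
     (\<forall>V f. V \<subseteq> U \<and> f \<in> regular X V \<longrightarrow> (\<lambda>y. f (\<psi> y)) \<in> regular Y {y \<in> W. \<psi> y \<in> V}) \<and>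
     (\<forall>V f. V \<subseteq> W \<and> f \<in> regular Y V \<longrightarrow> (\<lambda>x. f (\<phi> x)) \<in> regular X {x \<in> U. \<phi> x \<in> V})"

lemma isomorphism_open_iso:
  assumes X: "space_with_functions X" and Y: "space_with_functions Y"
    and U: "openin (zariski X) U" and W: "openin (zariski Y) W"
    and iso: "isomorphism (induced_space X U) (induced_space Y W) \<phi>"
  obtains \<psi> where "open_iso X Y U W \<phi> \<psi>"
proof -
  have pts: "points (induced_space X U) = U" "points (induced_space Y W) = W"
    using openin_subset[OF U] openin_subset[OF W] by auto
  obtain \<psi> where \<phi>: "morphism (induced_space X U) (induced_space Y W) \<phi>"
    and \<psi>: "morphism (induced_space Y W) (induced_space X U) \<psi>"
    and inv: "\<forall>x\<in>U. \<psi> (\<phi> x) = x" "\<forall>y\<in>W. \<phi> (\<psi> y) = y"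
    using iso unfolding isomorphism_def pts by blast
  note c1 = \<phi>[unfolded morphism_def] and c2 = \<psi>[unfolded morphism_def]
  have m: "\<phi> x \<in> W" if "x \<in> U" for x
    using continuous_map_image_subset_topspace[OF c1[THEN conjunct1]] that unfolding pts by blast
  have m': "\<psi> y \<in> U" if "y \<in> W" for y
    using continuous_map_image_subset_topspace[OF c2[THEN conjunct1]] that unfolding pts by blast
  have r: "(\<lambda>x. f (\<phi> x)) \<in> regular (induced_space X U) {x \<in> U. \<phi> x \<in> V}"
    if "f \<in> regular (induced_space Y W) V" for f V
    using c1[THEN conjunct2, unfolded pts, rule_format, OF that] .
  have r': "(\<lambda>y. f (\<psi> y)) \<in> regular (induced_space Y W) {y \<in> W. \<psi> y \<in> V}"
    if "f \<in> regular (induced_space X U) V" for f V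
    using c2[THEN conjunct2, unfolded pts, rule_format, OF that] .
  have "open_iso X Y U W \<phi> \<psi>"
    unfolding open_iso_def
  proof (intro conjI allI impI; (elim conjE)?)
    show "openin (zariski X) U" "openin (zariski Y) W" by (fact U W)+
    show "\<forall>x\<in>U. \<phi> x \<in> W \<and> \<psi> (\<phi> x) = x" "\<forall>y\<in>W. \<psi> y \<in> U \<and> \<phi> (\<psi> y) = y" using m m' inv by auto
    show "(\<lambda>y. f (\<psi> y)) \<in> regular Y {y \<in> W. \<psi> y \<in> V}" if "V \<subseteq> U" "f \<in> regular X V" for V f
      using r'[of f V] that unfolding regular_induced_open[OF X U] regular_induced_open[OF Y W] by blast
    show "(\<lambda>x. f (\<phi> x)) \<in> regular X {x \<in> U. \<phi> x \<in> V}" if "V \<subseteq> W" "f \<in> regular Y V" for V f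
      using r[of f V] that unfolding regular_induced_open[OF X U] regular_induced_open[OF Y W] by blast
  qed
  then show thesis by (rule that)
qed

lemma
  assumes "open_iso X Y U W \<phi> \<psi>"
  shows open_iso_open: "openin (zariski X) U" "openin (zariski Y) W"
    and open_iso_maps: "x \<in> U \<Longrightarrow> \<phi> x \<in> W" "y \<in> W \<Longrightarrow> \<psi> y \<in> U"
    and open_iso_inverse: "x \<in> U \<Longrightarrow> \<psi> (\<phi> x) = x" "y \<in> W \<Longrightarrow> \<phi> (\<psi> y) = y"
    and open_iso_push: "V \<subseteq> U \<Longrightarrow> f \<in> regular X V \<Longrightarrow> (\<lambda>y. f (\<psi> y)) \<in> regular Y {y \<in> W. \<psi> y \<in> V}"
    and open_iso_pull: "O' \<subseteq> W \<Longrightarrow> g \<in> regular Y O' \<Longrightarrow> (\<lambda>x. g (\<phi> x)) \<in> regular X {x \<in> U. \<phi> x \<in> O'}"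
proof -
  note s = assms[unfolded open_iso_def]
  note c1 = s[THEN conjunct2] note c2 = c1[THEN conjunct2] note c3 = c2[THEN conjunct2]
  note c4 = c3[THEN conjunct2]
  show "openin (zariski X) U" "openin (zariski Y) W" using s c1 by simp_all
  show "x \<in> U \<Longrightarrow> \<phi> x \<in> W" "x \<in> U \<Longrightarrow> \<psi> (\<phi> x) = x" using c2[THEN conjunct1] by simp_all
  show "y \<in> W \<Longrightarrow> \<psi> y \<in> U" "y \<in> W \<Longrightarrow> \<phi> (\<psi> y) = y" using c3[THEN conjunct1] by simp_all
  show "V \<subseteq> U \<Longrightarrow> f \<in> regular X V \<Longrightarrow> (\<lambda>y. f (\<psi> y)) \<in> regular Y {y \<in> W. \<psi> y \<in> V}"
    using c4[THEN conjunct1] by blast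
  show "O' \<subseteq> W \<Longrightarrow> g \<in> regular Y O' \<Longrightarrow> (\<lambda>x. g (\<phi> x)) \<in> regular X {x \<in> U. \<phi> x \<in> O'}"
    using c4[THEN conjunct2] by blast
qed

text \<open>Openness is carried over by transporting a constant function, since functions are
  regular on open sets only.\<close>

lemma open_iso_push_open:
  assumes "space_with_functions X" "space_with_functions Y" "open_iso X Y U W \<phi> \<psi>"
    "openin (zariski X) V"
  shows "openin (zariski Y) {y \<in> W. \<psi> y \<in> V}"
proof -
  have "openin (zariski X) (U \<inter> V)" using open_iso_open(1)[OF assms(3)] assms(4) by (rule openin_Int)
  from open_iso_push[OF assms(3) _ sf_const[OF assms(1) this]]
  have "openin (zariski Y) {y \<in> W. \<psi> y \<in> U \<inter> V}" by (auto intro: sf_open[OF assms(2)])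
  moreover have "{y \<in> W. \<psi> y \<in> U \<inter> V} = {y \<in> W. \<psi> y \<in> V}" using open_iso_maps(2)[OF assms(3)] by blast
  ultimately show ?thesis by simp
qed

section \<open>Smooth points in a chart\<close>

lemma affine_points_UNIV [simp]: "affine_points UNIV = UNIV"
  by (simp add: affine_points_def)

lemma irreducible_vanish_global:
  assumes X: "space_with_functions X" and D: "irreducible_set (zariski X) D"
    and f: "f \<in> regular X (points X)" and V: "openin (zariski X) V" "y \<in> D \<inter> V" "\<And>x. x \<in> D \<inter> V \<Longrightarrow> f x = 0"
    and x: "x \<in> D"
  shows "f x = 0"
proof -
  have "D \<subseteq> points X" using D by (simp add: irreducible_set_def)
  then show ?thesis using irreducible_vanish_extend[OF X D f V(1,2), of x] V(3) x by blast
qed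

locale chart =
  fixes X :: "'a ringed_space" and U :: "'a set" and W :: "('n::{finite,linorder} \<Rightarrow> complex) set"
    and \<phi> :: "'a \<Rightarrow> 'n \<Rightarrow> complex" and \<psi> :: "('n \<Rightarrow> complex) \<Rightarrow> 'a" and p :: 'a
  assumes X: "space_with_functions X"
    and iso: "open_iso X (affine_space UNIV) U W \<phi> \<psi>"
    and pU: "p \<in> U"
begin

lemmas U_open = open_iso_open(1)[OF iso]
lemmas W_open = open_iso_open(2)[OF iso, unfolded zariski_affine_space]
lemmas maps = open_iso_maps[OF iso]
lemmas inverse = open_iso_inverse[OF iso]

lemma pull_poly: "(\<lambda>x. eval_poly G (\<phi> x)) \<in> regular X U"
proof -
  have "{x \<in> U. \<phi> x \<in> W} = U" using maps by blast
  with open_iso_pull[OF iso order.refl regular_affine_poly[OF W_open], of G] show ?thesis by simp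
qed

lemma basic_nbhd:
  assumes "openin (zariski X) V" "q \<in> V" "q \<in> U"
  obtains h where "eval_poly h (\<phi> q) \<noteq> 0" "\<And>z. eval_poly h z \<noteq> 0 \<Longrightarrow> z \<in> W" "\<And>z. eval_poly h z \<noteq> 0 \<Longrightarrow> \<psi> z \<in> V"
proof -
  have "openin (zariski_affine UNIV) {y \<in> W. \<psi> y \<in> V}"
    using open_iso_push_open[OF X sf_affine_space iso assms(1)] by simp
  moreover have "\<phi> q \<in> {y \<in> W. \<psi> y \<in> V}" using assms maps inverse by simp
  ultimately obtain h where "eval_poly h (\<phi> q) \<noteq> 0"
    "\<And>x. x \<in> affine_points UNIV \<Longrightarrow> eval_poly h x \<noteq> 0 \<Longrightarrow> x \<in> {y \<in> W. \<psi> y \<in> V}"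
    by (rule openin_affineE) blast
  then show thesis by (intro that[of h]) auto
qed

lemma rational:
  assumes f: "f \<in> regular X V" and q: "q \<in> V" "q \<in> U"
  obtains G H V' where "openin (zariski X) V'" "q \<in> V'" "V' \<subseteq> V" "V' \<subseteq> U"
    "\<And>x. x \<in> V' \<Longrightarrow> eval_poly H (\<phi> x) \<noteq> 0" "\<And>x. x \<in> V' \<Longrightarrow> f x = eval_poly G (\<phi> x) / eval_poly H (\<phi> x)"
proof -
  have "f \<in> regular X (V \<inter> U)" using sf_open[OF X f] U_open by (intro sf_restrict[OF X f]) auto
  from open_iso_push[OF iso _ this]
  have r: "(\<lambda>y. f (\<psi> y)) \<in> regular (affine_space UNIV) {y \<in> W. \<psi> y \<in> V \<inter> U}" by blast
  have "\<phi> q \<in> {y \<in> W. \<psi> y \<in> V \<inter> U}" using q maps inverse by simp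
  with r obtain O' G H where O': "openin (zariski_affine UNIV) O'" "\<phi> q \<in> O'" "O' \<subseteq> {y \<in> W. \<psi> y \<in> V \<inter> U}"
    "\<And>y. y \<in> O' \<Longrightarrow> eval_poly H y \<noteq> 0" "\<And>y. y \<in> O' \<Longrightarrow> f (\<psi> y) = eval_poly G y / eval_poly H y"
    by (rule regular_affineE) blast
  have "(\<lambda>x. 1) \<in> regular X {x \<in> U. \<phi> x \<in> O'}"
    using open_iso_pull[OF iso _ sf_const[OF sf_affine_space, of UNIV O' 1]] O'(1,3) by auto
  then have "openin (zariski X) {x \<in> U. \<phi> x \<in> O'}" by (rule sf_open[OF X])
  moreover have "x \<in> V" if "x \<in> U" "\<phi> x \<in> O'" for x using that O'(3) inverse by force
  moreover have "f x = eval_poly G (\<phi> x) / eval_poly H (\<phi> x)" if "x \<in> U" "\<phi> x \<in> O'" for x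
    using O'(5)[OF that(2)] inverse(1)[OF that(1)] by simp
  ultimately show thesis using O'(2,4) q by (intro that[of "{x \<in> U. \<phi> x \<in> O'}" H G]) auto
qed

section \<open>Differentials at the base point of a chart\<close>

definition line :: "'n \<Rightarrow> complex \<Rightarrow> 'a" where
  "line j \<tau> = \<psi> ((\<phi> p)(j := \<phi> p j + \<tau>))"

text \<open>The \<open>j\<close>-th partial derivative at \<open>p\<close> in chart coordinates. It
  depends only on small \<open>\<tau>\<close>, for which the line stays in the chart.\<close>

definition dd :: "'n \<Rightarrow> ('a \<Rightarrow> complex) \<Rightarrow> complex" where
  "dd j f = deriv (\<lambda>\<tau>. f (line j \<tau>)) 0"

lemma line_0 [simp]: "line j 0 = p"
  using inverse(1)[OF pU] by (simp add: line_def)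

lemma eventually_line:
  assumes "openin (zariski X) V" "p \<in> V"
  shows "\<forall>\<^sub>F \<tau> in nhds 0. line j \<tau> \<in> V \<and> \<phi> (line j \<tau>) = (\<phi> p)(j := \<phi> p j + \<tau>)"
proof -
  obtain h where h: "eval_poly h (\<phi> p) \<noteq> 0" "\<And>z. eval_poly h z \<noteq> 0 \<Longrightarrow> z \<in> W"
    "\<And>z. eval_poly h z \<noteq> 0 \<Longrightarrow> \<psi> z \<in> V" using basic_nbhd[OF assms pU] by blast
  have "((\<lambda>\<tau>. eval_poly h ((\<phi> p)(j := \<phi> p j + \<tau>))) \<longlongrightarrow> eval_poly h ((\<phi> p)(j := \<phi> p j + 0))) (nhds 0)"
  proof (rule tendsto_eval_poly)
    fix i
    have "((\<lambda>\<tau>. if i = j then \<phi> p j + \<tau> else \<phi> p i) \<longlongrightarrow> (if i = j then \<phi> p j + 0 else \<phi> p i)) (nhds 0)"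
      using tendsto_add[OF tendsto_const filterlim_ident, of "\<phi> p j" "0 :: complex"] by (cases "i = j") auto
    then show "((\<lambda>\<tau>. ((\<phi> p)(j := \<phi> p j + \<tau>)) i) \<longlongrightarrow> ((\<phi> p)(j := \<phi> p j + 0)) i) (nhds 0)"
      by (cases "i = j") simp_all
  qed
  then have "\<forall>\<^sub>F \<tau> in nhds 0. eval_poly h ((\<phi> p)(j := \<phi> p j + \<tau>)) \<noteq> 0"
    by (rule tendsto_imp_eventually_ne) (use h in simp)
  then show ?thesis
    by eventually_elim (use h inverse in \<open>auto simp: line_def\<close>)
qed

lemma dd_poly_has_derivative:
  "((\<lambda>\<tau>. eval_poly G (\<phi> (line j \<tau>))) has_field_derivative eval_poly (partial_deriv j G) (\<phi> p)) (at 0)"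
proof -
  have "((\<lambda>t. eval_poly G ((\<phi> p)(j := t))) has_field_derivative
      eval_poly (partial_deriv j G) ((\<phi> p)(j := \<phi> p j + 0))) (at (\<phi> p j + 0))"
    by (rule eval_poly_has_partial_derivative)
  then have d: "((\<lambda>\<tau>. eval_poly G ((\<phi> p)(j := \<phi> p j + \<tau>))) has_field_derivative
      eval_poly (partial_deriv j G) (\<phi> p)) (at 0)"
    using DERIV_shift[of "\<lambda>t. eval_poly G ((\<phi> p)(j := t))" _ 0 "\<phi> p j"] by (simp add: add.commute)
  have e: "\<forall>\<^sub>F \<tau> in nhds 0. eval_poly G (\<phi> (line j \<tau>)) = eval_poly G ((\<phi> p)(j := \<phi> p j + \<tau>))"
    using eventually_line[OF U_open pU, of j] by eventually_elim simp
  show ?thesis by (rule DERIV_cong_ev[OF HOL.refl e HOL.refl, THEN iffD2, OF d])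
qed

lemma dd_poly: "dd j (\<lambda>x. eval_poly G (\<phi> x)) = eval_poly (partial_deriv j G) (\<phi> p)"
  unfolding dd_def by (rule DERIV_imp_deriv[OF dd_poly_has_derivative])

lemma dd_cong:
  assumes "openin (zariski X) V" "p \<in> V" "\<And>x. x \<in> V \<Longrightarrow> f x = g x"
  shows "dd j f = dd j g"
  unfolding dd_def
proof (rule deriv_cong_ev)
  show "\<forall>\<^sub>F \<tau> in nhds 0. f (line j \<tau>) = g (line j \<tau>)"
    using eventually_line[OF assms(1,2), of j] by eventually_elim (use assms(3) in auto)
qed simp

lemma has_dd_rational:
  assumes V: "openin (zariski X) V" "p \<in> V" and H: "eval_poly H (\<phi> p) \<noteq> 0"
    and f: "\<And>x. x \<in> V \<Longrightarrow> f x = eval_poly G (\<phi> x) / eval_poly H (\<phi> x)"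
  shows "((\<lambda>\<tau>. f (line j \<tau>)) has_field_derivative
    (eval_poly (partial_deriv j G) (\<phi> p) * eval_poly H (\<phi> p) - eval_poly G (\<phi> p) * eval_poly (partial_deriv j H) (\<phi> p))
      / (eval_poly H (\<phi> p) * eval_poly H (\<phi> p))) (at 0)"
proof -
  have d: "((\<lambda>\<tau>. eval_poly G (\<phi> (line j \<tau>)) / eval_poly H (\<phi> (line j \<tau>))) has_field_derivative
    (eval_poly (partial_deriv j G) (\<phi> p) * eval_poly H (\<phi> p) - eval_poly G (\<phi> p) * eval_poly (partial_deriv j H) (\<phi> p))
      / (eval_poly H (\<phi> p) * eval_poly H (\<phi> p))) (at 0)"
    using DERIV_divide[OF dd_poly_has_derivative[of G j] dd_poly_has_derivative[of H j]] H by simp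
  have e: "\<forall>\<^sub>F \<tau> in nhds 0. f (line j \<tau>) = eval_poly G (\<phi> (line j \<tau>)) / eval_poly H (\<phi> (line j \<tau>))"
    using eventually_line[OF V, of j] by eventually_elim (use f in auto)
  show ?thesis by (rule DERIV_cong_ev[OF HOL.refl e HOL.refl, THEN iffD2, OF d])
qed

lemma has_dd:
  assumes f: "f \<in> regular X V" "p \<in> V"
  shows "((\<lambda>\<tau>. f (line j \<tau>)) has_field_derivative dd j f) (at 0)"
proof -
  obtain G H V' where "openin (zariski X) V'" "p \<in> V'" "V' \<subseteq> V" "V' \<subseteq> U"
    "\<And>x. x \<in> V' \<Longrightarrow> eval_poly H (\<phi> x) \<noteq> 0" "\<And>x. x \<in> V' \<Longrightarrow> f x = eval_poly G (\<phi> x) / eval_poly H (\<phi> x)"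
    using rational[OF f pU] by metis
  then have "\<exists>D. ((\<lambda>\<tau>. f (line j \<tau>)) has_field_derivative D) (at 0)"
    using has_dd_rational[of V' H f G j] by blast
  then show ?thesis unfolding dd_def by (metis DERIV_imp_deriv)
qed

lemma dd_sum_mult:
  assumes "finite L" "\<And>l. l \<in> L \<Longrightarrow> c l \<in> regular X (V l) \<and> p \<in> V l"
    "\<And>l. l \<in> L \<Longrightarrow> t l \<in> regular X (V' l) \<and> p \<in> V' l"
  shows "dd j (\<lambda>x. \<Sum>l\<in>L. c l x * t l x) = (\<Sum>l\<in>L. dd j (c l) * t l p + c l p * dd j (t l))"
proof -
  have "((\<lambda>\<tau>. \<Sum>l\<in>L. c l (line j \<tau>) * t l (line j \<tau>)) has_field_derivative
      (\<Sum>l\<in>L. dd j (c l) * t l p + c l p * dd j (t l))) (at 0)"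
  proof (rule DERIV_sum)
    fix l assume l: "l \<in> L"
    from DERIV_mult[OF has_dd has_dd, of "c l" "V l" "t l" "V' l" j j] assms(2,3)[OF l]
    show "((\<lambda>\<tau>. c l (line j \<tau>) * t l (line j \<tau>)) has_field_derivative dd j (c l) * t l p + c l p * dd j (t l)) (at 0)"
      by (simp add: mult.commute add.commute)
  qed
  then show ?thesis unfolding dd_def by (rule DERIV_imp_deriv)
qed

text \<open>The lexicographic argument: an algebraic relation between functions cutting out the members
  of a chain successively restricts to smaller and smaller members.\<close>

lemma chain_length_bound:
  assumes irr: "\<And>i. i \<le> Suc CARD('n) \<Longrightarrow> irreducible_set (zariski X) (C i)"
    and cl: "\<And>i. i \<le> Suc CARD('n) \<Longrightarrow> closedin (zariski X) (C i)"
    and strict: "\<And>i. i < Suc CARD('n) \<Longrightarrow> C i \<subset> C (Suc i)"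
    and p: "p \<in> C 0"
  shows False
proof -
  let ?n = "CARD('n)"
  have pC: "p \<in> C i" if "i \<le> Suc ?n" for i
    using that
  proof (induction i)
    case (Suc i)
    then show ?case using strict[of i] by auto
  qed (rule p)
  \<comment> \<open>Consecutive members are separated by a polynomial in the coordinates:
    irreducibility puts a point of the larger member outside the smaller one into the chart, and a
    basic neighbourhood of that point avoids the smaller one.\<close>
  have "\<exists>a. (\<forall>x\<in>C i \<inter> U. eval_poly a (\<phi> x) = 0) \<and> (\<exists>y\<in>C (Suc i) \<inter> U. eval_poly a (\<phi> y) \<noteq> 0)"
    if i: "i \<le> ?n" for i
  proof -
    have op: "openin (zariski X) (points X - C i)" using cl[of i] i by auto
    obtain y0 where "y0 \<in> C (Suc i)" "y0 \<notin> C i" using strict[of i] i by auto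
    then have "C (Suc i) \<inter> (points X - C i) \<inter> U \<noteq> {}"
      using irr[of "Suc i"] i pC[of "Suc i"] pU
      by (intro irreducible_set_meets[OF irr[of "Suc i"] op U_open]) (auto simp: irreducible_set_def)
    then obtain y where y: "y \<in> C (Suc i)" "y \<in> U" "y \<in> points X - C i" by blast
    obtain h where h: "eval_poly h (\<phi> y) \<noteq> 0" "\<And>z. eval_poly h z \<noteq> 0 \<Longrightarrow> z \<in> W"
      "\<And>z. eval_poly h z \<noteq> 0 \<Longrightarrow> \<psi> z \<in> points X - C i"
      using basic_nbhd[OF op y(3,2)] by metis
    have "eval_poly h (\<phi> x) = 0" if "x \<in> C i \<inter> U" for x
      using h(3)[of "\<phi> x"] that inverse(1)[of x] by auto
    with h(1) y show ?thesis by blast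
  qed
  then obtain a where a: "\<And>i x. i \<le> ?n \<Longrightarrow> x \<in> C i \<inter> U \<Longrightarrow> eval_poly (a i) (\<phi> x) = 0"
    "\<And>i. i \<le> ?n \<Longrightarrow> \<exists>y\<in>C (Suc i) \<inter> U. eval_poly (a i) (\<phi> y) \<noteq> 0"
    by metis
  obtain Q where Q: "Q \<noteq> 0" "pvars Q \<subseteq> {..?n}" "\<And>z. eval_poly Q (\<lambda>k. eval_poly (a k) z) = 0"
    using algebraic_dependence[of a] by blast
  have reg: "(\<lambda>x. eval_poly R (\<lambda>k. eval_poly (a k) (\<phi> x))) \<in> regular X U" for R
  proof -
    obtain R' where "\<And>z. eval_poly R' z = eval_poly R (\<lambda>k. eval_poly (a k) z)"
      using exists_subst_poly[of R a] by blast
    with pull_poly[of R'] show ?thesis by simp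
  qed
  \<comment> \<open>Here \<open>k\<close> counts down from the top of the chain. On
    \<open>C (Suc i)\<close> the power of \<open>a i\<close> is cancelled from the relation; on
    \<open>C i\<close> the rest of \<open>a i\<close> vanishes, leaving a relation among functions
    of smaller index, and at the end a nonzero constant vanishing at \<open>p\<close>.\<close>
  have "\<exists>Q. Q \<noteq> 0 \<and> pvars Q \<subseteq> {..<Suc ?n - k} \<and>
      (\<forall>x\<in>C (Suc ?n - k) \<inter> U. eval_poly Q (\<lambda>l. eval_poly (a l) (\<phi> x)) = 0)" if "k \<le> Suc ?n" for k
    using that
  proof (induction k)
    case 0
    then show ?case using Q by (intro exI[of _ Q]) auto
  next
    case (Suc k)
    define i where "i = ?n - k"
    have i: "Suc ?n - k = Suc i" "Suc ?n - Suc k = i" "i \<le> ?n" using Suc.prems by (auto simp: i_def)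
    obtain Q where Q: "Q \<noteq> 0" "pvars Q \<subseteq> {..<Suc i}"
      "\<And>x. x \<in> C (Suc i) \<inter> U \<Longrightarrow> eval_poly Q (\<lambda>l. eval_poly (a l) (\<phi> x)) = 0"
      using Suc unfolding i by auto
    obtain e Q1 Q2 where f: "Q = poly_var i ^ e * (Q1 + poly_var i * Q2)" "Q1 \<noteq> 0" "pvars Q1 \<subseteq> pvars Q - {i}"
      using poly_factor_var[OF Q(1), of i] by blast
    obtain y where y: "y \<in> C (Suc i) \<inter> U" "eval_poly (a i) (\<phi> y) \<noteq> 0" using a(2)[OF i(3)] by blast
    have z: "eval_poly (Q1 + poly_var i * Q2) (\<lambda>l. eval_poly (a l) (\<phi> x)) = 0" if "x \<in> C (Suc i) \<inter> U" for x
    proof (rule irreducible_mult_zero[OF X irr sf_power[OF X pull_poly] reg _ y(1) _ that])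
      show "eval_poly (a i) (\<phi> x) ^ e * eval_poly (Q1 + poly_var i * Q2) (\<lambda>l. eval_poly (a l) (\<phi> x)) = 0"
        if "x \<in> C (Suc i) \<inter> U" for x
        using Q(3)[OF that] by (subst (asm) f(1)) (simp add: eval_poly_mult eval_poly_power)
      show "eval_poly (a i) (\<phi> y) ^ e \<noteq> 0" using y(2) by simp
    qed (use i in simp)
    have "eval_poly Q1 (\<lambda>l. eval_poly (a l) (\<phi> x)) = 0" if "x \<in> C i \<inter> U" for x
      using z[of x] a(1)[OF i(3) that] strict[of i] i(3) that by (auto simp: eval_poly_add eval_poly_mult)
    moreover have "pvars Q1 \<subseteq> {..<i}"
    proof
      fix x assume "x \<in> pvars Q1"
      then have "x \<in> {..<Suc i}" "x \<noteq> i" using f(3) Q(2) by blast+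
      then show "x \<in> {..<i}" by simp
    qed
    ultimately show ?case unfolding i using f(2) by blast
  qed
  from this[of "Suc ?n"] obtain R where R: "R \<noteq> 0" "pvars R = {}"
    "\<And>x. x \<in> C 0 \<inter> U \<Longrightarrow> eval_poly R (\<lambda>l. eval_poly (a l) (\<phi> x)) = 0" by auto
  obtain y where "eval_poly R y \<noteq> 0" using nonzero_poly_obtains_point[OF R(1)] by blast
  moreover have "eval_poly R y = eval_poly R (\<lambda>l. eval_poly (a l) (\<phi> p))"
    by (rule eval_poly_cong) (use R(2) in auto)
  ultimately show False using R(3)[of p] p pU by simp
qed

lemma codim_bound:
  assumes "codim X {p} = enat N"
  shows "N \<le> CARD('n)"
proof (rule ccontr)
  assume "\<not> N \<le> CARD('n)"
  then have "enat CARD('n) < codim X {p}" using assms by simp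
  then obtain k C where k: "CARD('n) < k" and
    C: "\<forall>i\<le>k. closedin (zariski X) (C i) \<and> irreducible_set (zariski X) (C i)" "\<forall>i<k. C i \<subset> C (Suc i)" "{p} \<subseteq> C 0"
    unfolding codim_def less_Sup_iff by auto
  show False by (rule chain_length_bound[of C]) (use k C in auto)
qed

text \<open>The parameters generate the maximal ideal, so their differentials span those of all
  coordinates. By \<open>codim_bound\<close> there are at most \<open>CARD('n)\<close> of them, and
  a dependence would leave too few vectors to span.\<close>

lemma parameters_independent:
  assumes ts: "regular_parameters X p ts"
    and b: "\<And>j. (\<Sum>l<length ts. b l * dd j (ts ! l)) = 0"
    and l: "l < length ts"
  shows "b l = 0"
proof (rule ccontr)
  assume bl: "b l \<noteq> 0"
  let ?N = "length ts"
  have gen: "generates_ideal X {p} ts (vanishing_ideal X {p} {p})" and N: "?N \<le> CARD('n)"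
    using ts codim_bound unfolding regular_parameters_def by auto
  define g where "g l = (\<chi> j. dd j (ts ! l))" for l
  have germ: "\<exists>V. ts ! l \<in> regular X V \<and> p \<in> V \<and> (ts ! l) p = 0" if "l < ?N" for l
  proof -
    have "ts ! l \<in> vanishing_ideal X {p} {p}" using gen that by (auto simp: generates_ideal_def)
    then show ?thesis by (auto simp: vanishing_ideal_def germs_def)
  qed
  then obtain V where V: "\<And>l. l < ?N \<Longrightarrow> ts ! l \<in> regular X (V l) \<and> p \<in> V l \<and> (ts ! l) p = 0" by metis
  have ax: "axis k 1 \<in> vec.span (g ` {..<?N})" for k
  proof -
    \<comment> \<open>The \<open>k\<close>-th coordinate, shifted to vanish at \<open>p\<close>; its
      differential is \<open>axis k 1\<close>.\<close>
    let ?G = "poly_var k - poly_const (\<phi> p k)"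
    have "(\<lambda>x. eval_poly ?G (\<phi> x)) \<in> vanishing_ideal X {p} {p}"
      using pull_poly[of ?G] pU U_open
      by (auto simp: vanishing_ideal_def germs_def eval_poly_diff intro!: exI[of _ U])
    with gen obtain c where c: "\<forall>l<?N. c l \<in> germs X {p}"
      "germ_eq X {p} (\<lambda>x. eval_poly ?G (\<phi> x)) (\<lambda>x. \<Sum>l<?N. c l x * (ts ! l) x)"
      unfolding generates_ideal_def by blast
    obtain O' where O': "openin (zariski X) O'" "p \<in> O'"
      "\<And>x. x \<in> O' \<Longrightarrow> eval_poly ?G (\<phi> x) = (\<Sum>l<?N. c l x * (ts ! l) x)"
      using c(2) unfolding germ_eq_def by auto
    obtain V' where V': "\<And>l. l < ?N \<Longrightarrow> c l \<in> regular X (V' l) \<and> p \<in> V' l"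
      using c(1) unfolding germs_def by simp metis
    have "eval_poly (partial_deriv j ?G) (\<phi> p) = (\<Sum>l<?N. c l p * dd j (ts ! l))" for j
    proof -
      have "eval_poly (partial_deriv j ?G) (\<phi> p) = dd j (\<lambda>x. \<Sum>l<?N. c l x * (ts ! l) x)"
        unfolding dd_poly[symmetric] by (rule dd_cong[OF O'])
      also have "\<dots> = (\<Sum>l<?N. dd j (c l) * (ts ! l) p + c l p * dd j (ts ! l))"
        by (rule dd_sum_mult[where V = V' and V' = V]) (use V V' in auto)
      also have "\<dots> = (\<Sum>l<?N. c l p * dd j (ts ! l))" by (rule sum.cong) (use V in auto)
      finally show ?thesis .
    qed
    moreover have "eval_poly (partial_deriv j ?G) (\<phi> p) = (axis k 1 :: (complex, 'n) vec) $ j" for j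
      by (cases "j = k") (simp_all add: partial_deriv_diff partial_deriv_var axis_def)
    ultimately have "axis k 1 = (\<Sum>l<?N. c l p *s g l)" by (simp add: vec_eq_iff g_def)
    also have "\<dots> \<in> vec.span (g ` {..<?N})"
      by (intro vec.span_sum vec.span_scale) (auto intro: vec.span_base)
    finally show ?thesis .
  qed
  have full: "x \<in> vec.span (g ` {..<?N})" for x :: "(complex, 'n) vec"
  proof -
    have "(\<Sum>k\<in>UNIV. (x $ k) *s axis k 1) \<in> vec.span (g ` {..<?N})"
      by (intro vec.span_sum vec.span_scale ax)
    then show ?thesis by (simp only: basis_expansion)
  qed
  let ?R = "g ` ({..<?N} - {l})"
  have "(\<Sum>l<?N. b l *s g l) = 0" using b by (simp add: vec_eq_iff g_def)
  then have "b l *s g l = - (\<Sum>k\<in>{..<?N} - {l}. b k *s g k)"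
    using l by (subst (asm) sum.remove[of _ l]) (auto simp: eq_neg_iff_add_eq_0)
  also have "\<dots> \<in> vec.span ?R"
    by (intro vec.span_neg vec.span_sum vec.span_scale) (auto intro: vec.span_base)
  finally have "b l *s g l \<in> vec.span ?R" .
  then have "inverse (b l) *s (b l *s g l) \<in> vec.span ?R" by (rule vec.span_scale)
  then have gl: "g l \<in> vec.span ?R" using bl by simp
  have "g ` {..<?N} \<subseteq> vec.span ?R"
  proof
    fix y assume "y \<in> g ` {..<?N}"
    then obtain k where "k < ?N" "y = g k" by auto
    then show "y \<in> vec.span ?R" using gl by (cases "k = l") (auto intro: vec.span_base)
  qed
  then have "vec.span (g ` {..<?N}) \<subseteq> vec.span ?R" by (rule vec.span_minimal) simp
  with full have "UNIV \<subseteq> vec.span ?R" by blast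
  then have "vec.dim (UNIV :: ((complex, 'n) vec) set) \<le> card ?R" by (rule vec.dim_le_card) simp
  also have "card ?R \<le> card ({..<?N} - {l})" by (rule card_image_le) simp
  also have "\<dots> < ?N" using l by simp
  finally show False using N by (simp add: card_cart_basis)
qed

end

section \<open>Projection of hypersurfaces and components of zero sets\<close>

lemma eventually_poly_nonzero:
  fixes P :: "complex poly"
  assumes "P \<noteq> 0" shows "\<forall>\<^sub>F t in at z. poly P t \<noteq> 0"
proof -
  have "\<not> z islimpt {t. poly P t = 0}" by (rule islimpt_finite[OF poly_roots_finite[OF assms]])
  then show ?thesis unfolding islimpt_iff_eventually by simp
qed

text \<open>An implicit function argument by roots. The base moves from \<open>w\<close> towards a
  point where \<open>\<rho>\<close> is nonzero; in direction \<open>j\<close> the constant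
  coefficient of \<open>F\<close> tends to zero and the linear one does not, so a small root
  remains. Correcting by that root does not affect \<open>\<rho>\<close>.\<close>

lemma hypersurface_projects:
  fixes F \<rho> h :: "'i mpoly"
  assumes F: "eval_poly F w = 0" "eval_poly (partial_deriv j F) w \<noteq> 0"
    and h: "eval_poly h w \<noteq> 0" and \<rho>: "\<rho> \<noteq> 0" "\<And>z c. eval_poly \<rho> (z(j := c)) = eval_poly \<rho> z"
  obtains z where "eval_poly h z \<noteq> 0" "eval_poly F z = 0" "eval_poly \<rho> z \<noteq> 0"
proof -
  obtain \<xi> where \<xi>: "eval_poly \<rho> \<xi> \<noteq> 0" using nonzero_poly_obtains_point[OF \<rho>(1)] by blast
  define u where "u = (\<lambda>i. \<xi> i - w i)"
  define b where "b \<tau> = (\<lambda>i. w i + \<tau> * u i)" for \<tau>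
  define e where "e = (\<lambda>i. if i = j then 1 else 0 :: complex)"
  define d where "d = total_degree F"
  define P where "P \<tau> = line_poly (b \<tau>) e F" for \<tau>
  have be: "(\<lambda>i. b \<tau> i + s * e i) = (b \<tau>)(j := b \<tau> j + s)" for \<tau> s
    by (auto simp: e_def)
  have Ps: "poly (P \<tau>) s = eval_poly F ((b \<tau>)(j := b \<tau> j + s))" for \<tau> s
    by (simp add: P_def be)
  have P0: "coeff (P \<tau>) 0 = eval_poly F (b \<tau>)" for \<tau>
    using Ps[of \<tau> 0] by (simp add: poly_0_coeff_0)
  have P1: "coeff (P \<tau>) 1 = eval_poly (partial_deriv j F) (b \<tau>)" for \<tau>
  proof -
    have "((\<lambda>s. eval_poly F ((b \<tau>)(j := b \<tau> j + s))) has_field_derivative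
        eval_poly (partial_deriv j F) ((b \<tau>)(j := b \<tau> j + 0))) (at 0)"
      using DERIV_shift[of "\<lambda>t. eval_poly F ((b \<tau>)(j := t))" _ 0 "b \<tau> j"]
        eval_poly_has_partial_derivative[of F "b \<tau>" j "b \<tau> j + 0"] by (simp add: add.commute)
    then have "(poly (P \<tau>) has_field_derivative eval_poly (partial_deriv j F) (b \<tau>)) (at 0)"
      unfolding Ps[symmetric] by simp
    from DERIV_unique[OF this poly_DERIV] show ?thesis
      by (simp add: poly_0_coeff_0 coeff_pderiv)
  qed
  have "((\<lambda>x. eval_poly h (\<lambda>i. b (fst x) i + snd x * e i)) \<longlongrightarrow> eval_poly h (\<lambda>i. w i + fst (0, 0) * u i + snd (0, 0) * e i))
      (nhds (0 :: complex, 0 :: complex))"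
    unfolding b_def by (intro tendsto_eval_poly tendsto_intros) (use tendsto_fst[OF filterlim_ident, of "(0, 0)"]
      tendsto_snd[OF filterlim_ident, of "(0, 0)"] in simp_all)
  then have "\<forall>\<^sub>F x in nhds (0, 0). eval_poly h (\<lambda>i. b (fst x) i + snd x * e i) \<noteq> 0"
    by (rule tendsto_imp_eventually_ne) (use h in simp)
  \<comment> \<open>The shift of the base and the root will each stay below
    \<open>\<delta> / 2\<close>.\<close>
  then obtain \<delta> where \<delta>: "0 < \<delta>"
    "\<And>x. dist x (0, 0) < \<delta> \<Longrightarrow> eval_poly h (\<lambda>i. b (fst x) i + snd x * e i) \<noteq> 0"
    unfolding eventually_nhds_metric by blast
  have b0: "((\<lambda>\<tau>. b \<tau> i) \<longlongrightarrow> w i) (at 0)" for i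
  proof -
    have "((\<lambda>\<tau>. b \<tau> i) \<longlongrightarrow> w i + 0 * u i) (at 0)" unfolding b_def by (intro tendsto_intros)
    then show ?thesis by simp
  qed
  have c1: "((\<lambda>\<tau>. coeff (P \<tau>) 1) \<longlongrightarrow> eval_poly (partial_deriv j F) w) (at 0)"
    unfolding P1 by (intro tendsto_eval_poly b0)
  have "((\<lambda>\<tau>. coeff (P \<tau>) 0) \<longlongrightarrow> eval_poly F w) (at 0)"
    unfolding P0 by (intro tendsto_eval_poly b0)
  then have c0: "((\<lambda>\<tau>. coeff (P \<tau>) 0) \<longlongrightarrow> 0) (at 0)" by (simp only: F(1))
  have "((\<lambda>\<tau>. (\<delta> / 2) * cmod (coeff (P \<tau>) 1) - d * cmod (coeff (P \<tau>) 0)) \<longlongrightarrow>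
      (\<delta> / 2) * cmod (eval_poly (partial_deriv j F) w) - d * cmod 0) (at 0)"
    by (intro tendsto_intros c0 c1)
  then have "\<forall>\<^sub>F \<tau> in at 0. 0 < (\<delta> / 2) * cmod (coeff (P \<tau>) 1) - d * cmod (coeff (P \<tau>) 0)"
    by (rule order_tendstoD) (use \<delta> F in simp)
  moreover have "\<forall>\<^sub>F \<tau> in at 0. coeff (P \<tau>) 1 \<noteq> 0" using c1 F(2) by (rule tendsto_imp_eventually_ne)
  moreover have "\<forall>\<^sub>F \<tau> in at (0 :: complex). cmod \<tau> < \<delta> / 2"
    using \<delta> by (auto simp: eventually_at intro!: exI[of _ "\<delta> / 2"])
  moreover have "\<forall>\<^sub>F \<tau> in at 0. eval_poly \<rho> (b \<tau>) \<noteq> 0"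
  proof -
    have "poly (line_poly w u \<rho>) 1 \<noteq> 0" using \<xi> by (simp add: u_def)
    then have "line_poly w u \<rho> \<noteq> 0" by (metis poly_0)
    from eventually_poly_nonzero[OF this] show ?thesis by (simp add: b_def)
  qed
  ultimately have "\<forall>\<^sub>F \<tau> in at 0. 0 < (\<delta> / 2) * cmod (coeff (P \<tau>) 1) - d * cmod (coeff (P \<tau>) 0) \<and>
      coeff (P \<tau>) 1 \<noteq> 0 \<and> cmod \<tau> < \<delta> / 2 \<and> eval_poly \<rho> (b \<tau>) \<noteq> 0"
    by eventually_elim blast
  then obtain \<tau> where \<tau>: "d * cmod (coeff (P \<tau>) 0) < (\<delta> / 2) * cmod (coeff (P \<tau>) 1)"
    "coeff (P \<tau>) 1 \<noteq> 0" "cmod \<tau> < \<delta> / 2" "eval_poly \<rho> (b \<tau>) \<noteq> 0"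
    using eventually_happens[of _ "at (0 :: complex)"] by force
  obtain s where s: "poly (P \<tau>) s = 0" "cmod s < \<delta> / 2"
    using small_root_exists[OF \<tau>(2), of d "\<delta> / 2"] \<tau>(1) \<delta>(1) degree_line_poly[of "b \<tau>" e F]
    by (auto simp: P_def d_def)
  have "dist (\<tau>, s) (0, 0) \<le> cmod \<tau> + cmod s"
    by (simp add: dist_Pair_Pair sqrt_sum_squares_le_sum)
  then have "dist (\<tau>, s) (0, 0) < \<delta>" using \<tau>(3) s(2) by simp
  from \<delta>(2)[OF this] have "eval_poly h ((b \<tau>)(j := b \<tau> j + s)) \<noteq> 0" by (simp add: be)
  moreover have "eval_poly F ((b \<tau>)(j := b \<tau> j + s)) = 0" using s(1) by (simp add: Ps)
  moreover have "eval_poly \<rho> ((b \<tau>)(j := b \<tau> j + s)) \<noteq> 0" using \<tau>(4) \<rho>(2) by simp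
  ultimately show thesis by (rule that)
qed

context chart
begin

text \<open>
  A special case of Krull's principal ideal theorem. The coordinates other than the \<open>j\<close>-th, \<open>f\<close> and the
  product of the \<open>t D\<close> are algebraically dependent. If \<open>f\<close> vanished on no member of \<open>\<D>\<close>, factors \<open>t\<close> and \<open>f\<close>
  could be cancelled from the relation, leaving a nonzero polynomial in the other coordinates that
  vanishes on the zero set of \<open>f\<close>; but this zero set projects onto an open set.
\<close>

lemma vanishes_on_component:
  assumes f: "f \<in> regular X V" "p \<in> V" "f p = 0" "dd j f \<noteq> 0"
    and fin: "finite \<D>" and irr: "\<And>D. D \<in> \<D> \<Longrightarrow> irreducible_set (zariski X) D" and pD: "\<And>D. D \<in> \<D> \<Longrightarrow> p \<in> D"
    and t: "\<And>D. D \<in> \<D> \<Longrightarrow> t D \<in> regular X (T D) \<and> p \<in> T D \<and> (\<forall>x\<in>D \<inter> T D. t D x = 0)"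
    and t_nz: "\<And>D V. D \<in> \<D> \<Longrightarrow> openin (zariski X) V \<Longrightarrow> p \<in> V \<Longrightarrow> \<exists>x\<in>V. t D x \<noteq> 0"
    and cover: "openin (zariski X) V0" "p \<in> V0" "\<And>x. x \<in> V0 \<Longrightarrow> f x = 0 \<Longrightarrow> x \<in> \<Union>\<D>"
  shows "\<exists>D\<in>\<D>. \<forall>x\<in>D \<inter> V. f x = 0"
proof (rule ccontr)
  assume neg: "\<not> (\<exists>D\<in>\<D>. \<forall>x\<in>D \<inter> V. f x = 0)"
  let ?n = "CARD('n)"
  obtain F H V1 where V1: "openin (zariski X) V1" "p \<in> V1" "V1 \<subseteq> V" "V1 \<subseteq> U"
    "\<And>x. x \<in> V1 \<Longrightarrow> eval_poly H (\<phi> x) \<noteq> 0" "\<And>x. x \<in> V1 \<Longrightarrow> f x = eval_poly F (\<phi> x) / eval_poly H (\<phi> x)"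
    using rational[OF f(1,2) pU] by metis
  have Hp: "eval_poly H (\<phi> p) \<noteq> 0" by (rule V1(5)[OF V1(2)])
  have Fp: "eval_poly F (\<phi> p) = 0" using V1(6)[OF V1(2)] f(3) Hp by simp
  have "dd j f = (eval_poly (partial_deriv j F) (\<phi> p) * eval_poly H (\<phi> p)
      - eval_poly F (\<phi> p) * eval_poly (partial_deriv j H) (\<phi> p)) / (eval_poly H (\<phi> p) * eval_poly H (\<phi> p))"
    unfolding dd_def by (rule DERIV_imp_deriv[OF has_dd_rational[OF V1(1,2) Hp V1(6)]])
  then have dF: "eval_poly (partial_deriv j F) (\<phi> p) \<noteq> 0" using f(4) Fp by (auto split: if_splits)
  have "\<exists>G V'. openin (zariski X) V' \<and> p \<in> V' \<and> V' \<subseteq> U \<and> G \<noteq> 0 \<and> (\<forall>x\<in>D \<inter> V'. eval_poly G (\<phi> x) = 0)"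
    if D: "D \<in> \<D>" for D
  proof -
    obtain G K V' where V': "openin (zariski X) V'" "p \<in> V'" "V' \<subseteq> T D" "V' \<subseteq> U"
      "\<And>x. x \<in> V' \<Longrightarrow> eval_poly K (\<phi> x) \<noteq> 0" "\<And>x. x \<in> V' \<Longrightarrow> t D x = eval_poly G (\<phi> x) / eval_poly K (\<phi> x)"
      using rational[of "t D" "T D" p] t[OF D] pU by metis
    have "G \<noteq> 0" using t_nz[OF D V'(1,2)] V'(6) by fastforce
    moreover have "eval_poly G (\<phi> x) = 0" if "x \<in> D \<inter> V'" for x
    proof -
      have "t D x = 0" using t[OF D] V'(3) that by blast
      with V'(5,6)[of x] that show ?thesis by simp
    qed
    ultimately show ?thesis using V'(1,2,4) by blast
  qed
  then obtain G VD where GV: "\<And>D. D \<in> \<D> \<Longrightarrow> openin (zariski X) (VD D) \<and> p \<in> VD D \<and> VD D \<subseteq> U \<and> G D \<noteq> 0 \<and>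
      (\<forall>x\<in>D \<inter> VD D. eval_poly (G D) (\<phi> x) = 0)" by metis
  define V2 where "V2 = \<Inter>(insert (V1 \<inter> V0) (VD ` \<D>))"
  have V2: "openin (zariski X) V2" unfolding V2_def
    by (rule openin_Inter) (use fin V1(1) cover(1) GV in auto)
  have pV2: "p \<in> V2" using V1(2) cover(2) GV by (auto simp: V2_def)
  have V2s: "V2 \<subseteq> V1" "V2 \<subseteq> V0" "\<And>D. D \<in> \<D> \<Longrightarrow> V2 \<subseteq> VD D" by (auto simp: V2_def)
  obtain b where b: "bij_betw b {0..<?n} (UNIV :: 'n set)"
    using ex_bij_betw_nat_finite[of "UNIV :: 'n set"] by auto
  then obtain k0 where k0: "k0 < ?n" "b k0 = j" unfolding bij_betw_def by (metis UNIV_I atLeastLessThan_iff imageE)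
  define tt where "tt = (\<Prod>D\<in>\<D>. G D)"
  have tt_nz: "tt \<noteq> 0" unfolding tt_def using fin GV by simp
  \<comment> \<open>The coordinates with the \<open>j\<close>-th replaced by \<open>F\<close>, and
    at the extra index \<open>?n\<close> the product \<open>tt\<close>.\<close>
  define a where "a k = (if k = ?n then tt else if k = k0 then F else poly_var (b k))" for k
  obtain Q where Q: "Q \<noteq> 0" "pvars Q \<subseteq> {..?n}" "\<And>z. eval_poly Q (\<lambda>k. eval_poly (a k) z) = 0"
    using algebraic_dependence[of a] by blast
  have subst: "\<exists>R'. \<forall>z. eval_poly R' z = eval_poly R (\<lambda>k. eval_poly (a k) z)" for R
    by (rule exists_subst_poly)
  obtain e Q1 Q2 where Q1: "Q = poly_var ?n ^ e * (Q1 + poly_var ?n * Q2)" "Q1 \<noteq> 0" "pvars Q1 \<subseteq> pvars Q - {?n}"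
    using poly_factor_var[OF Q(1), of ?n] by blast
  obtain S where S: "\<forall>z. eval_poly S z = eval_poly (Q1 + poly_var ?n * Q2) (\<lambda>k. eval_poly (a k) z)" using subst by blast
  \<comment> \<open>An identity of polynomials, valid everywhere: the nonzero \<open>tt\<close>
    cancels, and on its zero set only \<open>Q1\<close> survives.\<close>
  have "tt ^ e * S = 0"
  proof (rule eval_poly_eq_zeroI)
    fix z
    show "eval_poly (tt ^ e * S) z = 0"
      using Q(3)[of z] by (subst (asm) Q1(1)) (simp add: eval_poly_mult eval_poly_power S a_def)
  qed
  with tt_nz have "S = 0" by simp
  have Q1z: "eval_poly Q1 (\<lambda>k. eval_poly (a k) z) = 0" if "eval_poly tt z = 0" for z
  proof -
    have "a ?n = tt" by (simp add: a_def)
    moreover have "eval_poly (Q1 + poly_var ?n * Q2) (\<lambda>k. eval_poly (a k) z) = 0"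
      using S \<open>S = 0\<close> by (metis eval_poly_zero)
    ultimately show ?thesis using that by (simp add: eval_poly_add eval_poly_mult)
  qed
  obtain e' R1 R2 where R1: "Q1 = poly_var k0 ^ e' * (R1 + poly_var k0 * R2)" "R1 \<noteq> 0" "pvars R1 \<subseteq> pvars Q1 - {k0}"
    using poly_factor_var[OF Q1(2), of k0] by blast
  obtain S' where S': "\<forall>z. eval_poly S' z = eval_poly (R1 + poly_var k0 * R2) (\<lambda>k. eval_poly (a k) z)" using subst by blast
  \<comment> \<open>On \<open>D\<close> the product \<open>tt\<close> vanishes, whereas
    \<open>F\<close> is not identically zero there by the assumption being refuted; hence the power
    of \<open>F\<close> cancels.\<close>
  have zD: "eval_poly S' (\<phi> x) = 0" if D: "D \<in> \<D>" and x: "x \<in> D \<inter> V2" for x D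
  proof -
    obtain y where y: "y \<in> D \<inter> V2" "eval_poly F (\<phi> y) \<noteq> 0"
    proof (rule ccontr)
      assume "\<not> thesis"
      with that have "eval_poly F (\<phi> y) = 0" if "y \<in> D \<inter> V2" for y using that by blast
      then have "f y = 0" if "y \<in> D \<inter> V \<inter> V2" for y using that V1(6)[of y] V2s(1) by auto
      then have "f y = 0" if "y \<in> D \<inter> V" for y
        using irreducible_vanish_extend[OF X irr[OF D] f(1) V2, of p y] pV2 pD[OF D] that by blast
      with neg D show False by blast
    qed
    have r: "(\<lambda>x. eval_poly g (\<phi> x)) \<in> regular X V2" for g
      using sf_restrict[OF X pull_poly V2] V2s(1) V1(4) by blast
    show ?thesis
    proof (rule irreducible_mult_zero[OF X irr[OF D] sf_power[OF X r] r _ y(1) _ x])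
      fix x assume x: "x \<in> D \<inter> V2"
      have "eval_poly (G D) (\<phi> x) = 0" using GV[OF D] V2s(3)[OF D] x by blast
      then have "eval_poly tt (\<phi> x) = 0" using fin D by (auto simp: tt_def eval_poly_prod)
      from Q1z[OF this] show "eval_poly F (\<phi> x) ^ e' * eval_poly S' (\<phi> x) = 0"
        using k0(1) by (subst (asm) R1(1)) (simp add: eval_poly_mult eval_poly_power S' a_def)
    qed (use y in simp)
  qed
  \<comment> \<open>\<open>R1\<close> involves neither \<open>tt\<close> nor \<open>F\<close>, so it
    becomes a polynomial in the coordinates other than the \<open>j\<close>-th. At zeros of
    \<open>f\<close> near \<open>p\<close> it vanishes: they lie on some \<open>D\<close>, and
    \<open>F\<close> is zero there.\<close>
  obtain \<rho> where \<rho>: "\<forall>z. eval_poly \<rho> z = eval_poly R1 (\<lambda>k. eval_poly (poly_var (b k)) z)"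
    using exists_subst_poly[of R1 "\<lambda>k. poly_var (b k)"] by blast
  have vR: "k < ?n \<and> k \<noteq> k0" if "k \<in> pvars R1" for k
  proof -
    have "k \<in> pvars Q1" "k \<noteq> k0" using R1(3) that by blast+
    moreover have "k \<in> pvars Q" "k \<noteq> ?n" using Q1(3) \<open>k \<in> pvars Q1\<close> by blast+
    moreover have "k \<le> ?n" using Q(2) \<open>k \<in> pvars Q\<close> by blast
    ultimately show ?thesis by simp
  qed
  have \<rho>a: "eval_poly \<rho> z = eval_poly R1 (\<lambda>k. eval_poly (a k) z)" for z
    unfolding \<rho>[rule_format] by (rule eval_poly_cong) (use vR in \<open>fastforce simp: a_def\<close>)
  have \<rho>z: "eval_poly \<rho> (\<phi> x) = 0" if "x \<in> V2" "f x = 0" for x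
  proof -
    have "x \<in> \<Union>\<D>" using cover(3)[of x] that V2s(2) by blast
    then obtain D where D: "D \<in> \<D>" "x \<in> D" by blast
    have "eval_poly F (\<phi> x) = 0" using V1(5,6)[of x] V2s(1) that by auto
    with zD[OF D(1), of x] D(2) that(1) show ?thesis
      using k0(1) by (simp add: S' \<rho>a eval_poly_add eval_poly_mult a_def)
  qed
  obtain h where h: "eval_poly h (\<phi> p) \<noteq> 0" "\<And>z. eval_poly h z \<noteq> 0 \<Longrightarrow> z \<in> W" "\<And>z. eval_poly h z \<noteq> 0 \<Longrightarrow> \<psi> z \<in> V2"
    using basic_nbhd[OF V2 pV2 pU] by metis
  have \<rho>nz: "\<rho> \<noteq> 0"
  proof
    assume "\<rho> = 0"
    have "eval_poly R1 y = 0" for y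
    proof -
      have "eval_poly R1 y = eval_poly \<rho> (\<lambda>i. y (inv_into {0..<?n} b i))"
        unfolding \<rho>[rule_format] eval_poly_var
        by (rule eval_poly_cong) (use vR b in \<open>auto simp: bij_betw_def inv_into_f_f\<close>)
      with \<open>\<rho> = 0\<close> show ?thesis by simp
    qed
    then have "R1 = 0" by (rule eval_poly_eq_zeroI)
    with R1(2) show False ..
  qed
  have \<rho>j: "eval_poly \<rho> (z(j := c)) = eval_poly \<rho> z" for z c
    unfolding \<rho>[rule_format] eval_poly_var
  proof (rule eval_poly_cong)
    fix k assume "k \<in> pvars R1"
    then have "b k \<noteq> j" using vR[of k] k0 b by (auto simp: bij_betw_def inj_on_def)
    then show "(z(j := c)) (b k) = z (b k)" by simp
  qed
  obtain z where z: "eval_poly h z \<noteq> 0" "eval_poly F z = 0" "eval_poly \<rho> z \<noteq> 0"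
    using hypersurface_projects[OF Fp dF h(1) \<rho>nz \<rho>j] by blast
  have x: "\<psi> z \<in> V2" "\<phi> (\<psi> z) = z" using h z(1) inverse by auto
  have "f (\<psi> z) = 0" using V1(6)[of "\<psi> z"] x V2s(1) z(2) by auto
  from \<rho>z[OF x(1) this] x(2) z(3) show False by simp
qed

section \<open>Local equations and orders of vanishing\<close>

lemma local_equationD:
  assumes "local_equation X p D t"
  obtains V where "t \<in> regular X V" "p \<in> V" "\<And>x. x \<in> D \<inter> V \<Longrightarrow> t x = 0"
proof -
  have "t \<in> vanishing_ideal X {p} D" using assms by (auto simp: local_equation_def generates_ideal_def)
  then obtain V V' where V: "t \<in> regular X V" "p \<in> V" "openin (zariski X) V'" "p \<in> V'" "\<forall>x\<in>V' \<inter> D. t x = 0"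
    by (auto simp: vanishing_ideal_def germs_def)
  have "t \<in> regular X (V \<inter> V')" using V sf_open[OF X V(1)] by (intro sf_restrict[OF X V(1)]) auto
  with V show thesis by (intro that[of "V \<inter> V'"]) auto
qed

lemma local_equation_divides:
  assumes t: "local_equation X p D t" and f: "f \<in> regular X V" "p \<in> V" "\<And>x. x \<in> D \<inter> V \<Longrightarrow> f x = 0"
  obtains c V' where "c \<in> regular X V'" "p \<in> V'" "V' \<subseteq> V" "\<And>x. x \<in> V' \<Longrightarrow> f x = c x * t x"
proof -
  have "f \<in> vanishing_ideal X {p} D"
    using f sf_open[OF X f(1)] by (auto simp: vanishing_ideal_def germs_def)
  then obtain c where c: "c 0 \<in> germs X {p}" "germ_eq X {p} f (\<lambda>x. c 0 x * t x)"
    using t by (auto simp: local_equation_def generates_ideal_def)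
  then obtain V1 V2 where V: "c 0 \<in> regular X V1" "p \<in> V1" "openin (zariski X) V2" "p \<in> V2"
    "\<forall>x\<in>V2. f x = c 0 x * t x" by (auto simp: germs_def germ_eq_def)
  have "c 0 \<in> regular X (V1 \<inter> V2 \<inter> V)"
    using V sf_open[OF X V(1)] sf_open[OF X f(1)] by (intro sf_restrict[OF X V(1)]) auto
  with V f(2) show thesis by (intro that[of "c 0" "V1 \<inter> V2 \<inter> V"]) auto
qed

text \<open>A germ along \<open>D\<close> need not be defined at \<open>p\<close>, but its numerator
  \<open>G\<close> in chart coordinates is. By irreducibility \<open>G\<close> vanishes on
  \<open>D\<close> throughout the chart, so \<open>t\<close> divides it near \<open>p\<close>, and
  the denominator is invertible on an open set meeting \<open>D\<close>.\<close>

lemma local_equation_uniformizer: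
  assumes t: "local_equation X p D t" and D: "irreducible_set (zariski X) D" and pD: "p \<in> D"
  shows "generates_ideal X D [t] (vanishing_ideal X D D)"
  unfolding generates_ideal_def
proof (intro conjI ballI)
  obtain V where V: "t \<in> regular X V" "p \<in> V" "\<And>x. x \<in> D \<inter> V \<Longrightarrow> t x = 0"
    by (rule local_equationD[OF t]) blast
  have "t \<in> germs X D" unfolding germs_def using V(1,2) pD by blast
  moreover have "openin (zariski X) V" "V \<inter> D \<noteq> {}" using sf_open[OF X V(1)] V(2) pD by auto
  ultimately have "t \<in> vanishing_ideal X D D" using V(3) unfolding vanishing_ideal_def by blast
  then show "set [t] \<subseteq> vanishing_ideal X D D" by simp
  fix f assume "f \<in> vanishing_ideal X D D"
  then obtain V1 V2 where V1: "f \<in> regular X V1" "V1 \<inter> D \<noteq> {}" and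
    V2: "openin (zariski X) V2" "V2 \<inter> D \<noteq> {}" "\<forall>x\<in>V2 \<inter> D. f x = 0"
    by (auto simp: vanishing_ideal_def germs_def)
  have o1: "openin (zariski X) V1" by (rule sf_open[OF X V1(1)])
  have "D \<inter> V1 \<inter> V2 \<noteq> {}" using V1 V2 by (intro irreducible_set_meets[OF D o1 V2(1)]) blast+
  then have "D \<inter> (V1 \<inter> V2) \<inter> U \<noteq> {}"
    using pD pU o1 V2(1) U_open by (intro irreducible_set_meets[OF D]) (blast intro: openin_Int)+
  then obtain q where q: "q \<in> D" "q \<in> V1" "q \<in> V2" "q \<in> U" by blast
  obtain G H V3 where V3: "openin (zariski X) V3" "q \<in> V3" "V3 \<subseteq> V1" "V3 \<subseteq> U"
    "\<And>x. x \<in> V3 \<Longrightarrow> eval_poly H (\<phi> x) \<noteq> 0" "\<And>x. x \<in> V3 \<Longrightarrow> f x = eval_poly G (\<phi> x) / eval_poly H (\<phi> x)"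
    using rational[OF V1(1) q(2,4)] by metis
  have "eval_poly G (\<phi> x) = 0" if "x \<in> D \<inter> U" for x
  proof (rule irreducible_vanish_extend[OF X D pull_poly _ _ _ that])
    show "openin (zariski X) (V3 \<inter> V2)" using V3(1) V2(1) by (rule openin_Int)
    show "q \<in> D \<inter> (V3 \<inter> V2)" using q V3(2) by blast
    show "eval_poly G (\<phi> x) = 0" if "x \<in> D \<inter> U \<inter> (V3 \<inter> V2)" for x
    proof -
      have "f x = 0" using V2(3) that by blast
      with V3(5,6)[of x] that show ?thesis by simp
    qed
  qed
  then obtain c V4 where V4: "c \<in> regular X V4" "p \<in> V4" "V4 \<subseteq> U" "\<And>x. x \<in> V4 \<Longrightarrow> eval_poly G (\<phi> x) = c x * t x"
    using local_equation_divides[OF t pull_poly[of G] pU] by metis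
  have o4: "openin (zariski X) V4" by (rule sf_open[OF X V4(1)])
  have meet: "D \<inter> V4 \<inter> V3 \<noteq> {}" using V4(2) pD V3(2) q(1) by (intro irreducible_set_meets[OF D o4 V3(1)]) blast+
  define c' where "c' x = c x * inverse (eval_poly H (\<phi> x))" for x
  have o43: "openin (zariski X) (V4 \<inter> V3)" using o4 V3(1) by (rule openin_Int)
  have "(\<lambda>x. inverse (eval_poly H (\<phi> x))) \<in> regular X (V4 \<inter> V3)"
    by (rule sf_restrict[OF X sf_inverse[OF X pull_poly] o43]) (use V3(4,5) in auto)
  then have "c' \<in> regular X (V4 \<inter> V3)"
    unfolding c'_def using sf_restrict[OF X V4(1) o43] by (intro sf_mult[OF X]) auto
  with meet have "c' \<in> germs X D"
    unfolding germs_def by (intro CollectI exI[of _ "V4 \<inter> V3"]) auto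
  moreover have "f x = c' x * t x" if "x \<in> V4 \<inter> V3" for x
    using V3(5,6)[of x] V4(4)[of x] that by (simp add: c'_def divide_inverse)
  then have "germ_eq X D f (\<lambda>x. c' x * t x)" unfolding germ_eq_def using o43 meet by blast
  ultimately show "\<exists>c. (\<forall>k<length [t]. c k \<in> germs X D) \<and> germ_eq X D f (\<lambda>x. \<Sum>k<length [t]. c k x * ([t] ! k) x)"
    by (intro exI[of _ "\<lambda>_. c'"]) simp
qed

context
  fixes D and t and f :: "'a \<Rightarrow> complex"
  assumes t: "local_equation X p D t" and D: "irreducible_set (zariski X) D" and pD: "p \<in> D"
    and f: "f \<in> regular X (points X)"
begin

lemma D_sub: "D \<subseteq> points X"
  using D by (simp add: irreducible_set_def)

text \<open>The definite description also demands uniqueness: with a positive exponent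
  \<open>f\<close> would vanish on an open part of \<open>D\<close>, hence on
  \<open>D\<close>.\<close>

lemma vanishing_order_eq_0:
  assumes y: "y \<in> D" "f y \<noteq> 0"
  shows "vanishing_order X D f = 0"
  unfolding vanishing_order_def
proof (rule the_equality)
  have nv: "False" if "openin (zariski X) V" "z \<in> D \<inter> V" "\<And>x. x \<in> D \<inter> V \<Longrightarrow> f x = 0" for V z
    using irreducible_vanish_global[OF X D f that y(1)] y(2) by blast
  have "f \<in> germs X D" unfolding germs_def using f y(1) D_sub by blast
  moreover have "f \<notin> vanishing_ideal X D D"
  proof
    assume "f \<in> vanishing_ideal X D D"
    then obtain V where "openin (zariski X) V" "V \<inter> D \<noteq> {}" "\<forall>x\<in>V \<inter> D. f x = 0"
      by (auto simp: vanishing_ideal_def)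
    then show False using nv[of V] by blast
  qed
  moreover have "germ_eq X D f (\<lambda>x. f x * t x ^ 0)"
    unfolding germ_eq_def using y(1) D_sub by (intro exI[of _ "points X"]) auto
  ultimately show "\<exists>t u. generates_ideal X D [t] (vanishing_ideal X D D) \<and>
      u \<in> germs X D - vanishing_ideal X D D \<and> germ_eq X D f (\<lambda>x. u x * t x ^ 0)"
    using local_equation_uniformizer[OF t D pD] by blast
  fix k assume "\<exists>t u. generates_ideal X D [t] (vanishing_ideal X D D) \<and>
      u \<in> germs X D - vanishing_ideal X D D \<and> germ_eq X D f (\<lambda>x. u x * t x ^ k)"
  then obtain t' u' where t': "t' \<in> vanishing_ideal X D D" and eq: "germ_eq X D f (\<lambda>x. u' x * t' x ^ k)"
    by (auto simp: generates_ideal_def)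
  obtain V1 where V1: "openin (zariski X) V1" "V1 \<inter> D \<noteq> {}" "\<forall>x\<in>V1. f x = u' x * t' x ^ k"
    using eq by (auto simp: germ_eq_def)
  obtain V2 where V2: "openin (zariski X) V2" "V2 \<inter> D \<noteq> {}" "\<forall>x\<in>V2 \<inter> D. t' x = 0"
    using t' by (auto simp: vanishing_ideal_def)
  have "D \<inter> V1 \<inter> V2 \<noteq> {}" using V1 V2 by (intro irreducible_set_meets[OF D]) blast+
  then obtain z where z: "z \<in> D \<inter> (V1 \<inter> V2)" by blast
  show "k = 0"
  proof (rule ccontr)
    assume "k \<noteq> 0"
    then have "f x = 0" if "x \<in> D \<inter> (V1 \<inter> V2)" for x using V1(3) V2(3) that by auto
    with nv[OF openin_Int[OF V1(1) V2(1)] z] show False by blast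
  qed
qed

text \<open>In a second factorization \<open>u' * t' ^ k\<close>, \<open>t'\<close> is a multiple of
  \<open>t\<close>. If \<open>k = 0\<close>, then \<open>u'\<close> would vanish on \<open>D\<close>
  like \<open>f\<close>. If \<open>k\<close> is at least two, a factor \<open>t\<close> cancels
  because \<open>X\<close> is irreducible, and \<open>u\<close> would vanish on an open part of
  \<open>D\<close>, hence at \<open>p\<close>.\<close>

lemma vanishing_order_eq_1:
  assumes irrX: "irreducible_set (zariski X) (points X)"
    and u: "u \<in> regular X Vu" "p \<in> Vu" "u p \<noteq> 0" "\<And>x. x \<in> Vu \<Longrightarrow> f x = u x * t x"
    and nz: "\<And>V. openin (zariski X) V \<Longrightarrow> p \<in> V \<Longrightarrow> \<exists>x\<in>V. f x \<noteq> 0"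
  shows "vanishing_order X D f = 1"
  unfolding vanishing_order_def
proof (rule the_equality)
  obtain Vt where Vt: "t \<in> regular X Vt" "p \<in> Vt" "\<And>x. x \<in> D \<inter> Vt \<Longrightarrow> t x = 0"
    using local_equationD[OF t] by metis
  have ou: "openin (zariski X) Vu" and ot: "openin (zariski X) Vt" using sf_open[OF X u(1)] sf_open[OF X Vt(1)] by simp_all
  have uniform: "generates_ideal X D [t] (vanishing_ideal X D D)" by (rule local_equation_uniformizer[OF t D pD])
  have u_nv: "False" if "openin (zariski X) V" "z \<in> D \<inter> V" "\<And>x. x \<in> D \<inter> Vu \<inter> V \<Longrightarrow> u x = 0" for V z
    using irreducible_vanish_extend[OF X D u(1) that, of p] u(2,3) pD by blast
  have f0: "f x = 0" if "x \<in> D" for x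
  proof (rule irreducible_vanish_global[OF X D f openin_Int[OF ou ot] _ _ that])
    show "p \<in> D \<inter> (Vu \<inter> Vt)" using pD u(2) Vt(2) by blast
    show "f x = 0" if "x \<in> D \<inter> (Vu \<inter> Vt)" for x using u(4) Vt(3) that by auto
  qed
  have "u \<in> germs X D" unfolding germs_def using u(1,2) pD by blast
  moreover have "u \<notin> vanishing_ideal X D D"
  proof
    assume "u \<in> vanishing_ideal X D D"
    then obtain V where "openin (zariski X) V" "V \<inter> D \<noteq> {}" "\<forall>x\<in>V \<inter> D. u x = 0"
      by (auto simp: vanishing_ideal_def)
    then show False using u_nv[of V] by blast
  qed
  moreover have "germ_eq X D f (\<lambda>x. u x * t x ^ 1)"
    unfolding germ_eq_def using ou u(2,4) pD by (intro exI[of _ Vu]) auto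
  ultimately show "\<exists>t u. generates_ideal X D [t] (vanishing_ideal X D D) \<and>
      u \<in> germs X D - vanishing_ideal X D D \<and> germ_eq X D f (\<lambda>x. u x * t x ^ 1)"
    using uniform by blast
  fix k assume "\<exists>t u. generates_ideal X D [t] (vanishing_ideal X D D) \<and>
      u \<in> germs X D - vanishing_ideal X D D \<and> germ_eq X D f (\<lambda>x. u x * t x ^ k)"
  then obtain t' u' where t': "t' \<in> vanishing_ideal X D D" and u': "u' \<in> germs X D" "u' \<notin> vanishing_ideal X D D"
    and eq: "germ_eq X D f (\<lambda>x. u' x * t' x ^ k)"
    by (auto simp: generates_ideal_def)
  obtain V1 where V1: "openin (zariski X) V1" "V1 \<inter> D \<noteq> {}" "\<forall>x\<in>V1. f x = u' x * t' x ^ k"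
    using eq by (auto simp: germ_eq_def)
  obtain V2 where V2: "u' \<in> regular X V2" "V2 \<inter> D \<noteq> {}" using u'(1) by (auto simp: germs_def)
  obtain c where c: "c 0 \<in> germs X D" "germ_eq X D t' (\<lambda>x. c 0 x * t x)"
    using uniform t' by (auto simp: generates_ideal_def)
  obtain V3 where V3: "c 0 \<in> regular X V3" "V3 \<inter> D \<noteq> {}" using c(1) by (auto simp: germs_def)
  obtain V4 where V4: "openin (zariski X) V4" "V4 \<inter> D \<noteq> {}" "\<forall>x\<in>V4. t' x = c 0 x * t x"
    using c(2) by (auto simp: germ_eq_def)
  have o2: "openin (zariski X) V2" and o3: "openin (zariski X) V3" using sf_open[OF X V2(1)] sf_open[OF X V3(1)] by simp_all
  define V where "V = Vu \<inter> Vt \<inter> V1 \<inter> V2 \<inter> V3 \<inter> V4"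
  have V: "openin (zariski X) V" unfolding V_def by (intro openin_Int ou ot V1(1) o2 o3 V4(1))
  have m: "D \<inter> (A \<inter> B) \<noteq> {}" if "openin (zariski X) A" "openin (zariski X) B" "D \<inter> A \<noteq> {}" "B \<inter> D \<noteq> {}" for A B
    using irreducible_set_meets[OF D that(1,2)] that(3,4) by blast
  have "D \<inter> V \<noteq> {}" unfolding V_def
    by (intro m openin_Int ou ot V1 o2 V2(2) o3 V3(2) V4) (use u(2) Vt(2) pD in blast)+
  then obtain z where z: "z \<in> D \<inter> V" by blast
  show "k = 1"
  proof (rule ccontr)
    assume k1: "k \<noteq> 1"
    show False
    proof (cases "k = 0")
      case True
      then have "\<forall>x\<in>V1 \<inter> D. u' x = 0" using V1(3) f0 by auto
      with u' V1(1,2) show False unfolding vanishing_ideal_def by blast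
    next
      case False
      with k1 obtain l where l: "k = Suc (Suc l)" by (metis One_nat_def nat.exhaust)
      define w where "w x = u x - u' x * c 0 x ^ k * t x ^ Suc l" for x
      have reg: "g \<in> regular X V" if "g \<in> regular X V'" "V \<subseteq> V'" for g V'
        using sf_restrict[OF X that(1) V that(2)] .
      have regs: "u \<in> regular X V" "t \<in> regular X V" "u' \<in> regular X V" "c 0 \<in> regular X V"
        using reg[OF u(1)] reg[OF Vt(1)] reg[OF V2(1)] reg[OF V3(1)] by (auto simp: V_def)
      have w: "w \<in> regular X V" unfolding w_def
        by (intro sf_diff[OF X] sf_mult[OF X] sf_power[OF X] regs)
      have tw: "t x * w x = 0" if "x \<in> V" for x
      proof -
        have "u x * t x = u' x * (c 0 x * t x) ^ k" using that u(4) V1(3) V4(3) by (auto simp: V_def)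
        then show ?thesis by (simp add: w_def l algebra_simps power_mult_distrib)
      qed
      have VX: "V \<subseteq> points X" using openin_subset[OF V] .
      obtain y where y: "y \<in> V" "t y \<noteq> 0"
      proof (rule ccontr)
        assume "\<not> thesis"
        with that have t0: "t y = 0" if "y \<in> V" for y using that by blast
        have "t x = 0" if "x \<in> Vt" for x
        proof (rule irreducible_vanish_extend[OF X irrX Vt(1) V, of z x])
          show "z \<in> points X \<inter> V" "x \<in> points X \<inter> Vt" using z VX that openin_subset[OF ot] by auto
        qed (use t0 in blast)
        then have "\<forall>x\<in>Vu \<inter> Vt. f x = 0" using u(4) by auto
        with nz[OF openin_Int[OF ou ot]] u(2) Vt(2) show False by blast
      qed
      have w0: "w x = 0" if "x \<in> V" for x
        by (rule irreducible_mult_zero[OF X irrX regs(2) w, of y x]) (use tw y VX that in auto)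
      have "u x = 0" if "x \<in> D \<inter> V" for x
        using w0[of x] Vt(3)[of x] that by (auto simp: w_def V_def)
      then show False using u_nv[OF V z] by blast
    qed
  qed
qed

end

end

section \<open>Lifting curves\<close>

text \<open>\<open>R\<close> continues \<open>f\<close> along the curve to the parameter
  \<open>0\<close>, where the curve itself carries no information; its value and derivative at
  \<open>0\<close> are the first-order expansion of \<open>f\<close>.\<close>

definition along :: "(complex \<Rightarrow> 'a) \<Rightarrow> ('a \<Rightarrow> complex) \<Rightarrow> (complex \<Rightarrow> complex) \<Rightarrow> bool" where
  "along c f R \<longleftrightarrow> R field_differentiable (at 0) \<and> (\<forall>\<^sub>F t in at 0. f (c t) = R t)"

lemma eventually_eq_deriv:
  fixes R S :: "complex \<Rightarrow> complex"
  assumes "R field_differentiable (at 0)" "S field_differentiable (at 0)" "\<forall>\<^sub>F t in at 0. R t = S t"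
  shows "R 0 = S 0" "deriv R 0 = deriv S 0"
proof -
  have "(R \<longlongrightarrow> R 0) (at 0)" "(S \<longlongrightarrow> S 0) (at 0)"
    using assms(1,2) by (auto dest: field_differentiable_imp_continuous_at simp: continuous_at)
  from Lim_transform_eventually[OF this(1) assms(3)] this(2) show 0: "R 0 = S 0"
    by (rule tendsto_unique[OF trivial_limit_at])
  have "\<forall>\<^sub>F t in nhds 0. R t = S t"
    using assms(3) 0 by (auto simp: eventually_at_filter elim: eventually_mono)
  then show "deriv R 0 = deriv S 0" by (rule deriv_cong_ev) simp
qed

text \<open>The affine line lives on \<open>nat \<Rightarrow> complex\<close>, the type of the test
  spaces in \<open>proper_morphism\<close>, with \<open>0\<close> as its only coordinate.\<close>

definition curve_param :: "complex \<Rightarrow> nat \<Rightarrow> complex" where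
  "curve_param t = (\<lambda>k. if k = 0 then t else 0)"

lemma curve_param_0 [simp]: "curve_param t 0 = t"
  by (simp add: curve_param_def)

lemma curve_param_affine [simp]: "curve_param t \<in> affine_points {..<Suc 0}"
  by (simp add: affine_points_def curve_param_def)

lemma isomorphism_id: 
  assumes "\<And>V f. f \<in> regular S V \<Longrightarrow> V \<subseteq> points S"
  shows "isomorphism S S id"
proof -
  have "(\<lambda>x. f (id x)) \<in> regular S {x \<in> points S. id x \<in> V}" if "f \<in> regular S V" for f V
  proof -
    have "{x \<in> points S. id x \<in> V} = V" using assms[OF that] by auto
    with that show ?thesis by simp
  qed
  then have "morphism S S id" by (simp add: morphism_def del: id_apply)
  then show ?thesis unfolding isomorphism_def by (auto intro!: exI[of _ id])
qed

lemma prevariety_affine_line: "prevariety (affine_space {..<Suc 0})"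
proof -
  let ?Y = "affine_space {..<Suc 0}"
  let ?S = "induced_space ?Y (points ?Y)"
  have "V \<subseteq> points ?S" if "f \<in> regular ?S V" for f V
  proof -
    have "openin (zariski ?S) V" using that by (simp add: induced_space_def)
    then show ?thesis by (rule openin_subset)
  qed
  then have "isomorphism ?S ?S id" by (rule isomorphism_id)
  then have "affine_variety ?S" unfolding affine_variety_def
    by (intro exI[of _ "Suc 0"] exI[of _ "points ?Y"] exI[of _ id]) (auto simp del: topspace_zariski_affine)
  then show ?thesis unfolding prevariety_def
    by (intro conjI sf_affine_space exI[of _ "{points ?Y}"]) (auto simp del: topspace_zariski_affine)
qed

lemma morphism_line:
  fixes x0 v :: "'i \<Rightarrow> complex"
  shows "morphism (affine_space {..<Suc 0}) (affine_space UNIV) (\<lambda>y i. x0 i + y 0 * v i)"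
    (is "morphism ?Y ?A ?\<psi>")
proof -
  have ex: "\<exists>q. \<forall>y. eval_poly q y = eval_poly p (?\<psi> y)" for p
  proof -
    from exists_subst_poly[of p "\<lambda>i. poly_const (x0 i) + poly_var (0 :: nat) * poly_const (v i)"]
    show ?thesis by (simp add: eval_poly_add eval_poly_mult)
  qed
  then have "\<forall>p. \<exists>q. \<forall>y. eval_poly q y = eval_poly p (?\<psi> y)" by blast
  from choice[OF this] obtain q where q: "\<And>p y. eval_poly (q p) y = eval_poly p (?\<psi> y)" by blast
  have op: "openin (zariski_affine {..<Suc 0}) {y \<in> affine_points {..<Suc 0}. ?\<psi> y \<in> V}"
    if "openin (zariski_affine UNIV) V" for V
  proof -
    obtain P where "V = {x \<in> affine_points UNIV. \<exists>p\<in>P. eval_poly p x \<noteq> 0}"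
      using \<open>openin (zariski_affine UNIV) V\<close> unfolding openin_zariski_affine by blast
    then show ?thesis unfolding openin_zariski_affine by (intro exI[of _ "q ` P"]) (simp add: q)
  qed
  have "(\<lambda>y. f (?\<psi> y)) \<in> regular ?Y {y \<in> affine_points {..<Suc 0}. ?\<psi> y \<in> V}" if f: "f \<in> regular ?A V" for f V
  proof (rule regular_affineI[OF op])
    show "openin (zariski_affine UNIV) V" using f by (simp add: regular_affine_iff)
    fix y assume y: "y \<in> {y \<in> affine_points {..<Suc 0}. ?\<psi> y \<in> V}"
    then have "?\<psi> y \<in> V" by simp
    from f this obtain V' g h where V': "openin (zariski_affine UNIV) V'" "?\<psi> y \<in> V'" "V' \<subseteq> V"
      "\<And>x. x \<in> V' \<Longrightarrow> eval_poly h x \<noteq> 0" "\<And>x. x \<in> V' \<Longrightarrow> f x = eval_poly g x / eval_poly h x"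
      by (rule regular_affineE) blast
    show "\<exists>V' a b. openin (zariski_affine {..<Suc 0}) V' \<and> y \<in> V' \<and> V' \<subseteq> {y \<in> affine_points {..<Suc 0}. ?\<psi> y \<in> V} \<and>
        (\<forall>x\<in>V'. eval_poly b x \<noteq> 0 \<and> f (?\<psi> x) = eval_poly a x / eval_poly b x)"
      using y V' op[OF V'(1)]
      by (intro exI[of _ "{y \<in> affine_points {..<Suc 0}. ?\<psi> y \<in> V'}"] exI[of _ "q g"] exI[of _ "q h"]) (auto simp: q)
  qed
  moreover have "continuous_map (zariski_affine {..<Suc 0}) (zariski_affine UNIV) ?\<psi>"
    using op unfolding continuous_map_def by auto
  ultimately show ?thesis unfolding morphism_def by simp
qed

lemma poly_regular_line:
  "(\<lambda>y. poly P (y 0)) \<in> regular (affine_space {..<Suc 0}) (affine_points {..<Suc 0})"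
proof -
  let ?q = "\<Sum>k\<le>degree P. poly_const (coeff P k) * poly_var (0 :: nat) ^ k"
  have "eval_poly ?q y = poly P (y 0)" for y
    by (simp add: eval_poly_sum eval_poly_mult eval_poly_power poly_altdef)
  then have "eval_poly ?q = (\<lambda>y. poly P (y 0))" by (intro ext)
  moreover have "openin (zariski_affine {..<Suc 0}) (affine_points {..<Suc 0})"
    using openin_topspace[of "zariski_affine {..<Suc 0}"] by simp
  ultimately show ?thesis using regular_affine_poly[of "{..<Suc 0}" "affine_points {..<Suc 0}" ?q] by simp
qed

text \<open>The closure of a section over the complement of finitely many points of the affine line maps
  onto the line, because the morphism is universally closed.\<close>

lemma curve_limit_exists:
  fixes X :: "'a ringed_space" and \<pi> :: "'a \<Rightarrow> 'i \<Rightarrow> complex"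
  assumes X: "space_with_functions X" and proper: "proper_morphism X (affine_space UNIV) \<pi>"
    and c: "\<And>t. t \<in> T \<Longrightarrow> c t \<in> points X \<and> \<pi> (c t) = (\<lambda>i. x0 i + t * v i)" and T: "infinite T"
  shows "\<exists>p. p \<in> points X \<and> \<pi> p = x0 \<and>
    (\<forall>U f g h. f \<in> regular X U \<longrightarrow> p \<in> U \<longrightarrow> poly h 0 * f p - poly g 0 \<noteq> 0 \<longrightarrow>
       (\<exists>t\<in>T. c t \<in> U \<and> poly h t * f (c t) - poly g t \<noteq> 0))"
proof -
  let ?Y = "affine_space {..<Suc 0}" and ?\<psi> = "\<lambda>y i. x0 i + y 0 * v i"
  let ?P = "product_zariski X ?Y"
  let ?F = "{(x, y). \<pi> x = ?\<psi> y}"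
  define \<Gamma> where "\<Gamma> = (\<lambda>t. (c t, curve_param t)) ` T"
  define C where "C = subtopology ?P ?F closure_of \<Gamma>"
  have closed: "closedin (zariski ?Y) (snd ` C)"
    using proper prevariety_affine_line morphism_line[of x0 v] closedin_closure_of
    unfolding proper_morphism_def C_def by blast
  have basic: "openin ?P {(x, y). x \<in> U \<and> y \<in> V \<and> (\<Sum>k<K. f k x * g k y) \<noteq> 0}"
    if "openin (zariski X) U" "openin (zariski ?Y) V" "\<forall>k<(K :: nat). f k \<in> regular X U \<and> g k \<in> regular ?Y V"
    for U V K f g
    unfolding product_zariski_def by (rule topology_generated_by_Basis) (use that in blast)
  have oY: "openin (zariski ?Y) (affine_points {..<Suc 0})"
    using openin_topspace[of "zariski ?Y"] by simp
  have basic': "openin ?P {(x, y). x \<in> U \<and> y \<in> affine_points {..<Suc 0} \<and> poly h (y 0) * f x - poly g (y 0) \<noteq> 0}"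
    if f: "f \<in> regular X U" for U f h g
  proof -
    have U: "openin (zariski X) U" by (rule sf_open[OF X f])
    \<comment> \<open>Two tensors suffice, \<open>f\<close> with \<open>h\<close> and
      \<open>1\<close> with \<open>- g\<close>: nonvanishing of the difference is then a basic open
      condition on the product.\<close>
    define F where "F k = (if k = 0 then f else (\<lambda>_. 1))" for k :: nat
    define G where "G k y = poly (if k = 0 then h else - g) (y 0)" for k :: nat and y :: "nat \<Rightarrow> complex"
    have "\<forall>k<2 :: nat. F k \<in> regular X U \<and> G k \<in> regular ?Y (affine_points {..<Suc 0})"
      using f sf_const[OF X U] poly_regular_line unfolding F_def G_def by simp
    from basic[OF U oY this] show ?thesis by (simp add: F_def G_def numeral_2_eq_2 mult.commute)
  qed
  have \<Gamma>_top: "\<Gamma> \<subseteq> topspace (subtopology ?P ?F)"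
  proof
    fix z assume "z \<in> \<Gamma>"
    then obtain t where t: "t \<in> T" "z = (c t, curve_param t)" by (auto simp: \<Gamma>_def)
    from openin_subset[OF basic'[OF sf_const[OF X openin_topspace, of 1], of "[:1:]" 0]] c[OF t(1)]
    have "z \<in> topspace ?P" by (auto simp: t(2))
    with c[OF t(1)] show "z \<in> topspace (subtopology ?P ?F)" by (auto simp: t(2))
  qed
  have "\<Gamma> \<subseteq> C" unfolding C_def by (rule closure_of_subset[OF \<Gamma>_top])
  then have inC: "curve_param t \<in> snd ` C" if "t \<in> T" for t using that by (force simp: \<Gamma>_def)
  \<comment> \<open>Otherwise a polynomial nonzero at \<open>0\<close> would vanish on the closed
    image, and so on the infinite set \<open>T\<close>.\<close>
  have "curve_param 0 \<in> snd ` C"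
  proof (rule ccontr)
    assume n: "curve_param 0 \<notin> snd ` C"
    have "openin (zariski_affine {..<Suc 0}) (affine_points {..<Suc 0} - snd ` C)"
      using closed by (simp add: closedin_def)
    then obtain h where h: "eval_poly h (curve_param 0) \<noteq> 0"
      "\<And>y. y \<in> affine_points {..<Suc 0} \<Longrightarrow> eval_poly h y \<noteq> 0 \<Longrightarrow> y \<in> affine_points {..<Suc 0} - snd ` C"
      using n by (elim openin_affineE[where w = "curve_param 0"]) auto
    let ?l = "line_poly (curve_param 0) (curve_param 1) h"
    have l: "poly ?l t = eval_poly h (curve_param t)" for t
      by (simp add: curve_param_def if_distrib cong: if_cong)
    have "?l \<noteq> 0" using h(1) l[of 0] by (metis poly_0)
    moreover have "T \<subseteq> {t. poly ?l t = 0}" using h(2) inC curve_param_affine unfolding l by blast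
    ultimately show False using T poly_roots_finite finite_subset by blast
  qed
  then obtain p where p: "(p, curve_param 0) \<in> C" by force
  then have pF: "(p, curve_param 0) \<in> topspace ?P \<inter> ?F"
    and cl: "\<And>O'. openin (subtopology ?P ?F) O' \<Longrightarrow> (p, curve_param 0) \<in> O' \<Longrightarrow> \<exists>z\<in>\<Gamma>. z \<in> O'"
    unfolding C_def in_closure_of by auto
  have "p \<in> points X"
  proof -
    have "topspace ?P \<subseteq> points X \<times> UNIV"
      unfolding product_zariski_def topology_generated_by_topspace using openin_subset by fastforce
    with pF show ?thesis by auto
  qed
  moreover have "\<pi> p = x0" using pF by simp
  moreover have "\<exists>t\<in>T. c t \<in> U \<and> poly h t * f (c t) - poly g t \<noteq> 0"
    if f: "f \<in> regular X U" "p \<in> U" "poly h 0 * f p - poly g 0 \<noteq> 0" for U f g h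
  proof -
    let ?O = "{(x, y). x \<in> U \<and> y \<in> affine_points {..<Suc 0} \<and> poly h (y 0) * f x - poly g (y 0) \<noteq> 0}"
    have "openin (subtopology ?P ?F) (?O \<inter> ?F)"
      unfolding openin_subtopology using basic'[OF f(1)] by blast
    moreover have "(p, curve_param 0) \<in> ?O \<inter> ?F" using f pF by auto
    ultimately obtain z where "z \<in> \<Gamma>" "z \<in> ?O" using cl by blast
    then show ?thesis by (auto simp: \<Gamma>_def)
  qed
  ultimately show ?thesis by (intro exI[of _ p] conjI allI impI)
qed

text \<open>Zorn's lemma for irreducible subsets of \<open>S\<close> through \<open>x\<close>. In a
  chain, a member not inside \<open>A\<close> and one not inside \<open>B\<close> are comparable, so
  the larger is inside neither.\<close>

lemma irreducible_component_exists:
  assumes "x \<in> S" "S \<subseteq> topspace T"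
  obtains C where "C \<in> irreducible_components T S" "x \<in> C"
proof -
  let ?\<A> = "{C. x \<in> C \<and> C \<subseteq> S \<and> irreducible_set T C}"
  have "{x} \<in> ?\<A>" using assms by (auto simp: irreducible_set_def)
  then have ne: "?\<A> \<noteq> {}" by blast
  have chain: "\<Union>\<C> \<in> ?\<A>" if \<C>: "\<C> \<noteq> {}" "subset.chain ?\<A> \<C>" for \<C>
  proof -
    have sub: "C \<in> ?\<A>" if "C \<in> \<C>" for C using \<C>(2) that by (auto simp: subset_chain_def)
    have "\<Union>\<C> \<subseteq> A \<or> \<Union>\<C> \<subseteq> B" if AB: "closedin T A" "closedin T B" "\<Union>\<C> \<subseteq> A \<union> B" for A B
    proof (rule ccontr)
      assume "\<not> (\<Union>\<C> \<subseteq> A \<or> \<Union>\<C> \<subseteq> B)"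
      then obtain C D where CD: "C \<in> \<C>" "\<not> C \<subseteq> A" "D \<in> \<C>" "\<not> D \<subseteq> B" by blast
      have "C \<subseteq> D \<or> D \<subseteq> C" using \<C>(2) CD by (auto simp: subset_chain_def)
      then obtain M where M: "M \<in> \<C>" "\<not> M \<subseteq> A" "\<not> M \<subseteq> B" using CD by blast
      have "M \<subseteq> A \<union> B" using M(1) AB(3) by blast
      with sub[OF M(1)] AB(1,2) M(2,3) show False unfolding irreducible_set_def by blast
    qed
    moreover have "\<Union>\<C> \<subseteq> S" "x \<in> \<Union>\<C>" using sub \<C>(1) by blast+
    ultimately show ?thesis using assms(2) unfolding irreducible_set_def by blast
  qed
  have "\<exists>M\<in>?\<A>. \<forall>C\<in>?\<A>. M \<subseteq> C \<longrightarrow> C = M"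
    by (rule subset_Zorn_nonempty[OF ne]) (rule chain)
  then obtain M where M: "M \<in> ?\<A>" "\<forall>C\<in>?\<A>. M \<subseteq> C \<longrightarrow> C = M" by (elim bexE)
  have "M \<in> irreducible_components T S"
    unfolding irreducible_components_def using M by blast
  with M(1) show thesis by (intro that) auto
qed

section \<open>Resolutions of arrangements\<close>

locale arrangement_resolution = twisted m \<alpha> \<beta>
  for m :: nat and \<alpha> :: "nat \<Rightarrow> 'n::{finite,linorder} mpoly" and \<beta> +
  fixes X :: "'a ringed_space" and \<pi> :: "'a \<Rightarrow> 'n \<Rightarrow> complex"
    and s :: nat and E :: "nat \<Rightarrow> 'a set" and r :: "nat \<Rightarrow> nat \<Rightarrow> int"
  assumes distinct: "inj_on (\<lambda>i. zero_locus (\<alpha> i)) {1..m}"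
    and resolution: "resolution_of_singularities m \<alpha> X \<pi> s E"
    and multiplicities: "\<And>i. i \<in> {1..m} \<Longrightarrow>
      divisor_of X (\<lambda>x. eval_poly (\<alpha> i) (\<pi> x)) =
      (\<lambda>D. of_bool (D = proper_transform X (affine_space UNIV) \<pi> (zero_locus (\<alpha> i))) +
           (\<Sum>j = 1..s. r i j * of_bool (D = E j)))"
    and nonint_hyperplane: "\<And>i. i \<in> {1..m} \<Longrightarrow> \<beta> i \<notin> \<int>"
    and nonint_exceptional: "\<And>j. j \<in> {1..s} \<Longrightarrow> (\<Sum>i = 1..m. of_int (r i j) * \<beta> i) \<notin> \<int>"
begin

abbreviation "A \<equiv> affine_space (UNIV :: 'n set)"
abbreviation "Exc \<equiv> exceptional_locus X A \<pi>"
abbreviation "Z \<equiv> \<pi> ` Exc"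
abbreviation "PT i \<equiv> proper_transform X A \<pi> (zero_locus (\<alpha> i))"
abbreviation "pull i \<equiv> (\<lambda>x. eval_poly (\<alpha> i) (\<pi> x))"
abbreviation "comps \<equiv> {PT i | i. i \<in> {1..m}} \<union> E ` {1..s}"

lemmas res = resolution[unfolded resolution_of_singularities_def Let_def, folded a_def]

lemma variety: "variety X"
  using res by (elim conjE)

lemma proper: "proper_morphism X A \<pi>"
  using res by (elim conjE)

lemma inj_E: "inj_on E {1..s}"
  using res by (elim conjE)

lemma E_components: "E ` {1..s} = irreducible_components (zariski X) Exc"
  using res by (elim conjE)

lemma E_prime: "\<forall>j\<in>{1..s}. prime_divisor X (E j)"
  using res by (elim conjE)

lemma Z_sub: "Z \<subseteq> zero_locus a"
  using res by (elim conjE)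

lemma iso: "isomorphism (induced_space X (points X - Exc)) (induced_space A (points A - Z)) \<pi>"
  using res by (elim conjE)

lemma charts: "\<exists>\<U>. finite \<U> \<and> \<Union>\<U> = points X \<and>
    (\<forall>U\<in>\<U>. openin (zariski X) U \<and> affine_variety (induced_space X U) \<and>
       (\<exists>W \<phi>. openin (zariski A) W \<and> affine_variety (induced_space A W) \<and>
          isomorphism (induced_space X U) (induced_space A W) \<phi>))"
  using res by (elim conjE)

lemma preimage_components:
  "irreducible_components (zariski X) {x \<in> points X. \<pi> x \<in> zero_locus a} \<subseteq> comps"
  using res by (elim conjE)

lemma crossing: "\<forall>p\<in>points X. normal_crossing_at X p comps"
  using res by (elim conjE)

lemma X: "space_with_functions X" and irrX: "irreducible_set (zariski X) (points X)"
  using variety by (simp_all add: variety_def prevariety_def)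

lemma pull_regular: "pull i \<in> regular X (points X)"
proof -
  have "morphism X A \<pi>" using proper by (simp add: proper_morphism_def)
  moreover have "openin (zariski_affine UNIV) (UNIV :: ('n \<Rightarrow> complex) set)"
    using openin_topspace[of "zariski_affine (UNIV :: 'n set)"] by simp
  ultimately have "pull i \<in> regular X {x \<in> points X. \<pi> x \<in> UNIV}"
    unfolding morphism_def using regular_affine_poly by blast
  then show ?thesis by simp
qed

lemma not_Exc_nbhd:
  assumes "p \<in> points X - Exc"
  obtains U where "openin (zariski X) U" "p \<in> U" "U \<subseteq> points X - Exc" "openin (zariski A) (\<pi> ` U)"
proof -
  from assms obtain U where U: "openin (zariski X) U" "p \<in> U" "openin (zariski A) (\<pi> ` U)"
    "isomorphism (induced_space X U) (induced_space A (\<pi> ` U)) \<pi>"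
    unfolding exceptional_locus_def by blast
  then have "U \<subseteq> points X - Exc"
    using openin_subset[OF U(1)] unfolding exceptional_locus_def by blast
  with U show thesis by (intro that)
qed

lemma open_not_Exc: "openin (zariski X) (points X - Exc)"
proof (subst openin_subopen, intro ballI)
  fix p assume "p \<in> points X - Exc"
  then show "\<exists>T. openin (zariski X) T \<and> p \<in> T \<and> T \<subseteq> points X - Exc"
    by (rule not_Exc_nbhd) blast
qed

lemma \<pi>_not_Z: "x \<in> points X - Exc \<Longrightarrow> \<pi> x \<in> UNIV - Z"
proof -
  assume x: "x \<in> points X - Exc"
  have "continuous_map (zariski (induced_space X (points X - Exc))) (zariski (induced_space A (points A - Z))) \<pi>"
    using iso by (simp only: isomorphism_def morphism_def)
  from continuous_map_image_subset_topspace[OF this] x show ?thesis by (auto simp: image_subset_iff)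
qed

text \<open>A point off \<open>Z\<close> has a preimage off the exceptional locus, and near that
  preimage \<open>\<pi>\<close> is an isomorphism onto an open set, which avoids
  \<open>Z\<close>.\<close>

lemma open_not_Z: "openin (zariski A) (UNIV - Z)"
proof (subst openin_subopen, intro ballI)
  fix y assume y: "y \<in> UNIV - Z"
  obtain \<psi> where \<psi>: "morphism (induced_space A (points A - Z)) (induced_space X (points X - Exc)) \<psi>"
    "\<forall>y\<in>points (induced_space A (points A - Z)). \<pi> (\<psi> y) = y"
    using iso unfolding isomorphism_def by blast
  have "continuous_map (zariski (induced_space A (points A - Z))) (zariski (induced_space X (points X - Exc))) \<psi>"
    using \<psi>(1) by (simp only: morphism_def)
  from continuous_map_image_subset_topspace[OF this] y have "\<psi> y \<in> points X - Exc"
    by (auto simp: image_subset_iff)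
  then obtain U where U: "openin (zariski X) U" "\<psi> y \<in> U" "U \<subseteq> points X - Exc" "openin (zariski A) (\<pi> ` U)"
    by (rule not_Exc_nbhd)
  have "\<pi> (\<psi> y) = y" using \<psi>(2) y by simp
  then have "y \<in> \<pi> ` U" using U(2) by force
  moreover have "\<pi> ` U \<subseteq> UNIV - Z" by (intro image_subsetI \<pi>_not_Z subsetD[OF U(3)])
  ultimately show "\<exists>T. openin (zariski A) T \<and> y \<in> T \<and> T \<subseteq> UNIV - Z"
    using U(4) by (intro exI[of _ "\<pi> ` U"] conjI)
qed

lemma exists_inverse: "\<exists>\<sigma>. open_iso X A (points X - Exc) (UNIV - Z) \<pi> \<sigma>"
  using isomorphism_open_iso[OF X sf_affine_space open_not_Exc open_not_Z] iso by auto

definition "\<sigma> = (SOME \<sigma>. open_iso X A (points X - Exc) (UNIV - Z) \<pi> \<sigma>)"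

lemma \<sigma>: "open_iso X A (points X - Exc) (UNIV - Z) \<pi> \<sigma>"
  unfolding \<sigma>_def using exists_inverse by (rule someI_ex)

lemma pull_closed: "closedin (zariski X) {x \<in> points X. pull i x = 0}"
proof -
  have "openin (zariski X) {x \<in> points X. pull i x \<noteq> 0}" by (rule sf_nonzero_open[OF X pull_regular])
  moreover have "points X - {x \<in> points X. pull i x = 0} = {x \<in> points X. pull i x \<noteq> 0}" by blast
  ultimately show ?thesis by (simp add: closedin_def)
qed

lemma PT_vanishes: "x \<in> PT i \<Longrightarrow> pull i x = 0"
proof -
  assume x: "x \<in> PT i"
  have "PT i \<subseteq> {x \<in> points X. pull i x = 0}"
    unfolding proper_transform_def by (rule closure_of_minimal[OF _ pull_closed]) (auto simp: zero_locus_def)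
  with x show ?thesis by blast
qed

lemma PT_contains: "x \<in> points X \<Longrightarrow> \<pi> x \<in> zero_locus (\<alpha> i) - Z \<Longrightarrow> x \<in> PT i"
  unfolding proper_transform_def by (rule subsetD[OF closure_of_subset]) auto

lemma PT_meets:
  assumes "PT i \<noteq> {}"
  obtains q where "q \<in> PT i" "q \<in> points X - Exc" "\<pi> q \<in> zero_locus (\<alpha> i) - Z"
proof -
  have "{x \<in> points X. \<pi> x \<in> zero_locus (\<alpha> i) - Z} \<noteq> {}"
    using assms unfolding proper_transform_def by (metis (no_types, lifting) closure_of_empty)
  then obtain q where q: "q \<in> points X" "\<pi> q \<in> zero_locus (\<alpha> i) - Z" by blast
  then show thesis using PT_contains[OF q] by (intro that[of q]) auto
qed

lemma E_sub: "j \<in> {1..s} \<Longrightarrow> E j \<subseteq> Exc"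
  using E_components by (auto simp: irreducible_components_def)

lemma prime_irr: "prime_divisor X D \<Longrightarrow> irreducible_set (zariski X) D"
  and prime_closed: "prime_divisor X D \<Longrightarrow> closedin (zariski X) D"
  by (simp_all add: prime_divisor_def)

text \<open>\<open>divisor_of\<close> is zero at anything but a prime divisor, whereas the given
  formula yields \<open>1\<close> at a proper transform that differs from all the prime divisors
  \<open>E j\<close>.\<close>

lemma PT_prime:
  assumes i: "i \<in> {1..m}"
  shows "prime_divisor X (PT i)"
proof (rule ccontr)
  assume n: "\<not> prime_divisor X (PT i)"
  then have "divisor_of X (pull i) (PT i) = 0" by (simp add: divisor_of_def)
  moreover have "(\<Sum>j = 1..s. r i j * of_bool (PT i = E j)) = 0"
    by (rule sum.neutral) (use n E_prime in fastforce)
  ultimately show False using fun_cong[OF multiplicities[OF i], of "PT i"] by simp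
qed

lemma comps_prime: "D \<in> comps \<Longrightarrow> prime_divisor X D"
  using PT_prime E_prime by auto

lemma PT_ne_E:
  assumes "i \<in> {1..m}" "j \<in> {1..s}"
  shows "PT i \<noteq> E j"
proof
  assume e: "PT i = E j"
  have "PT i \<noteq> {}" using prime_irr[OF PT_prime[OF assms(1)]] by (auto simp: irreducible_set_def)
  then obtain q where "q \<in> PT i" "q \<in> points X - Exc" by (rule PT_meets)
  with e E_sub[OF assms(2)] show False by auto
qed

text \<open>Over points off \<open>Z\<close> the map is an isomorphism, so \<open>\<alpha> i\<close>
  vanishes on a nonempty open piece of the hyperplane of \<open>\<alpha> l\<close>; two hyperplanes
  sharing such a piece coincide.\<close>

lemma hyperplanes_distinct:
  assumes il: "i \<in> {1..m}" "l \<in> {1..m}" and v: "\<forall>x\<in>PT l. pull i x = 0"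
  shows "i = l"
proof -
  have "PT l \<noteq> {}" using prime_irr[OF PT_prime[OF il(2)]] by (auto simp: irreducible_set_def)
  then obtain q where q: "\<pi> q \<in> zero_locus (\<alpha> l) - Z" by (rule PT_meets) blast
  define y0 where "y0 = \<pi> q"
  have y0: "eval_poly (\<alpha> l) y0 = 0" "y0 \<in> UNIV - Z" using q by (auto simp: y0_def zero_locus_def)
  obtain h where h: "eval_poly h y0 \<noteq> 0" "\<And>z. z \<in> affine_points UNIV \<Longrightarrow> eval_poly h z \<noteq> 0 \<Longrightarrow> z \<in> UNIV - Z"
    using openin_affineE[OF open_not_Z[simplified zariski_affine_space] y0(2)] by metis
  have on: "eval_poly (\<alpha> i) z = 0" if "eval_poly (\<alpha> l) z = 0" "eval_poly h z \<noteq> 0" for z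
  proof -
    have z: "z \<in> UNIV - Z" using h(2) that by simp
    have c: "\<sigma> z \<in> points X - Exc" "\<pi> (\<sigma> z) = z" using open_iso_maps(2)[OF \<sigma> z] open_iso_inverse(2)[OF \<sigma> z] by auto
    then have "\<sigma> z \<in> PT l" using z that(1) by (intro PT_contains) (auto simp: zero_locus_def)
    with v c(2) show ?thesis by auto
  qed
  have e: "eval_poly (\<alpha> k) (\<lambda>j. y0 j + t * u $ j) = eval_poly (\<alpha> k) y0 + t * pair (lin (\<alpha> k)) u"
    if "k \<in> {1..m}" for k t u
    using eval_poly_shift[OF degree_one[OF that], of y0 "t *s u"]
    by (simp add: pair_commute[of "lin (\<alpha> k)"] pair_scale_left)
  have i0: "eval_poly (\<alpha> i) y0 = 0" by (rule on[OF y0(1) h(1)])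
  \<comment> \<open>Along a direction inside the hyperplane of \<open>\<alpha> l\<close>, a nonzero
    slope of \<open>\<alpha> i\<close> would force \<open>h\<close> to vanish at every
    \<open>t \<noteq> 0\<close>, although it is nonzero at \<open>y0\<close>.\<close>
  have ker: "pair (lin (\<alpha> i)) u = 0" if "pair (lin (\<alpha> l)) u = 0" for u
  proof (rule ccontr)
    assume n: "pair (lin (\<alpha> i)) u \<noteq> 0"
    let ?h = "line_poly y0 (\<lambda>j. u $ j) h"
    have "poly ?h 0 \<noteq> 0" using h(1) by simp
    then have "?h \<noteq> 0" by (metis poly_0)
    moreover have "poly ?h t = 0" if "t \<noteq> 0" for t
      using on[of "\<lambda>j. y0 j + t * u $ j"] e[OF il(2)] e[OF il(1)] y0(1) i0 n that \<open>pair (lin (\<alpha> l)) u = 0\<close> by auto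
    then have "- {0} \<subseteq> {t. poly ?h t = 0}" by auto
    ultimately have "finite (- {0 :: complex})" using poly_roots_finite finite_subset by blast
    then show False by (simp add: infinite_UNIV_char_0)
  qed
  have "zero_locus (\<alpha> i) = zero_locus (\<alpha> l)"
  proof -
    have ev: "eval_poly (\<alpha> k) z = pair (lin (\<alpha> k)) (\<chi> j. z j - y0 j)" if "k \<in> {1..m}" "eval_poly (\<alpha> k) y0 = 0" for k z
      using e[OF that(1), of 1 "\<chi> j. z j - y0 j"] that(2) by simp
    have "pair (lin (\<alpha> l)) u = 0" if "pair (lin (\<alpha> i)) u = 0" for u
    proof (rule ccontr)
      assume n: "pair (lin (\<alpha> l)) u \<noteq> 0"
      have "lin (\<alpha> i) $ j = 0" for j
      proof -
        have pj: "pair w (axis j 1) = w $ j" for w :: "(complex, 'n) vec"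
          by (simp add: pair_def axis_def if_distrib cong: if_cong)
        \<comment> \<open>The multiple of \<open>u\<close> that moves the basis vector into the
          kernel of \<open>lin (\<alpha> l)\<close>, and thus into that of
          \<open>lin (\<alpha> i)\<close>.\<close>
        let ?c = "pair (lin (\<alpha> l)) (axis j 1) / pair (lin (\<alpha> l)) u"
        have lin: "pair w (axis j 1 + (- ?c) *s u) = pair w (axis j 1) - ?c * pair w u" for w
          unfolding pair_commute[of w] pair_add_left pair_scale_left by simp
        have "pair (lin (\<alpha> i)) (axis j 1 + (- ?c) *s u) = 0"
          by (intro ker, unfold lin) (use n in simp)
        then have "lin (\<alpha> i) $ j - ?c * pair (lin (\<alpha> i)) u = 0" unfolding lin unfolding pj .
        then show ?thesis using that by simp
      qed
      then have "lin (\<alpha> i) = 0" by (simp add: vec_eq_iff)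
      with lin_nonzero[OF degree_one[OF il(1)]] show False by simp
    qed
    with ker show ?thesis unfolding zero_locus_def ev[OF il(1) i0] ev[OF il(2) y0(1)] by blast
  qed
  with distinct il show ?thesis by (auto dest: inj_onD)
qed

end

text \<open>
  The assumption \<open>limit\<close> says that \<open>(p, 0)\<close> lies in the closure of the graph of the lift of the line
  \<open>x0 + t v\<close>, tested on functions \<open>h(t) f - g(t)\<close>.
\<close>

locale lifted = arrangement_resolution m \<alpha> \<beta> X \<pi> s E r
  for m :: nat and \<alpha> :: "nat \<Rightarrow> 'n::{finite,linorder} mpoly" and \<beta>
    and X :: "'a ringed_space" and \<pi> s E r +
  fixes x0 :: "'n \<Rightarrow> complex" and v :: "(complex, 'n) vec" and p :: 'a
  assumes through: "{i \<in> {1..m}. eval_poly (\<alpha> i) x0 = 0} \<noteq> {}"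
    and transversal: "\<And>i. i \<in> {1..m} \<Longrightarrow> eval_poly (\<alpha> i) x0 = 0 \<Longrightarrow> pair (lin (\<alpha> i)) v \<noteq> 0"
    and p: "p \<in> points X" "\<pi> p = x0"
    and limit: "\<And>U f g h. f \<in> regular X U \<Longrightarrow> p \<in> U \<Longrightarrow> poly h 0 * f p - poly g 0 \<noteq> 0 \<Longrightarrow>
       \<exists>t\<in>{t. eval_poly a (\<lambda>i. x0 i + t * v $ i) \<noteq> 0}.
         \<sigma> (\<lambda>i. x0 i + t * v $ i) \<in> U \<and> poly h t * f (\<sigma> (\<lambda>i. x0 i + t * v $ i)) - poly g t \<noteq> 0"
begin

definition "Ax = {i \<in> {1..m}. eval_poly (\<alpha> i) x0 = 0}"
definition "\<gamma> t = (\<lambda>i. x0 i + t * v $ i)"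
definition "c t = \<sigma> (\<gamma> t)"
definition "T = {t. eval_poly a (\<gamma> t) \<noteq> 0}"
text \<open>The slope of \<open>\<alpha> i\<close> along the line; for \<open>i\<close> in
  \<open>Ax\<close> it is the derivative at \<open>0\<close> of the pullback along the lift.\<close>

definition "q i = pair (lin (\<alpha> i)) v"

abbreviation "line P \<equiv> line_poly x0 (\<lambda>i. v $ i) P"

lemma line_eval: "poly (line P) t = eval_poly P (\<gamma> t)"
  by (simp add: \<gamma>_def)

lemma limit': "f \<in> regular X U \<Longrightarrow> p \<in> U \<Longrightarrow> poly h 0 * f p - poly g 0 \<noteq> 0 \<Longrightarrow>
    \<exists>t\<in>T. c t \<in> U \<and> poly h t * f (c t) - poly g t \<noteq> 0"
  using limit unfolding T_def c_def \<gamma>_def .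

lemma q_nz: "i \<in> Ax \<Longrightarrow> q i \<noteq> 0"
  using transversal by (simp add: Ax_def q_def)

lemma eval_\<gamma>:
  assumes "i \<in> Ax" shows "eval_poly (\<alpha> i) (\<gamma> t) = t * q i"
  using eval_poly_shift[OF degree_one, of i x0 "t *s v"] assms
  by (simp add: \<gamma>_def q_def Ax_def pair_commute[of "lin (\<alpha> i)"] pair_scale_left)

lemma zero_notin_T: "0 \<notin> T"
  using through by (auto simp: T_def \<gamma>_def a_def eval_poly_prod)

lemma \<gamma>_notin_Z: "t \<in> T \<Longrightarrow> \<gamma> t \<in> UNIV - Z"
  using Z_sub by (auto simp: T_def zero_locus_def)

lemma lift_of_line:
  assumes "t \<in> T" shows "c t \<in> points X - Exc" "\<pi> (c t) = \<gamma> t"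
  using open_iso_maps(2)[OF \<sigma> \<gamma>_notin_Z[OF assms]] open_iso_inverse(2)[OF \<sigma> \<gamma>_notin_Z[OF assms]]
  by (simp_all add: c_def)

text \<open>\<open>limit\<close> supplies one parameter in \<open>T\<close> whose lift lies in
  \<open>U\<close>; since the condition is open on the line, it then fails for finitely many
  parameters only.\<close>

lemma eventually_curve:
  assumes U: "openin (zariski X) U" "p \<in> U"
  shows "\<forall>\<^sub>F t in at 0. t \<in> T \<and> c t \<in> U"
proof -
  obtain t0 where t0: "t0 \<in> T" "c t0 \<in> U"
    using limit'[OF sf_const[OF X U(1), of 1] U(2), of "[:1:]" 0] by auto
  have op: "openin (zariski_affine UNIV) {y \<in> UNIV - Z. \<sigma> y \<in> U}"
    using open_iso_push_open[OF X sf_affine_space \<sigma> U(1)] by simp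
  have "\<gamma> t0 \<in> {y \<in> UNIV - Z. \<sigma> y \<in> U}" using \<gamma>_notin_Z t0 by (simp add: c_def)
  with op obtain h where h: "eval_poly h (\<gamma> t0) \<noteq> 0"
    "\<And>x. x \<in> affine_points UNIV \<Longrightarrow> eval_poly h x \<noteq> 0 \<Longrightarrow> x \<in> {y \<in> UNIV - Z. \<sigma> y \<in> U}"
    by (rule openin_affineE) blast
  have "poly (line (h * a)) t0 \<noteq> 0" using h(1) t0(1) unfolding line_eval by (simp add: eval_poly_mult T_def)
  then have "line (h * a) \<noteq> 0" by (metis poly_0)
  from eventually_poly_nonzero[OF this, of 0] show ?thesis
    by eventually_elim (use h(2) in \<open>auto simp: line_eval eval_poly_mult T_def c_def simp del: poly_line_poly\<close>)
qed

text \<open>A fraction \<open>g / h\<close> representing \<open>f\<close> along the curve, with \<open>h\<close> of least degree, has \<open>h(0) \<noteq> 0\<close>: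
  otherwise \<open>limit\<close> gives \<open>g(0) = 0\<close>, and \<open>t\<close> can be cancelled.\<close>

lemma along_curve:
  assumes f: "f \<in> regular X U" "p \<in> U"
  shows "\<exists>R. along c f R \<and> R 0 = f p"
proof -
  have U: "openin (zariski X) U" by (rule sf_open[OF X f(1)])
  define good where "good g h \<longleftrightarrow> h \<noteq> 0 \<and> (\<forall>t\<in>T. c t \<in> U \<longrightarrow> poly h t * f (c t) = poly g t)" for g h
  have "\<exists>g h. good g h"
  proof -
    obtain t0 where t0: "t0 \<in> T" "c t0 \<in> U"
      using limit'[OF sf_const[OF X U, of 1] f(2), of "[:1:]" 0] by auto
    have "f \<in> regular X (U \<inter> (points X - Exc))"
      using open_not_Exc U by (intro sf_restrict[OF X f(1)]) auto
    from open_iso_push[OF \<sigma> _ this] have r: "(\<lambda>y. f (\<sigma> y)) \<in> regular A {y \<in> UNIV - Z. \<sigma> y \<in> U \<inter> (points X - Exc)}"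
      by blast
    have "\<gamma> t0 \<in> {y \<in> UNIV - Z. \<sigma> y \<in> U \<inter> (points X - Exc)}"
      using \<gamma>_notin_Z t0 lift_of_line(1)[OF t0(1)] by (simp add: c_def)
    with r obtain V G H where V: "openin (zariski_affine UNIV) V" "\<gamma> t0 \<in> V"
      "V \<subseteq> {y \<in> UNIV - Z. \<sigma> y \<in> U \<inter> (points X - Exc)}"
      "\<And>y. y \<in> V \<Longrightarrow> eval_poly H y \<noteq> 0" "\<And>y. y \<in> V \<Longrightarrow> f (\<sigma> y) = eval_poly G y / eval_poly H y"
      by (rule regular_affineE) blast
    obtain k where k: "eval_poly k (\<gamma> t0) \<noteq> 0" "\<And>y. y \<in> affine_points UNIV \<Longrightarrow> eval_poly k y \<noteq> 0 \<Longrightarrow> y \<in> V"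
      using openin_affineE[OF V(1,2)] by metis
    have "poly (line (H * k)) t0 \<noteq> 0" using k(1) V(4)[OF V(2)] unfolding line_eval by (simp add: eval_poly_mult)
    then have "line (H * k) \<noteq> 0" by (metis poly_0)
    moreover have "poly (line (H * k)) t * f (c t) = poly (line (G * k)) t" for t
    proof (cases "eval_poly k (\<gamma> t) = 0")
      case False
      then have "\<gamma> t \<in> V" using k(2) by simp
      with V(4,5)[OF this] show ?thesis unfolding line_eval by (simp add: eval_poly_mult c_def)
    qed (simp add: line_eval eval_poly_mult del: poly_line_poly)
    ultimately show ?thesis unfolding good_def by blast
  qed
  then obtain d where d: "\<exists>g h. good g h \<and> degree h = d" "\<And>e. e < d \<Longrightarrow> \<not> (\<exists>g h. good g h \<and> degree h = e)"
    using exists_least_iff[of "\<lambda>d. \<exists>g h. good g h \<and> degree h = d"] by blast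
  then obtain g h where gh: "good g h" "degree h = d" by blast
  have val: "poly h 0 * f p = poly g 0"
  proof (rule ccontr)
    assume "poly h 0 * f p \<noteq> poly g 0"
    then obtain t where "t \<in> T" "c t \<in> U" "poly h t * f (c t) - poly g t \<noteq> 0"
      using limit'[OF f, of h g] by auto
    with gh(1) show False by (simp add: good_def)
  qed
  have h0: "poly h 0 \<noteq> 0"
  proof
    assume h0: "poly h 0 = 0"
    with val have "poly g 0 = 0" by simp
    with h0 obtain g' h' where g': "g = [:0, 1:] * g'" "h = [:0, 1:] * h'"
      by (metis dvdE minus_zero poly_eq_0_iff_dvd)
    have h': "h' \<noteq> 0" using gh(1) g'(2) by (auto simp: good_def)
    have "poly h' t * f (c t) = poly g' t" if "t \<in> T" "c t \<in> U" for t
    proof -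
      have "t * (poly h' t * f (c t)) = t * poly g' t"
        using gh(1) that by (simp add: good_def g' mult.assoc)
      moreover have "t \<noteq> 0" using zero_notin_T that by auto
      ultimately show ?thesis by simp
    qed
    with h' have "good g' h'" by (simp add: good_def)
    moreover have "degree h = degree [:0, 1 :: complex:] + degree h'"
      unfolding g'(2) using h' by (intro degree_mult_eq) auto
    then have "degree h' < d" using gh(2) by simp
    ultimately show False using d(2) by blast
  qed
  let ?R = "\<lambda>t. poly g t / poly h t"
  have "?R field_differentiable (at 0)"
    using h0 by (intro field_differentiable_divide) (auto simp: field_differentiable_def intro: poly_DERIV)
  moreover have "\<forall>\<^sub>F t in at 0. f (c t) = ?R t"
  proof -
    have "h \<noteq> 0" using h0 by auto
    from eventually_poly_nonzero[OF this, of 0] eventually_curve[OF U f(2)] show ?thesis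
      by eventually_elim (use gh(1) in \<open>auto simp: good_def field_simps\<close>)
  qed
  ultimately have "along c f ?R" by (simp add: along_def)
  moreover have "?R 0 = f p" using val h0 by (simp add: field_simps)
  ultimately show ?thesis by blast
qed

lemma pull_along:
  assumes "i \<in> Ax" shows "\<forall>\<^sub>F t in at 0. pull i (c t) = t * q i"
  using eventually_curve[OF openin_topspace p(1)]
  by eventually_elim (use eval_\<gamma>[OF assms] lift_of_line(2) in auto)

lemma pull_not_locally_zero:
  assumes "i \<in> Ax" "openin (zariski X) V" "p \<in> V" shows "\<exists>x\<in>V. pull i x \<noteq> 0"
proof -
  have "\<forall>\<^sub>F t in at (0 :: complex). t \<noteq> 0" by (rule eventually_neq_at_within)
  with eventually_curve[OF assms(2,3)] pull_along[OF assms(1)]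
  have "\<forall>\<^sub>F t in at 0. c t \<in> V \<and> pull i (c t) \<noteq> 0"
    by eventually_elim (use q_nz[OF assms(1)] in auto)
  from eventually_happens[OF this] show ?thesis by auto
qed

end

section \<open>The block attached to the limit point\<close>

context lifted
begin

lemma chart_exists: "\<exists>U W \<phi> (\<psi> :: ('n \<Rightarrow> complex) \<Rightarrow> 'a). chart X U W \<phi> \<psi> p"
proof -
  obtain \<U> where \<U>: "\<Union>\<U> = points X"
    "\<forall>U\<in>\<U>. openin (zariski X) U \<and> affine_variety (induced_space X U) \<and>
      (\<exists>W \<phi>. openin (zariski A) W \<and> affine_variety (induced_space A W) \<and>
         isomorphism (induced_space X U) (induced_space A W) \<phi>)"
    using charts by blast
  obtain U where U: "U \<in> \<U>" "p \<in> U" using p(1) \<U>(1) by blast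
  obtain W \<phi> where W: "openin (zariski X) U" "openin (zariski A) W" "isomorphism (induced_space X U) (induced_space A W) \<phi>"
    using \<U>(2) U(1) by blast
  obtain \<psi> where "open_iso X A U W \<phi> \<psi>"
    by (rule isomorphism_open_iso[OF X sf_affine_space W])
  then have "chart X U W \<phi> \<psi> p" using X U(2) by (intro chart.intro)
  then show ?thesis by blast
qed

lemma nonintegral_block:
  obtains S where "S \<subseteq> Ax" "(\<Sum>i\<in>S. \<beta> i) \<notin> \<int>"
    "\<And>b. (\<And>x. (\<Sum>i\<in>Ax. b i * eval_poly (\<alpha> i) x) = 0) \<Longrightarrow> (\<Sum>i\<in>S. b i * q i) = 0"
proof -
  have finA: "finite Ax" and Am: "Ax \<subseteq> {1..m}" by (auto simp: Ax_def)
  obtain U W \<phi> and \<psi> :: "('n \<Rightarrow> complex) \<Rightarrow> 'a" where "chart X U W \<phi> \<psi> p" using chart_exists by blast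
  then interpret ch: chart X U W \<phi> \<psi> p .
  define \<D> where "\<D> = {D \<in> comps. p \<in> D}"
  have fin_comps: "finite comps" by simp
  then have fin: "finite \<D>" unfolding \<D>_def by (rule rev_finite_subset) blast
  have prime: "prime_divisor X D" if "D \<in> \<D>" for D using that comps_prime by (simp add: \<D>_def)
  have irr: "irreducible_set (zariski X) D" if "D \<in> \<D>" for D using prime_irr[OF prime[OF that]] .
  have pD: "p \<in> D" if "D \<in> \<D>" for D using that by (simp add: \<D>_def)
  obtain ts \<iota> where ts: "regular_parameters X p ts" and inj: "inj_on \<iota> \<D>"
    and NC: "\<And>D. D \<in> \<D> \<Longrightarrow> \<iota> D < length ts \<and> local_equation X p D (ts ! \<iota> D)"
    using crossing p(1) unfolding normal_crossing_at_def \<D>_def by (metis (no_types, lifting) mem_Collect_eq)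
  have gen: "generates_ideal X {p} ts (vanishing_ideal X {p} {p})"
    using ts by (simp add: regular_parameters_def)
  have indep: "b l = 0" if "\<And>j. (\<Sum>l<length ts. b l * ch.dd j (ts ! l)) = 0" "l < length ts" for b l
    by (rule ch.parameters_independent[OF ts that])
  have "\<exists>V. ts ! l \<in> regular X V \<and> p \<in> V \<and> (ts ! l) p = 0" if "l < length ts" for l
  proof -
    have "ts ! l \<in> vanishing_ideal X {p} {p}" using gen that by (auto simp: generates_ideal_def)
    then show ?thesis by (auto simp: vanishing_ideal_def germs_def)
  qed
  then obtain V where V: "\<And>l. l < length ts \<Longrightarrow> ts ! l \<in> regular X (V l) \<and> p \<in> V l \<and> (ts ! l) p = 0" by metis
  have "\<exists>R. along c (ts ! l) R \<and> R 0 = 0" if "l < length ts" for l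
    using along_curve[of "ts ! l" "V l"] V[OF that] by auto
  then obtain Rt where Rt: "\<And>l. l < length ts \<Longrightarrow> along c (ts ! l) (Rt l) \<and> Rt l 0 = 0" by metis
  have pull0: "pull i p = 0" if "i \<in> Ax" for i using that p(2) by (simp add: Ax_def)
  have q_diff: "(\<lambda>t. t * q i) field_differentiable (at 0)" "deriv (\<lambda>t. t * q i) 0 = q i" for i
  proof -
    have "((\<lambda>t. t * q i) has_field_derivative q i) (at 0)" by (auto intro!: derivative_eq_intros)
    then show "(\<lambda>t. t * q i) field_differentiable (at 0)" "deriv (\<lambda>t. t * q i) 0 = q i"
      by (auto simp: field_differentiable_def DERIV_imp_deriv)
  qed
  \<comment> \<open>With zero differential, independence would make every coefficient
    \<open>b l\<close> vanish at \<open>p\<close>; each product with a parameter would then have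
    order at least two along the lift, against the slope \<open>q i\<close>.\<close>
  have dd_pull: "\<exists>j. ch.dd j (pull i) \<noteq> 0" if i: "i \<in> Ax" for i
  proof (rule ccontr)
    assume n: "\<nexists>j. ch.dd j (pull i) \<noteq> 0"
    have "pull i \<in> germs X {p}" unfolding germs_def using pull_regular[of i] p(1) by blast
    then have "pull i \<in> vanishing_ideal X {p} {p}"
      unfolding vanishing_ideal_def using pull0[OF i] p(1) by (auto intro!: exI[of _ "points X"])
    with gen obtain b where b: "\<forall>l<length ts. b l \<in> germs X {p}"
      "germ_eq X {p} (pull i) (\<lambda>x. \<Sum>l<length ts. b l x * (ts ! l) x)"
      unfolding generates_ideal_def by blast
    obtain O' where O': "openin (zariski X) O'" "p \<in> O'" "\<And>x. x \<in> O' \<Longrightarrow> pull i x = (\<Sum>l<length ts. b l x * (ts ! l) x)"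
      using b(2) unfolding germ_eq_def by auto
    obtain V' where V': "\<And>l. l < length ts \<Longrightarrow> b l \<in> regular X (V' l) \<and> p \<in> V' l"
      using b(1) unfolding germs_def by simp metis
    have "(\<Sum>l<length ts. b l p * ch.dd j (ts ! l)) = 0" for j
    proof -
      have "0 = ch.dd j (pull i)" using n by simp
      also have "\<dots> = ch.dd j (\<lambda>x. \<Sum>l<length ts. b l x * (ts ! l) x)" by (rule ch.dd_cong[OF O'])
      also have "\<dots> = (\<Sum>l<length ts. ch.dd j (b l) * (ts ! l) p + b l p * ch.dd j (ts ! l))"
        by (rule ch.dd_sum_mult[where V = V' and V' = V]) (use V V' in auto)
      also have "\<dots> = (\<Sum>l<length ts. b l p * ch.dd j (ts ! l))" by (rule sum.cong) (use V in auto)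
      finally show ?thesis by simp
    qed
    then have b0: "b l p = 0" if "l < length ts" for l using indep[of "\<lambda>l. b l p"] that by blast
    have "\<exists>R. along c (b l) R \<and> R 0 = 0" if "l < length ts" for l
      using along_curve[of "b l" "V' l"] V'[OF that] b0[OF that] by auto
    then obtain Rb where Rb: "\<And>l. l < length ts \<Longrightarrow> along c (b l) (Rb l) \<and> Rb l 0 = 0" by metis
    let ?S = "\<lambda>t. \<Sum>l<length ts. Rb l t * Rt l t"
    have S: "(?S has_field_derivative (\<Sum>l<length ts. 0)) (at 0)"
    proof (rule DERIV_sum)
      fix l assume "l \<in> {..<length ts}"
      then have l: "l < length ts" by simp
      have "(Rb l has_field_derivative deriv (Rb l) 0) (at 0)" "(Rt l has_field_derivative deriv (Rt l) 0) (at 0)"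
        using Rb[OF l] Rt[OF l] by (auto simp: along_def field_differentiable_derivI)
      from DERIV_mult[OF this] Rb[OF l] Rt[OF l]
      show "((\<lambda>t. Rb l t * Rt l t) has_field_derivative 0) (at 0)" by simp
    qed
    then have S': "?S field_differentiable (at 0)" "deriv ?S 0 = 0"
      by (auto simp: field_differentiable_def DERIV_imp_deriv)
    have "\<forall>\<^sub>F t in at 0. \<forall>l\<in>{..<length ts}. b l (c t) = Rb l t \<and> (ts ! l) (c t) = Rt l t"
      by (rule eventually_ball_finite) (use Rb Rt in \<open>auto simp: along_def eventually_conj_iff\<close>)
    with pull_along[OF i] eventually_curve[OF O'(1,2)] have "\<forall>\<^sub>F t in at 0. t * q i = ?S t"
      by eventually_elim (use O'(3) in auto)
    from eventually_eq_deriv(2)[OF q_diff(1) S'(1) this] have "q i = 0" by (simp only: q_diff S'(2))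
    with q_nz[OF i] show False ..
  qed
  define t where "t D = ts ! \<iota> D" for D
  have t: "\<exists>T. t D \<in> regular X T \<and> p \<in> T \<and> (\<forall>x\<in>D \<inter> T. t D x = 0)" if "D \<in> \<D>" for D
    using ch.local_equationD[of D "t D"] NC[OF that] unfolding t_def by metis
  then obtain TD where TD: "\<And>D. D \<in> \<D> \<Longrightarrow> t D \<in> regular X (TD D) \<and> p \<in> TD D \<and> (\<forall>x\<in>D \<inter> TD D. t D x = 0)" by metis
  have t_nz: "\<exists>x\<in>V. t D x \<noteq> 0" if D: "D \<in> \<D>" and V: "openin (zariski X) V" "p \<in> V" for D V
  proof (rule ccontr)
    assume "\<not> (\<exists>x\<in>V. t D x \<noteq> 0)"
    then have "ch.dd j (t D) = ch.dd j (\<lambda>_. 0)" for j by (intro ch.dd_cong[OF V]) auto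
    then have "(\<Sum>l<length ts. of_bool (l = \<iota> D) * ch.dd j (ts ! l)) = 0" for j
      using NC[OF D] by (simp add: t_def ch.dd_def of_bool_def if_distrib[of "\<lambda>z. z * _"] cong: if_cong)
    from indep[OF this, of "\<iota> D"] NC[OF D] show False by simp
  qed
  have cover: "\<exists>D\<in>\<D>. \<forall>x\<in>D. pull i x = 0" if i: "i \<in> Ax" for i
  proof -
    \<comment> \<open>Discarding the finitely many components that miss \<open>p\<close> leaves a
      neighbourhood where the preimage of the arrangement is covered by \<open>\<D>\<close>.\<close>
    define V0 where "V0 = points X - \<Union>{D \<in> comps. p \<notin> D}"
    have "closedin (zariski X) (\<Union>{D \<in> comps. p \<notin> D})"
      using fin_comps comps_prime prime_closed by (intro closedin_Union) (auto simp del: Un_iff)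
    then have V0: "openin (zariski X) V0" unfolding V0_def by (intro openin_diff openin_topspace)
    have pV0: "p \<in> V0" using p(1) by (auto simp: V0_def)
    have "x \<in> \<Union>\<D>" if x: "x \<in> V0" "pull i x = 0" for x
    proof -
      have "eval_poly a (\<pi> x) = 0" using x(2) finA i Am by (auto simp: a_def eval_poly_prod)
      then have "x \<in> {x \<in> points X. \<pi> x \<in> zero_locus a}" using x(1) by (simp add: V0_def zero_locus_def)
      then obtain C where C: "C \<in> irreducible_components (zariski X) {x \<in> points X. \<pi> x \<in> zero_locus a}" "x \<in> C"
        by (rule irreducible_component_exists) auto
      have "C \<in> comps" using preimage_components C(1) by (rule subsetD)
      moreover have "p \<in> C" using x(1) C(2) \<open>C \<in> comps\<close> unfolding V0_def by blast
      ultimately show ?thesis using C(2) unfolding \<D>_def by blast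
    qed
    note * = this
    obtain j where "ch.dd j (pull i) \<noteq> 0" using dd_pull[OF i] by blast
    from ch.vanishes_on_component[OF pull_regular p(1) pull0[OF i] this fin irr pD TD t_nz V0 pV0 *]
    obtain D where D: "D \<in> \<D>" "\<forall>x\<in>D \<inter> points X. pull i x = 0" by blast
    have "D \<subseteq> points X" using irr[OF D(1)] by (simp add: irreducible_set_def)
    with D show ?thesis by blast
  qed
  \<comment> \<open>To first order along the lift, \<open>q i\<close> is \<open>u p\<close> times
    the derivative of the local equation; being nonzero, it makes \<open>u\<close> a unit at
    \<open>p\<close>.\<close>
  have factor: "\<exists>u V. u \<in> regular X V \<and> p \<in> V \<and> (\<forall>x\<in>V. pull i x = u x * t D x) \<and> u p \<noteq> 0 \<and>
      q i = u p * deriv (Rt (\<iota> D)) 0"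
    if i: "i \<in> Ax" and D: "D \<in> \<D>" "\<forall>x\<in>D. pull i x = 0" for i D
  proof -
    have l: "\<iota> D < length ts" "local_equation X p D (t D)" using NC[OF D(1)] by (simp_all add: t_def)
    obtain u V' where u: "u \<in> regular X V'" "p \<in> V'" "\<And>x. x \<in> V' \<Longrightarrow> pull i x = u x * t D x"
      using ch.local_equation_divides[OF l(2) pull_regular p(1), of i] D(2) by (metis IntD1)
    obtain R where R: "along c u R" "R 0 = u p" using along_curve[OF u(1,2)] by blast
    have "(R has_field_derivative deriv R 0) (at 0)" "(Rt (\<iota> D) has_field_derivative deriv (Rt (\<iota> D)) 0) (at 0)"
      using R Rt[OF l(1)] by (auto simp: along_def field_differentiable_derivI)
    from DERIV_mult[OF this] have d: "((\<lambda>z. R z * Rt (\<iota> D) z) has_field_derivative u p * deriv (Rt (\<iota> D)) 0) (at 0)"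
      using R(2) Rt[OF l(1)] by (simp add: mult.commute)
    then have d': "(\<lambda>z. R z * Rt (\<iota> D) z) field_differentiable (at 0)" "deriv (\<lambda>z. R z * Rt (\<iota> D) z) 0 = u p * deriv (Rt (\<iota> D)) 0"
      by (auto simp: field_differentiable_def DERIV_imp_deriv)
    have "\<forall>\<^sub>F z in at 0. u (c z) = R z" "\<forall>\<^sub>F z in at 0. t D (c z) = Rt (\<iota> D) z"
      using R(1) Rt[OF l(1)] by (simp_all add: along_def t_def)
    with pull_along[OF i] eventually_curve[OF sf_open[OF X u(1)] u(2)] have "\<forall>\<^sub>F z in at 0. z * q i = R z * Rt (\<iota> D) z"
      by eventually_elim (use u(3) in auto)
    from eventually_eq_deriv(2)[OF q_diff(1) d'(1) this] have e: "q i = u p * deriv (Rt (\<iota> D)) 0"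
      by (simp only: q_diff d'(2))
    with q_nz[OF i] have "u p \<noteq> 0" by auto
    with u e show ?thesis by blast
  qed
  obtain i0 where i0: "i0 \<in> Ax" using through by (auto simp: Ax_def)
  obtain D0 where D0: "D0 \<in> \<D>" "\<forall>x\<in>D0. pull i0 x = 0" using cover[OF i0] by blast
  \<comment> \<open>These are the forms whose pullback has positive order along \<open>D0\<close>,
    which ties the block to the multiplicities.\<close>
  define S where "S = {i \<in> {1..m}. \<forall>x\<in>D0. pull i x = 0}"
  have SA: "S \<subseteq> Ax" using pD[OF D0(1)] p(2) by (auto simp: S_def Ax_def)
  have l0: "\<iota> D0 < length ts" "local_equation X p D0 (t D0)" using NC[OF D0(1)] by (simp_all add: t_def)
  \<comment> \<open>One component is chosen for each form, \<open>D0\<close> whenever possible, so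
    that grouping by components returns exactly \<open>S\<close>.\<close>
  have "\<exists>D. D \<in> \<D> \<and> (\<forall>x\<in>D. pull i x = 0) \<and> (D = D0 \<longleftrightarrow> i \<in> S)" if i: "i \<in> Ax" for i
  proof (cases "i \<in> S")
    case True
    then show ?thesis using D0(1) by (intro exI[of _ D0]) (auto simp: S_def)
  next
    case False
    obtain D where D: "D \<in> \<D>" "\<forall>x\<in>D. pull i x = 0" using cover[OF i] by blast
    with False i Am have "D \<noteq> D0" by (auto simp: S_def)
    with D False show ?thesis by blast
  qed
  then obtain Di where Di: "\<And>i. i \<in> Ax \<Longrightarrow> Di i \<in> \<D> \<and> (\<forall>x\<in>Di i. pull i x = 0) \<and> (Di i = D0 \<longleftrightarrow> i \<in> S)" by metis
  define fac where "fac i u V \<longleftrightarrow> u \<in> regular X V \<and> p \<in> V \<and> (\<forall>x\<in>V. pull i x = u x * t (Di i) x) \<and>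
    u p \<noteq> 0 \<and> q i = u p * deriv (Rt (\<iota> (Di i))) 0" for i u V
  have "\<forall>i\<in>Ax. \<exists>u V. fac i u V" unfolding fac_def using factor Di by blast
  from bchoice[OF this] obtain u where "\<forall>i\<in>Ax. \<exists>V. fac i (u i) V" ..
  from bchoice[OF this] obtain Vu where "\<forall>i\<in>Ax. fac i (u i) (Vu i)" ..
  then have u: "u i \<in> regular X (Vu i) \<and> p \<in> Vu i \<and> (\<forall>x\<in>Vu i. pull i x = u i x * t (Di i) x) \<and>
      u i p \<noteq> 0 \<and> q i = u i p * deriv (Rt (\<iota> (Di i))) 0" if "i \<in> Ax" for i
    using that unfolding fac_def by (rule bspec)
  show thesis
  proof (rule that[of S])
    show "S \<subseteq> Ax" by (rule SA)
    show "(\<Sum>i\<in>S. b i * q i) = 0" if rel: "\<And>x. (\<Sum>i\<in>Ax. b i * eval_poly (\<alpha> i) x) = 0" for b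
    proof -
      define V1 where "V1 = \<Inter>(Vu ` Ax)"
      have V1: "openin (zariski X) V1" unfolding V1_def
        by (rule openin_Inter) (use finA i0 u sf_open[OF X] in blast)+
      have pV1: "p \<in> V1" using u by (auto simp: V1_def)
      have z: "(\<Sum>i\<in>Ax. (b i * u i x) * t (Di i) x) = 0" if "x \<in> V1" for x
      proof -
        have "(\<Sum>i\<in>Ax. (b i * u i x) * t (Di i) x) = (\<Sum>i\<in>Ax. b i * pull i x)"
          using u that by (intro sum.cong HOL.refl) (auto simp: V1_def)
        with rel show ?thesis by simp
      qed
      define w where "w i = b i * u i p" for i
      have "(\<Sum>i\<in>Ax. w i * ch.dd j (t (Di i))) = 0" for j
      proof -
        have "ch.dd j (\<lambda>x. \<Sum>i\<in>Ax. (b i * u i x) * t (Di i) x) = ch.dd j (\<lambda>_. 0)"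
          by (rule ch.dd_cong[OF V1 pV1]) (use z in simp)
        also have "\<dots> = 0" by (simp add: ch.dd_def)
        finally have 0: "ch.dd j (\<lambda>x. \<Sum>i\<in>Ax. (b i * u i x) * t (Di i) x) = 0" .
        have "ch.dd j (\<lambda>x. \<Sum>i\<in>Ax. (b i * u i x) * t (Di i) x)
            = (\<Sum>i\<in>Ax. ch.dd j (\<lambda>x. b i * u i x) * t (Di i) p + (b i * u i p) * ch.dd j (t (Di i)))"
        proof (rule ch.dd_sum_mult[OF finA, where V = Vu and V' = "\<lambda>i. TD (Di i)"])
          fix i assume i: "i \<in> Ax"
          show "(\<lambda>x. b i * u i x) \<in> regular X (Vu i) \<and> p \<in> Vu i"
          proof
            have ui: "u i \<in> regular X (Vu i)" and pi: "p \<in> Vu i" using u[OF i] by auto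
            show "(\<lambda>x. b i * u i x) \<in> regular X (Vu i)"
              by (rule sf_mult[OF X sf_const[OF X sf_open[OF X ui]] ui])
            show "p \<in> Vu i" by (rule pi)
          qed
          show "t (Di i) \<in> regular X (TD (Di i)) \<and> p \<in> TD (Di i)" using TD Di[OF i] by blast
        qed
        also have "\<dots> = (\<Sum>i\<in>Ax. w i * ch.dd j (t (Di i)))"
          using TD Di pD by (intro sum.cong HOL.refl) (fastforce simp: w_def)
        finally show ?thesis using 0 by simp
      qed
      \<comment> \<open>Grouping by parameter lets independence of the differentials isolate the
        terms that belong to \<open>D0\<close>.\<close>
      moreover have "(\<Sum>l<length ts. (\<Sum>i\<in>{i \<in> Ax. \<iota> (Di i) = l}. w i) * ch.dd j (ts ! l))
          = (\<Sum>i\<in>Ax. w i * ch.dd j (t (Di i)))" for j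
      proof -
        have "(\<Sum>l<length ts. (\<Sum>i\<in>{i \<in> Ax. \<iota> (Di i) = l}. w i) * ch.dd j (ts ! l))
            = (\<Sum>l<length ts. \<Sum>i\<in>{i \<in> Ax. \<iota> (Di i) = l}. w i * ch.dd j (t (Di i)))"
          by (simp add: sum_distrib_right t_def)
        also have "\<dots> = (\<Sum>i\<in>Ax. w i * ch.dd j (t (Di i)))"
          by (rule sum.group) (use finA NC Di in auto)
        finally show ?thesis .
      qed
      ultimately have "(\<Sum>i\<in>{i \<in> Ax. \<iota> (Di i) = \<iota> D0}. w i) = 0"
        using indep[of "\<lambda>l. \<Sum>i\<in>{i \<in> Ax. \<iota> (Di i) = l}. w i", OF _ l0(1)] by simp
      moreover have "{i \<in> Ax. \<iota> (Di i) = \<iota> D0} = S"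
        using SA Di D0(1) inj by (auto dest: inj_onD)
      ultimately have "(\<Sum>i\<in>S. w i) * deriv (Rt (\<iota> D0)) 0 = 0" by simp
      \<comment> \<open>On \<open>S\<close> all the slopes share the derivative of one local
        equation, which converts unit values into slopes.\<close>
      moreover have "b i * q i = w i * deriv (Rt (\<iota> D0)) 0" if "i \<in> S" for i
      proof -
        have "i \<in> Ax" using SA that by blast
        then show ?thesis using u[of i] Di[of i] that by (simp add: w_def)
      qed
      ultimately show ?thesis by (simp add: sum_distrib_right)
    qed
    have ord: "vanishing_order X D0 (pull i) = of_bool (i \<in> S)" if i: "i \<in> {1..m}" for i
    proof (cases "i \<in> S")
      case True
      then have iA: "i \<in> Ax" using SA by blast
      then have "Di i = D0" using Di True by blast
      then have ui: "u i \<in> regular X (Vu i)" "p \<in> Vu i" "u i p \<noteq> 0" "\<And>x. x \<in> Vu i \<Longrightarrow> pull i x = u i x * t D0 x"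
        using u[OF iA] by auto
      have "vanishing_order X D0 (pull i) = 1"
        by (rule ch.vanishing_order_eq_1[OF l0(2) irr[OF D0(1)] pD[OF D0(1)] pull_regular irrX ui pull_not_locally_zero[OF iA]])
      with True show ?thesis by simp
    next
      case False
      with i obtain y where "y \<in> D0" "pull i y \<noteq> 0" by (auto simp: S_def)
      from ch.vanishing_order_eq_0[OF l0(2) irr[OF D0(1)] pD[OF D0(1)] pull_regular this] False
      show ?thesis by simp
    qed
    have "D0 \<in> comps" using D0(1) by (simp add: \<D>_def)
    then consider (PT) l where "l \<in> {1..m}" "D0 = PT l" | (E) j where "j \<in> {1..s}" "D0 = E j" by blast
    then show "(\<Sum>i\<in>S. \<beta> i) \<notin> \<int>"
    proof cases
      case PT
      have "S = {l}"
        using hyperplanes_distinct[OF _ PT(1)] PT PT_vanishes[of _ l] unfolding S_def by auto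
      then show ?thesis using nonint_hyperplane[OF PT(1)] by simp
    next
      case E
      have "r i j = of_bool (i \<in> S)" if i: "i \<in> {1..m}" for i
      proof -
        have "(\<Sum>j' = 1..s. r i j' * of_bool (E j = E j')) = (\<Sum>j' = 1..s. if j' = j then r i j else 0)"
          using inj_E E(1) by (intro sum.cong HOL.refl) (auto dest: inj_onD)
        also have "\<dots> = r i j" using E(1) by simp
        finally have "divisor_of X (pull i) D0 = r i j"
          using fun_cong[OF multiplicities[OF i], of D0] PT_ne_E[OF i E(1)] E(2) by auto
        then show ?thesis using prime[OF D0(1)] ord[OF i] by (simp add: divisor_of_def)
      qed
      then have "(\<Sum>i = 1..m. of_int (r i j) * \<beta> i) = (\<Sum>i = 1..m. if i \<in> S then \<beta> i else 0)"
        by (intro sum.cong HOL.refl) auto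
      also have "\<dots> = (\<Sum>i\<in>S. \<beta> i)"
      proof -
        have "{1..m} \<inter> S = S" by (auto simp: S_def)
        then show ?thesis by (simp flip: sum.inter_restrict)
      qed
      finally show ?thesis using nonint_exceptional[OF E(1)] by simp
    qed
  qed
qed

end

lemma (in arrangement_resolution) nonintegral_block_at:
  fixes x0 :: "'n \<Rightarrow> complex"
  defines "B \<equiv> {i \<in> {1..m}. eval_poly (\<alpha> i) x0 = 0}"
  assumes ne: "B \<noteq> {}"
  shows "\<exists>S \<subseteq> B. (\<Sum>i\<in>S. \<beta> i) \<notin> \<int> \<and>
    vec.span ((\<lambda>i. lin (\<alpha> i)) ` S) \<inter> vec.span ((\<lambda>i. lin (\<alpha> i)) ` (B - S)) \<subseteq> {0}"
proof -
  have finB: "finite B" and Bm: "B \<subseteq> {1..m}" by (auto simp: B_def)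
  define Y where "Y S = vec.span ((\<lambda>i. lin (\<alpha> i)) ` S) \<inter> vec.span ((\<lambda>i. lin (\<alpha> i)) ` (B - S))" for S
  have "\<exists>w. w \<noteq> 0 \<and> (\<not> Y S \<subseteq> {0} \<longrightarrow> w \<in> Y S)" for S
  proof (cases "Y S \<subseteq> {0}")
    case True
    then show ?thesis by (intro exI[of _ "axis undefined 1"]) (simp add: axis_eq_0_iff)
  qed blast
  \<comment> \<open>The direction \<open>v\<close> has to detect one nonzero vector of each nonzero intersection of spans.\<close>
  then obtain w where w: "\<And>S. w S \<noteq> 0" "\<And>S. \<not> Y S \<subseteq> {0} \<Longrightarrow> w S \<in> Y S" by metis
  have "finite ((\<lambda>i. lin (\<alpha> i)) ` B \<union> w ` Pow B)" using finB by simp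
  moreover have "u \<noteq> 0" if "u \<in> (\<lambda>i. lin (\<alpha> i)) ` B \<union> w ` Pow B" for u
    using that w(1) Bm lin_nonzero[OF degree_one] by fastforce
  ultimately have "\<exists>v. \<forall>u\<in>(\<lambda>i. lin (\<alpha> i)) ` B \<union> w ` Pow B. pair u v \<noteq> 0"
    by (rule common_nonzero_vector)
  then obtain v where v: "\<And>u. u \<in> (\<lambda>i. lin (\<alpha> i)) ` B \<union> w ` Pow B \<Longrightarrow> pair u v \<noteq> 0" by blast
  let ?l = "line_poly x0 (\<lambda>i. v $ i)"
  have shift: "eval_poly (\<alpha> i) (\<lambda>j. x0 j + y $ j) = eval_poly (\<alpha> i) x0 + pair (lin (\<alpha> i)) y" if "i \<in> {1..m}" for i y
    by (rule eval_poly_shift[OF degree_one[OF that]])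
  \<comment> \<open>A hyperplane through \<open>x0\<close> is left because of its nonzero slope, and
    any other does not contain \<open>x0\<close>; so the line meets the arrangement in finitely many
    points.\<close>
  have "?l (\<alpha> i) \<noteq> 0" if i: "i \<in> {1..m}" for i
  proof
    assume "?l (\<alpha> i) = 0"
    then have z: "eval_poly (\<alpha> i) (\<lambda>j. x0 j + t * v $ j) = 0" for t by (metis poly_0 poly_line_poly)
    have "eval_poly (\<alpha> i) x0 = 0" using z[of 0] by simp
    moreover from this have "pair (lin (\<alpha> i)) v = 0" using z[of 1] shift[OF i, of v] by simp
    ultimately show False using v[of "lin (\<alpha> i)"] i by (auto simp: B_def)
  qed
  then have "(\<Prod>i = 1..m. ?l (\<alpha> i)) \<noteq> 0" by simp
  then have "finite {t. poly (\<Prod>i = 1..m. ?l (\<alpha> i)) t = 0}" by (rule poly_roots_finite)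
  moreover have "poly (\<Prod>i = 1..m. ?l (\<alpha> i)) t = eval_poly a (\<lambda>i. x0 i + t * v $ i)" for t
    by (simp add: poly_prod a_def eval_poly_prod)
  moreover define T where "T = {t. eval_poly a (\<lambda>i. x0 i + t * v $ i) \<noteq> 0}"
  ultimately have "finite (- T)" by (simp add: Collect_neg_eq)
  then have T: "infinite T" using infinite_UNIV_char_0[where 'a = complex] finite_Un[of T "- T"] by auto
  have cT: "\<sigma> (\<lambda>i. x0 i + t * v $ i) \<in> points X \<and> \<pi> (\<sigma> (\<lambda>i. x0 i + t * v $ i)) = (\<lambda>i. x0 i + t * v $ i)"
    if "t \<in> T" for t
  proof -
    have "(\<lambda>i. x0 i + t * v $ i) \<in> UNIV - Z" using Z_sub that by (auto simp: T_def zero_locus_def)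
    from open_iso_maps(2)[OF \<sigma> this] open_iso_inverse(2)[OF \<sigma> this] show ?thesis by blast
  qed
  have "\<exists>p. p \<in> points X \<and> \<pi> p = x0 \<and> (\<forall>U f g h. f \<in> regular X U \<longrightarrow> p \<in> U \<longrightarrow> poly h 0 * f p - poly g 0 \<noteq> 0 \<longrightarrow>
       (\<exists>t\<in>T. \<sigma> (\<lambda>i. x0 i + t * v $ i) \<in> U \<and> poly h t * f (\<sigma> (\<lambda>i. x0 i + t * v $ i)) - poly g t \<noteq> 0))"
    by (rule curve_limit_exists[OF X proper cT T])
  then obtain p where p: "p \<in> points X" "\<pi> p = x0" and lim: "\<forall>U f g h. f \<in> regular X U \<longrightarrow> p \<in> U \<longrightarrow> poly h 0 * f p - poly g 0 \<noteq> 0 \<longrightarrow>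
       (\<exists>t\<in>T. \<sigma> (\<lambda>i. x0 i + t * v $ i) \<in> U \<and> poly h t * f (\<sigma> (\<lambda>i. x0 i + t * v $ i)) - poly g t \<noteq> 0)"
    by (elim exE conjE)
  interpret lifted m \<alpha> \<beta> X \<pi> s E r x0 v p
  proof unfold_locales
    show "{i \<in> {1..m}. eval_poly (\<alpha> i) x0 = 0} \<noteq> {}" using ne by (simp add: B_def)
    show "pair (lin (\<alpha> i)) v \<noteq> 0" if "i \<in> {1..m}" "eval_poly (\<alpha> i) x0 = 0" for i
      using v[of "lin (\<alpha> i)"] that by (auto simp: B_def)
    show "p \<in> points X" "\<pi> p = x0" by (fact p)+
  qed (use lim in \<open>simp add: T_def\<close>)
  have Ax: "Ax = B" by (simp add: Ax_def B_def)
  obtain S where S: "S \<subseteq> B" "(\<Sum>i\<in>S. \<beta> i) \<notin> \<int>"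
    and rel: "\<And>b. (\<And>x. (\<Sum>i\<in>B. b i * eval_poly (\<alpha> i) x) = 0) \<Longrightarrow> (\<Sum>i\<in>S. b i * q i) = 0"
    using nonintegral_block unfolding Ax by blast
  have finS: "finite S" "finite (B - S)" using S(1) finB finite_subset by auto
  \<comment> \<open>If the spans met, writing \<open>w S\<close> once over \<open>S\<close> and once
    over \<open>B - S\<close> would give a relation between the forms in \<open>B\<close>, and
    \<open>rel\<close> would turn it into \<open>pair (w S) v = 0\<close>, which the choice of
    \<open>v\<close> excludes.\<close>
  have "Y S \<subseteq> {0}"
  proof (rule ccontr)
    assume "\<not> Y S \<subseteq> {0}"
    then have wY: "w S \<in> Y S" by (rule w(2))
    obtain b where b: "w S = (\<Sum>i\<in>S. b i *s lin (\<alpha> i))"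
      using wY span_image_obtains_coeffs[OF finS(1), of "w S"] unfolding Y_def by blast
    obtain d where d: "w S = (\<Sum>i\<in>B - S. d i *s lin (\<alpha> i))"
      using wY span_image_obtains_coeffs[OF finS(2), of "w S"] unfolding Y_def by blast
    define e where "e i = (if i \<in> S then b i else - d i)" for i
    have "(\<Sum>i\<in>B. e i * eval_poly (\<alpha> i) x) = 0" for x
    proof -
      let ?y = "\<chi> j. x j - x0 j"
      have ev: "eval_poly (\<alpha> i) x = pair (lin (\<alpha> i)) ?y" if "i \<in> B" for i
        using shift[of i ?y] that by (simp add: B_def)
      have "(\<Sum>i\<in>B. e i * eval_poly (\<alpha> i) x) = (\<Sum>i\<in>B. e i * pair (lin (\<alpha> i)) ?y)"
        by (rule sum.cong) (simp_all add: ev)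
      also have "\<dots> = (\<Sum>i\<in>B - S. e i * pair (lin (\<alpha> i)) ?y) + (\<Sum>i\<in>S. e i * pair (lin (\<alpha> i)) ?y)"
        by (rule sum.subset_diff[OF S(1) finB])
      also have "(\<Sum>i\<in>S. e i * pair (lin (\<alpha> i)) ?y) = pair (w S) ?y"
        unfolding b pair_sum_left pair_scale_left by (rule sum.cong) (simp_all add: e_def)
      also have "(\<Sum>i\<in>B - S. e i * pair (lin (\<alpha> i)) ?y) = - pair (w S) ?y"
        unfolding d pair_sum_left pair_scale_left sum_negf[symmetric] by (rule sum.cong) (simp_all add: e_def)
      finally show ?thesis by simp
    qed
    then have "(\<Sum>i\<in>S. e i * q i) = 0" by (rule rel)
    moreover have "(\<Sum>i\<in>S. e i * q i) = pair (w S) v"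
      unfolding b pair_sum_left pair_scale_left by (rule sum.cong) (simp_all add: e_def q_def)
    ultimately have "pair (w S) v = 0" by simp
    moreover have "w S \<in> (\<lambda>i. lin (\<alpha> i)) ` B \<union> w ` Pow B" using S(1) by blast
    ultimately show False using v by blast
  qed
  with S show ?thesis unfolding Y_def by blast
qed

theorem theorem5p4:
  fixes m s :: nat
    and \<alpha> :: "nat \<Rightarrow> 'n::{finite,linorder} mpoly"
    and \<beta> :: "nat \<Rightarrow> complex"
    and X :: "'a ringed_space" and \<pi> :: "'a \<Rightarrow> 'n \<Rightarrow> complex"
    and E :: "nat \<Rightarrow> 'a set" and r :: "nat \<Rightarrow> nat \<Rightarrow> int"
  assumes degree_one: "\<And>i. i \<in> {1..m} \<Longrightarrow> total_degree (\<alpha> i) = 1"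
    and distinct: "inj_on (\<lambda>i. zero_locus (\<alpha> i)) {1..m}"
    and resolution: "resolution_of_singularities m \<alpha> X \<pi> s E"
    and multiplicities: "\<And>i. i \<in> {1..m} \<Longrightarrow>
      divisor_of X (\<lambda>x. eval_poly (\<alpha> i) (\<pi> x)) =
      (\<lambda>D. of_bool (D = proper_transform X (affine_space UNIV) \<pi> (zero_locus (\<alpha> i))) +
           (\<Sum>j = 1..s. r i j * of_bool (D = E j)))"
    and nonint_hyperplane: "\<And>i. i \<in> {1..m} \<Longrightarrow> \<beta> i \<notin> \<int>"
    and nonint_exceptional: "\<And>j. j \<in> {1..s} \<Longrightarrow> (\<Sum>i = 1..m. of_int (r i j) * \<beta> i) \<notin> \<int>"
  shows "irreducible_module (weyl_action m \<alpha> \<beta>) (localization (\<Prod>i = 1..m. \<alpha> i))"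
proof -
  interpret arrangement_resolution m \<alpha> \<beta> X \<pi> s E r
    by unfold_locales (fact assms)+
  show ?thesis by (rule irreducible_if_nonintegral_blocks[OF nonintegral_block_at])
qed

end
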